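(* Fix $\alpha>0$. Let $\mathbf{u}_h=\tfrac12\nabla^\perp h\in W^{3,2}_{\mathrm{div}}(\mathbb{T}^2;\mathbb{R}^2)$, $f\in W^{2,2}(\mathbb{T}^2)$ and $(b_0,\omega_0)\in\mathcal{M}=W^{3,2}(\mathbb{T}^2)\times W^{2,2}(\mathbb{T}^2)$, and let $(b^\alpha,\omega^\alpha,T^\alpha_{\max})$ be a maximal solution of the $\alpha$-TQG system with data $\mathbf{u}_h,f$ and initial condition $(b_0,\omega_0)$, with associated velocity $\mathbf{u}^\alpha=\nabla^\perp(1-\alpha\Delta)^{-1}(\Delta-1)^{-1}(\omega^\alpha-f)$. If $T^\alpha_{\max}<\infty$, then $$\int_0^{T^\alpha_{\max}}\|\nabla\mathbf{u}^\alpha(t)\|_{\infty}\,dt=\infty.$$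
   Context: $\mathbb{T}^2$ is the two-dimensional flat torus, $\nabla^\perp=(-\partial_y,\partial_x)$, $W^{k,2}(\mathbb{T}^2)$ are the usual $L^2$-based Sobolev spaces with norm $\|\cdot\|_{k,2}$, $\|\cdot\|_\infty$ is the $L^\infty(\mathbb{T}^2)$ norm, and $W^{k,2}_{\mathrm{div}}(\mathbb{T}^2;\mathbb{R}^2)$ is the space of weakly divergence-free vector fields in $W^{k,2}$. $\mathcal{M}=W^{3,2}(\mathbb{T}^2)\times W^{2,2}(\mathbb{T}^2)$ has norm $\|(b,\omega)\|_{\mathcal{M}}=\|b\|_{3,2}+\|\omega\|_{2,2}$. Standing assumption: all functions under consideration have zero average over $\mathbb{T}^2$. The $\alpha$-TQG system ($\alpha>0$) for $(b^\alpha,\omega^\alpha)$ is $$\partial_t b^\alpha+\mathbf{u}^\alpha\cdot\nabla b^\alpha=0,\qquad \partial_t\omega^\alpha+\mathbf{u}^\alpha\cdot\nabla(\omega^\alpha-b^\alpha)=-\mathbf{u}_h\cdot\nabla b^\alpha,$$ $$\mathbf{u}^\alpha=\nabla^\perp\psi^\alpha,\qquad \mathbf{u}_h=\tfrac12\nabla^\perp h,\qquad \omega^\alpha=(\Delta-1)(1-\alpha\Delta)\psi^\alpha+f,$$ where $h$ and $f$ are given time-independent functions. Local strong solution: given $T>0$, $(b^\alpha,\omega^\alpha,T)$ is a local strong solution with initial condition $(b_0,\omega_0)$ if $b^\alpha\in C([0,T];W^{3,2}(\mathbb{T}^2))$, $\omega^\alpha\in C([0,T];W^{2,2}(\mathbb{T}^2))$,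 and for all $t\in[0,T]$ $$b^\alpha(t)=b_0-\int_0^t\mathrm{div}(b^\alpha\mathbf{u}^\alpha)\,d\tau,\qquad \omega^\alpha(t)=\omega_0-\int_0^t\big[\mathrm{div}((\omega^\alpha-b^\alpha)\mathbf{u}^\alpha)+\mathrm{div}(b^\alpha\mathbf{u}_h)\big]\,d\tau,$$ with $\mathbf{u}^\alpha=\nabla^\perp(1-\alpha\Delta)^{-1}(\Delta-1)^{-1}(\omega^\alpha-f)$. Maximal solution: $(b^\alpha,\omega^\alpha,T^\alpha_{\max})$ is a maximal solution with initial condition $(b_0,\omega_0)$ if (i) there is an increasing sequence of times $(T_n)_{n\in\mathbb{N}}$ with limit $T^\alpha_{\max}\in(0,\infty]$; (ii) for each $n$, $(b^\alpha,\omega^\alpha,T_n)$ is a local strong solution with initial condition $(b_0,\omega_0)$; (iii) if $T^\alpha_{\max}<\infty$, then $\limsup_{T_n\to T^\alpha_{\max}}\|(b^\alpha,\omega^\alpha)(T_n)\|_{\mathcal{M}}^2=\infty$. *)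

theory Defs
  imports "HOL-Analysis.Analysis" "HOL-Probability.Essential_Supremum"
begin

section \<open>The real Hilbert space of square integrable functions on the flat torus\<close>

text \<open>
  The flat torus is the plane modulo \<open>2\<pi>\<close> times the integer lattice. Since almost everywhere
  classes do not see the boundary of the fundamental cell, square integrable functions on the torus
  are the square integrable functions on the cell. The periodic structure enters through the test
  functions in the definition of weak derivatives below.
\<close>

definition torus :: "(real \<times> real) measure" where
  "torus = restrict_space lborel (cbox (0, 0) (2 * pi, 2 * pi))"

definition square_integrable :: "(real \<times> real \<Rightarrow> real) \<Rightarrow> bool" where
  "square_integrable f \<longleftrightarrow> f \<in> borel_measurable torus \<and> integrable torus (\<lambda>x. (f x)\<^sup>2)"

definition l2_eq :: "(real \<times> real \<Rightarrow> real) \<Rightarrow> (real \<times> real \<Rightarrow> real) \<Rightarrow> bool" where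
  "l2_eq f g \<longleftrightarrow> square_integrable f \<and> square_integrable g \<and> (AE x in torus. f x = g x)"

lemma square_integrable_zero: "square_integrable (\<lambda>_. 0)"
  by (simp add: square_integrable_def)

lemma square_integrable_measurable [measurable_dest]:
  "square_integrable f \<Longrightarrow> f \<in> borel_measurable torus"
  by (simp add: square_integrable_def)

lemma square_integrable_mult:
  assumes "square_integrable f" "square_integrable g"
  shows "integrable torus (\<lambda>x. f x * g x)"
proof (rule Bochner_Integration.integrable_bound)
  show "integrable torus (\<lambda>x. (f x)\<^sup>2 + (g x)\<^sup>2)"
    using assms by (auto simp: square_integrable_def)
  show "(\<lambda>x. f x * g x) \<in> borel_measurable torus"
    using assms by (auto simp: square_integrable_def)
  have "\<bar>a * b\<bar> \<le> a\<^sup>2 + b\<^sup>2" for a b :: real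
  proof -
    have "0 \<le> \<bar>a\<bar> * \<bar>b\<bar>" by simp
    moreover have "2 * (\<bar>a\<bar> * \<bar>b\<bar>) \<le> a\<^sup>2 + b\<^sup>2"
      using sum_squares_bound[of "\<bar>a\<bar>" "\<bar>b\<bar>"] by (simp add: mult.assoc)
    ultimately show ?thesis by (simp only: abs_mult)
  qed
  then show "AE x in torus. norm (f x * g x) \<le> norm ((f x)\<^sup>2 + (g x)\<^sup>2)"
    by (auto intro!: AE_I2)
qed

lemma square_integrable_add:
  assumes "square_integrable f" "square_integrable g"
  shows "square_integrable (\<lambda>x. f x + g x)"
  using assms square_integrable_mult[OF assms]
  by (auto simp: square_integrable_def power2_sum mult.assoc)

lemma square_integrable_scale:
  assumes "square_integrable f"
  shows "square_integrable (\<lambda>x. c * f x)"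
  using assms by (auto simp: square_integrable_def power_mult_distrib)

quotient_type l2 = "real \<times> real \<Rightarrow> real" / partial: l2_eq
  morphisms rep_l2 of_fun
proof (rule part_equivpI)
  show "\<exists>f. l2_eq f f"
    using square_integrable_zero by (auto simp: l2_eq_def)
  show "symp l2_eq"
    by (auto intro!: sympI simp: l2_eq_def elim: eventually_mono)
  show "transp l2_eq"
    by (intro transpI) (auto simp: l2_eq_def)
qed

instantiation l2 :: real_inner
begin

lift_definition zero_l2 :: l2 is "\<lambda>_. 0"
  using square_integrable_zero by (auto simp: l2_eq_def)

lift_definition plus_l2 :: "l2 \<Rightarrow> l2 \<Rightarrow> l2" is "\<lambda>f g x. f x + g x"
  by (auto simp: l2_eq_def intro: square_integrable_add)

lift_definition scaleR_l2 :: "real \<Rightarrow> l2 \<Rightarrow> l2" is "\<lambda>c f x. c * f x"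
  by (auto simp: l2_eq_def intro: square_integrable_scale)

definition uminus_l2 :: "l2 \<Rightarrow> l2" where
  "uminus_l2 v = (-1) *\<^sub>R v"

definition minus_l2 :: "l2 \<Rightarrow> l2 \<Rightarrow> l2" where
  "minus_l2 v w = v + - w"

lift_definition inner_l2 :: "l2 \<Rightarrow> l2 \<Rightarrow> real" is "\<lambda>f g. \<integral>x. f x * g x \<partial>torus"
proof -
  fix f f' g g' assume "l2_eq f f'" "l2_eq g g'"
  then show "(\<integral>x. f x * g x \<partial>torus) = (\<integral>x. f' x * g' x \<partial>torus)"
    by (intro integral_cong_AE) (auto simp: l2_eq_def square_integrable_def)
qed

definition norm_l2 :: "l2 \<Rightarrow> real" where
  "norm_l2 v = sqrt (inner v v)"

definition dist_l2 :: "l2 \<Rightarrow> l2 \<Rightarrow> real" where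
  "dist_l2 v w = norm (v - w)"

definition sgn_l2 :: "l2 \<Rightarrow> l2" where
  "sgn_l2 v = inverse (norm v) *\<^sub>R v"

definition uniformity_l2 :: "(l2 \<times> l2) filter" where
  "uniformity_l2 = (INF e\<in>{0 <..}. principal {(x, y). dist x y < e})"

definition open_l2 :: "l2 set \<Rightarrow> bool" where
  "open_l2 U \<longleftrightarrow> (\<forall>x\<in>U. \<forall>\<^sub>F (x', y) in uniformity. x' = x \<longrightarrow> y \<in> U)"

instance
proof
  fix u v w :: l2 and a b :: real
  show "u + v + w = u + (v + w)"
    by transfer (auto simp: l2_eq_def add.assoc intro!: square_integrable_add)
  show "u + v = v + u"
    by transfer (auto simp: l2_eq_def add.commute intro!: square_integrable_add)
  show "0 + u = u"
    by transfer (auto simp: l2_eq_def)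
  show "- u + u = 0"
    unfolding uminus_l2_def
    by transfer (auto simp: l2_eq_def square_integrable_zero)
  show "u - v = u + - v"
    by (simp add: minus_l2_def)
  show "a *\<^sub>R (u + v) = a *\<^sub>R u + a *\<^sub>R v"
    by transfer
      (auto simp: l2_eq_def distrib_left intro!: square_integrable_add square_integrable_scale)
  show "(a + b) *\<^sub>R u = a *\<^sub>R u + b *\<^sub>R u"
    by transfer
      (auto simp: l2_eq_def distrib_right intro!: square_integrable_add square_integrable_scale)
  show "a *\<^sub>R b *\<^sub>R u = (a * b) *\<^sub>R u"
  proof transfer
    fix a b :: real and f assume "l2_eq f f"
    then show "l2_eq (\<lambda>x. a * (b * f x)) (\<lambda>x. a * b * f x)"
      using square_integrable_scale[of f "a * b"] by (auto simp: l2_eq_def mult.assoc)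
  qed
  show "1 *\<^sub>R u = u"
    by transfer (auto simp: l2_eq_def)
  show "sgn u = inverse (norm u) *\<^sub>R u"
    by (simp add: sgn_l2_def)
  show "dist u v = norm (u - v)"
    by (simp add: dist_l2_def)
  show "(uniformity :: (l2 \<times> l2) filter) = (INF e\<in>{0 <..}. principal {(x, y). dist x y < e})"
    by (simp add: uniformity_l2_def)
  show "open U \<longleftrightarrow> (\<forall>x\<in>U. \<forall>\<^sub>F (x', y) in uniformity. x' = x \<longrightarrow> y \<in> U)" for U :: "l2 set"
    by (simp add: open_l2_def)
  show "inner u v = inner v u"
    by transfer (simp add: mult.commute)
  show "inner (u + v) w = inner u w + inner v w"
    by transfer (auto simp: l2_eq_def distrib_right square_integrable_mult
        intro!: Bochner_Integration.integral_add)
  show "inner (a *\<^sub>R u) v = a * inner u v"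
    by transfer (simp add: mult.assoc)
  show "0 \<le> inner u u"
    by transfer simp
  show "inner u u = 0 \<longleftrightarrow> u = 0"
    by transfer (auto simp: l2_eq_def square_integrable_zero integral_nonneg_eq_0_iff_AE
        square_integrable_mult)
  show "norm u = sqrt (inner u u)"
    by (simp add: norm_l2_def)
qed

end

text \<open>Average over the torus, which has area \<open>4\<pi>\<^sup>2\<close>.\<close>

lift_definition average :: "l2 \<Rightarrow> real" is "\<lambda>f. (\<integral>x. f x \<partial>torus) / (4 * pi\<^sup>2)"
  by (auto simp: l2_eq_def square_integrable_def intro!: integral_cong_AE)

text \<open>
  Pointwise product. It is the almost everywhere product whenever that is square integrable, which
  is the case for all products occurring in the equations below; otherwise it is set to zero.
\<close>

lift_definition l2_mult :: "l2 \<Rightarrow> l2 \<Rightarrow> l2" (infixl "\<odot>" 70) is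
  "\<lambda>f g. if square_integrable (\<lambda>x. f x * g x) then (\<lambda>x. f x * g x) else (\<lambda>_. 0)"
proof -
  fix f f' g g' assume eq: "l2_eq f f'" "l2_eq g g'"
  have "integrable torus (\<lambda>x. (f x * g x)\<^sup>2) \<longleftrightarrow> integrable torus (\<lambda>x. (f' x * g' x)\<^sup>2)"
    using eq by (intro integrable_cong_AE) (auto simp: l2_eq_def square_integrable_def)
  then have "square_integrable (\<lambda>x. f x * g x) \<longleftrightarrow> square_integrable (\<lambda>x. f' x * g' x)"
    using eq by (auto simp: l2_eq_def square_integrable_def)
  then show "l2_eq
      (if square_integrable (\<lambda>x. f x * g x) then (\<lambda>x. f x * g x) else (\<lambda>_. 0))
      (if square_integrable (\<lambda>x. f' x * g' x) then (\<lambda>x. f' x * g' x) else (\<lambda>_. 0))"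
    using eq square_integrable_zero by (auto simp: l2_eq_def)
qed

section \<open>Weak derivatives and Sobolev spaces\<close>

definition partial_deriv :: "real \<times> real \<Rightarrow> (real \<times> real \<Rightarrow> real) \<Rightarrow> real \<times> real \<Rightarrow> real" where
  "partial_deriv e \<phi> x = frechet_derivative \<phi> (at x) e"

definition pderivs :: "nat \<Rightarrow> nat \<Rightarrow> (real \<times> real \<Rightarrow> real) \<Rightarrow> real \<times> real \<Rightarrow> real" where
  "pderivs i j \<phi> = (partial_deriv (1, 0) ^^ i) ((partial_deriv (0, 1) ^^ j) \<phi>)"

text \<open>
  Smooth functions on the torus, as doubly periodic smooth functions on the plane. One order of
  differentiation suffices for smoothness because mixed derivatives of a function all of whose
  \<open>pderivs\<close> are Frechet differentiable are symmetric.
\<close>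

definition test_fun :: "(real \<times> real \<Rightarrow> real) \<Rightarrow> bool" where
  "test_fun \<phi> \<longleftrightarrow> (\<forall>i j x. pderivs i j \<phi> differentiable (at x)) \<and>
    (\<forall>x y. \<phi> (x + 2 * pi, y) = \<phi> (x, y) \<and> \<phi> (x, y + 2 * pi) = \<phi> (x, y))"

definition has_weak_deriv :: "nat \<Rightarrow> nat \<Rightarrow> l2 \<Rightarrow> l2 \<Rightarrow> bool" where
  "has_weak_deriv i j v w \<longleftrightarrow> (\<forall>\<phi>. test_fun \<phi> \<longrightarrow>
    inner v (of_fun (pderivs i j \<phi>)) = (- 1) ^ (i + j) * inner w (of_fun \<phi>))"

definition weak_deriv :: "nat \<Rightarrow> nat \<Rightarrow> l2 \<Rightarrow> l2" where
  "weak_deriv i j v = (THE w. has_weak_deriv i j v w)"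

text \<open>\<open>sobolev k\<close> is \<open>W\<^sup>k\<^sup>,\<^sup>2\<close>; \<open>sobolev_norm k\<close> is only meaningful on it.\<close>

definition sobolev :: "nat \<Rightarrow> l2 set" where
  "sobolev k = {v. \<forall>i j. i + j \<le> k \<longrightarrow> (\<exists>w. has_weak_deriv i j v w)}"

definition sobolev_norm :: "nat \<Rightarrow> l2 \<Rightarrow> real" where
  "sobolev_norm k v = sqrt (\<Sum>(i, j)\<in>{(i, j). i + j \<le> k}. (norm (weak_deriv i j v))\<^sup>2)"

text \<open>\<open>v \<in> C([0,T]; W\<^sup>k\<^sup>,\<^sup>2)\<close>\<close>

definition continuous_sobolev :: "nat \<Rightarrow> real \<Rightarrow> (real \<Rightarrow> l2) \<Rightarrow> bool" where
  "continuous_sobolev k T v \<longleftrightarrow> (\<forall>t\<in>{0..T}. v t \<in> sobolev k \<and>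
    ((\<lambda>s. sobolev_norm k (v s - v t)) \<longlongrightarrow> 0) (at t within {0..T}))"

section \<open>Vector calculus; vector fields are pairs of components\<close>

definition laplacian :: "l2 \<Rightarrow> l2" where
  "laplacian v = weak_deriv 2 0 v + weak_deriv 0 2 v"

definition grad_perp :: "l2 \<Rightarrow> l2 \<times> l2" where
  "grad_perp \<psi> = (- weak_deriv 0 1 \<psi>, weak_deriv 1 0 \<psi>)"

definition has_weak_div :: "l2 \<times> l2 \<Rightarrow> l2 \<Rightarrow> bool" where
  "has_weak_div F w \<longleftrightarrow> (\<forall>\<phi>. test_fun \<phi> \<longrightarrow>
    inner (fst F) (of_fun (pderivs 1 0 \<phi>)) + inner (snd F) (of_fun (pderivs 0 1 \<phi>))
      = - inner w (of_fun \<phi>))"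

definition weak_div :: "l2 \<times> l2 \<Rightarrow> l2" where
  "weak_div F = (THE w. has_weak_div F w)"

definition sobolev_div :: "nat \<Rightarrow> (l2 \<times> l2) set" where
  "sobolev_div k = {F. fst F \<in> sobolev k \<and> snd F \<in> sobolev k \<and> has_weak_div F 0}"

definition scale_field :: "l2 \<Rightarrow> l2 \<times> l2 \<Rightarrow> l2 \<times> l2" (infixr "\<odot>\<^sub>v" 70) where
  "v \<odot>\<^sub>v F = (v \<odot> fst F, v \<odot> snd F)"

text \<open>Essential supremum of the Frobenius norm of a matrix field with entries \<open>a\<close>, \<open>b\<close>, \<open>c\<close>, \<open>d\<close>.\<close>

lift_definition matrix_sup_norm :: "l2 \<Rightarrow> l2 \<Rightarrow> l2 \<Rightarrow> l2 \<Rightarrow> ennreal" is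
  "\<lambda>a b c d. esssup torus (\<lambda>x. ennreal (sqrt ((a x)\<^sup>2 + (b x)\<^sup>2 + (c x)\<^sup>2 + (d x)\<^sup>2)))"
proof -
  fix a a' b b' c c' d d'
  assume eq: "l2_eq a a'" "l2_eq b b'" "l2_eq c c'" "l2_eq d d'"
  then have [measurable]:
      "a \<in> borel_measurable torus" "a' \<in> borel_measurable torus"
      "b \<in> borel_measurable torus" "b' \<in> borel_measurable torus"
      "c \<in> borel_measurable torus" "c' \<in> borel_measurable torus"
      "d \<in> borel_measurable torus" "d' \<in> borel_measurable torus"
    and "AE x in torus. a x = a' x \<and> b x = b' x \<and> c x = c' x \<and> d x = d' x"
    by (auto simp: l2_eq_def square_integrable_def)
  then show "esssup torus (\<lambda>x. ennreal (sqrt ((a x)\<^sup>2 + (b x)\<^sup>2 + (c x)\<^sup>2 + (d x)\<^sup>2)))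
      = esssup torus (\<lambda>x. ennreal (sqrt ((a' x)\<^sup>2 + (b' x)\<^sup>2 + (c' x)\<^sup>2 + (d' x)\<^sup>2)))"
    by (auto simp: esssup_def intro!: Limsup_eq elim: eventually_mono)
qed

definition grad_sup_norm :: "l2 \<times> l2 \<Rightarrow> ennreal" where
  "grad_sup_norm u = matrix_sup_norm
    (weak_deriv 1 0 (fst u)) (weak_deriv 0 1 (fst u))
    (weak_deriv 1 0 (snd u)) (weak_deriv 0 1 (snd u))"

section \<open>The alpha-TQG system\<close>

text \<open>
  Inverses of \<open>\<Delta> - 1\<close> and \<open>1 - \<alpha>\<Delta>\<close> as bijections from \<open>W\<^sup>2\<^sup>,\<^sup>2\<close> onto the square
  integrable functions (for \<open>\<alpha> > 0\<close>).
\<close>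

definition inv_laplacian_minus_one :: "l2 \<Rightarrow> l2" where
  "inv_laplacian_minus_one = inv_into (sobolev 2) (\<lambda>\<psi>. laplacian \<psi> - \<psi>)"

definition inv_one_minus_laplacian :: "real \<Rightarrow> l2 \<Rightarrow> l2" where
  "inv_one_minus_laplacian \<alpha> = inv_into (sobolev 2) (\<lambda>\<psi>. \<psi> - \<alpha> *\<^sub>R laplacian \<psi>)"

definition velocity :: "real \<Rightarrow> l2 \<Rightarrow> l2 \<Rightarrow> l2 \<times> l2" where
  "velocity \<alpha> f \<omega> = grad_perp (inv_one_minus_laplacian \<alpha> (inv_laplacian_minus_one (\<omega> - f)))"

text \<open>
  The time integrals are integrals of functions with values in the Hilbert space \<open>l2\<close>. The
  integrands are continuous in time, so the gauge integral agrees with the Bochner integral. Since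
  divergences have average zero, \<open>b t\<close> and \<open>\<omega> t\<close> have average zero whenever \<open>b\<^sub>0\<close> and \<open>\<omega>\<^sub>0\<close> do.
\<close>

definition local_strong_solution ::
  "real \<Rightarrow> l2 \<times> l2 \<Rightarrow> l2 \<Rightarrow> l2 \<Rightarrow> l2 \<Rightarrow> (real \<Rightarrow> l2) \<Rightarrow> (real \<Rightarrow> l2) \<Rightarrow> real \<Rightarrow> bool" where
  "local_strong_solution \<alpha> u\<^sub>h f b\<^sub>0 \<omega>\<^sub>0 b \<omega> T \<longleftrightarrow>
    0 < T \<and> continuous_sobolev 3 T b \<and> continuous_sobolev 2 T \<omega> \<and>
    (\<forall>t\<in>{0..T}.
      (\<exists>I. ((\<lambda>\<tau>. weak_div (b \<tau> \<odot>\<^sub>v velocity \<alpha> f (\<omega> \<tau>))) has_integral I) {0..t} \<and>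
           b t = b\<^sub>0 - I) \<and>
      (\<exists>I. ((\<lambda>\<tau>. weak_div ((\<omega> \<tau> - b \<tau>) \<odot>\<^sub>v velocity \<alpha> f (\<omega> \<tau>)) + weak_div (b \<tau> \<odot>\<^sub>v u\<^sub>h))
              has_integral I) {0..t} \<and>
           \<omega> t = \<omega>\<^sub>0 - I))"

definition M_norm :: "l2 \<times> l2 \<Rightarrow> real" where
  "M_norm p = sobolev_norm 3 (fst p) + sobolev_norm 2 (snd p)"

definition maximal_solution ::
  "real \<Rightarrow> l2 \<times> l2 \<Rightarrow> l2 \<Rightarrow> l2 \<Rightarrow> l2 \<Rightarrow> (real \<Rightarrow> l2) \<Rightarrow> (real \<Rightarrow> l2) \<Rightarrow> ereal \<Rightarrow> bool" where
  "maximal_solution \<alpha> u\<^sub>h f b\<^sub>0 \<omega>\<^sub>0 b \<omega> Tmax \<longleftrightarrow> 0 < Tmax \<and>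
    (\<exists>T :: nat \<Rightarrow> real. incseq T \<and> (\<lambda>n. ereal (T n)) \<longlonglongrightarrow> Tmax \<and>
      (\<forall>n. local_strong_solution \<alpha> u\<^sub>h f b\<^sub>0 \<omega>\<^sub>0 b \<omega> (T n)) \<and>
      (Tmax < \<infinity> \<longrightarrow> limsup (\<lambda>n. ereal ((M_norm (b (T n), \<omega> (T n)))\<^sup>2)) = \<infinity>))"

end

theory Submission
  imports Defs
begin

text \<open>
  Suppose that \<open>Tmax\<close> and the time integral of \<open>\<parallel>\<nabla>u\<parallel>\<^sub>\<infinity>\<close> are finite; the norm of the solution then
  stays bounded, which contradicts maximality. Pairing the equation for \<open>b\<close> with \<open>\<Delta>b\<close> shows that the
  logarithmic derivative of \<open>1 + \<parallel>\<nabla>b\<parallel>\<^sup>2\<close> is at most \<open>2 \<parallel>\<nabla>u\<parallel>\<^sub>\<infinity>\<close>, so \<open>\<nabla>b\<close> is bounded in the mean square.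
  The velocity is three derivatives smoother than \<open>\<omega>\<close>, hence \<open>\<parallel>u\<parallel>\<^sub>\<infinity>\<close> is controlled by the mean square
  norm of \<open>\<omega> - f\<close>. In the energy estimate for \<open>\<omega>\<close> the transport term cancels, what remains is linear,
  and Gronwall's inequality bounds \<open>\<omega>\<close> in the mean square and therefore \<open>u\<close> in \<open>W\<^sup>3\<^sup>,\<^sup>2\<close>. From there on
  the estimates for \<open>b\<close> in \<open>W\<^sup>3\<^sup>,\<^sup>2\<close> and for \<open>\<omega>\<close> in \<open>W\<^sup>2\<^sup>,\<^sup>2\<close> are linear.

  All norms are read off the Fourier coefficients. In an energy identity with weight \<open>p\<close> the
  transport term is a double sum over frequencies \<open>k\<close>, \<open>l\<close> whose kernel is antisymmetric because \<open>u\<close>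
  is divergence free, so that \<open>p k\<close> may be replaced by \<open>(p k - p l) / 2\<close>; Young's inequality for
  convolutions does the rest. The time derivative of \<open>b\<close> lies in \<open>W\<^sup>2\<^sup>,\<^sup>2\<close> only, and therefore the weights
  are first truncated to finitely many frequencies.
\<close>

section \<open>Integration over the flat torus\<close>

abbreviation cell :: "(real \<times> real) set" where
  "cell \<equiv> cbox (0, 0) (2 * pi, 2 * pi)"

lemma space_torus: "space torus = cell"
  by (simp add: torus_def space_restrict_space)

lemma borel_measurable_torus:
  "f \<in> borel_measurable borel \<Longrightarrow> f \<in> borel_measurable torus"
  unfolding torus_def by (intro measurable_restrict_space1) simp

lemma continuous_measurable_torus:
  "continuous_on UNIV f \<Longrightarrow> f \<in> borel_measurable torus"
  by (intro borel_measurable_torus borel_measurable_continuous_onI)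

lemma emeasure_torus: "emeasure torus (space torus) = ennreal (4 * pi\<^sup>2)"
proof -
  have "emeasure torus (space torus) = emeasure lborel cell"
    unfolding space_torus torus_def by (subst emeasure_restrict_space) auto
  also have "\<dots> = ennreal (\<Prod>b\<in>Basis. (2 * pi, 2 * pi) \<bullet> b)"
    by (subst emeasure_lborel_cbox) (auto simp: Basis_prod_def zero_prod_def[symmetric])
  also have "(\<Prod>b\<in>Basis. (2 * pi, 2 * pi) \<bullet> (b::real \<times> real)) = 4 * pi\<^sup>2"
    by (simp add: Basis_prod_def prod.union_disjoint power2_eq_square)
  finally show ?thesis .
qed

interpretation torus: finite_measure torus
  by (intro finite_measureI) (simp add: emeasure_torus)

lemma measure_torus: "measure torus (space torus) = 4 * pi\<^sup>2"
  unfolding measure_def emeasure_torus by simp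

lemma AE_torusI: "(\<And>x. x \<in> cell \<Longrightarrow> P x) \<Longrightarrow> AE x in torus. P x"
  by (rule AE_I2) (simp add: space_torus)

lemma integral_torus_continuous:
  fixes g :: "real \<times> real \<Rightarrow> 'a::euclidean_space"
  assumes "continuous_on UNIV g"
  shows "integral\<^sup>L torus g = integral cell g"
proof -
  have "set_integrable lborel cell g"
    unfolding set_integrable_def
    by (intro borel_integrable_compact) (auto intro: continuous_on_subset[OF assms])
  then have "(LINT x : cell | lborel. g x) = integral cell g"
    by (rule set_borel_integral_eq_integral)
  then show ?thesis
    unfolding torus_def set_lebesgue_integral_def by (subst integral_restrict_space) auto
qed

lemma integral_torus_dx:
  fixes g G :: "real \<times> real \<Rightarrow> complex"
  assumes cont: "continuous_on UNIV g"
    and deriv: "\<And>x y. ((\<lambda>s. G (s, y)) has_vector_derivative g (x, y)) (at x)"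
    and per: "\<And>y. G (2 * pi, y) = G (0, y)"
  shows "integral\<^sup>L torus g = 0"
proof -
  have *: "integral (cbox 0 (2*pi)) (\<lambda>x. g (x, y)) = 0" for y
  proof -
    have "((\<lambda>x. g (x, y)) has_integral (G (2*pi, y) - G (0, y))) {0..2*pi}"
      by (rule fundamental_theorem_of_calculus)
        (auto intro: has_vector_derivative_at_within[OF deriv])
    then show ?thesis by (simp add: per integral_unique)
  qed
  have "continuous_on cell g" by (rule continuous_on_subset[OF cont]) auto
  then have "integral cell g = integral (cbox 0 (2*pi)) (\<lambda>x. integral (cbox 0 (2*pi)) (\<lambda>y. g (x, y)))"
    by (rule integral_prod_continuous)
  also have "\<dots> = integral (cbox 0 (2*pi)) (\<lambda>y. integral (cbox 0 (2*pi)) (\<lambda>x. g (x, y)))"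
    by (rule integral_swap_continuous) (auto intro!: continuous_on_subset[OF cont])
  finally show ?thesis using * by (simp add: integral_torus_continuous[OF cont])
qed

lemma integral_torus_dy:
  fixes g G :: "real \<times> real \<Rightarrow> complex"
  assumes cont: "continuous_on UNIV g"
    and deriv: "\<And>x y. ((\<lambda>s. G (x, s)) has_vector_derivative g (x, y)) (at y)"
    and per: "\<And>x. G (x, 2 * pi) = G (x, 0)"
  shows "integral\<^sup>L torus g = 0"
proof -
  have *: "integral (cbox 0 (2*pi)) (\<lambda>y. g (x, y)) = 0" for x
  proof -
    have "((\<lambda>y. g (x, y)) has_integral (G (x, 2*pi) - G (x, 0))) {0..2*pi}"
      by (rule fundamental_theorem_of_calculus)
        (auto intro: has_vector_derivative_at_within[OF deriv])
    then show ?thesis by (simp add: per integral_unique)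
  qed
  have "continuous_on cell g" by (rule continuous_on_subset[OF cont]) auto
  then have "integral cell g = integral (cbox 0 (2*pi)) (\<lambda>x. integral (cbox 0 (2*pi)) (\<lambda>y. g (x, y)))"
    by (rule integral_prod_continuous)
  then show ?thesis using * by (simp add: integral_torus_continuous[OF cont])
qed

lemma square_integrable_bounded:
  assumes "f \<in> borel_measurable torus" "\<And>x. x \<in> cell \<Longrightarrow> \<bar>f x\<bar> \<le> B"
  shows "square_integrable f"
  unfolding square_integrable_def
proof
  have "\<bar>f x\<bar>\<^sup>2 \<le> B\<^sup>2" if "x \<in> cell" for x
    using assms(2)[OF that] by (intro power_mono) auto
  then show "integrable torus (\<lambda>x. (f x)\<^sup>2)"
    by (intro torus.integrable_const_bound[where B = "B\<^sup>2"] AE_torusI)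
      (use assms(1) in \<open>auto\<close>)
qed fact

lemma square_integrable_continuous:
  assumes "continuous_on UNIV f"
  shows "square_integrable f"
proof -
  have "compact (f ` cell)"
    by (intro compact_continuous_image continuous_on_subset[OF assms]) auto
  then obtain B where "\<And>x. x \<in> cell \<Longrightarrow> \<bar>f x\<bar> \<le> B"
    by (metis bounded_iff compact_imp_bounded imageI real_norm_def)
  then show ?thesis
    by (intro square_integrable_bounded[of f B] continuous_measurable_torus assms)
qed

lemma square_integrable_imp_integrable:
  assumes "square_integrable f"
  shows "integrable torus f"
proof -
  have "integrable torus (\<lambda>x. f x * 1)"
    by (intro square_integrable_mult assms square_integrable_continuous) auto
  then show ?thesis by simp
qed

lemma square_integrable_mult_bounded:
  assumes f: "f \<in> borel_measurable torus" "AE x in torus. \<bar>f x\<bar> \<le> B" and g: "square_integrable g"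
  shows "square_integrable (\<lambda>x. f x * g x)"
    and "(\<integral>x. (f x * g x)\<^sup>2 \<partial>torus) \<le> B\<^sup>2 * (\<integral>x. (g x)\<^sup>2 \<partial>torus)"
proof -
  have [measurable]: "g \<in> borel_measurable torus" using g by (simp add: square_integrable_def)
  have gi: "integrable torus (\<lambda>x. B\<^sup>2 * (g x)\<^sup>2)" using g by (simp add: square_integrable_def)
  have ae: "AE x in torus. (f x * g x)\<^sup>2 \<le> B\<^sup>2 * (g x)\<^sup>2"
    using f(2)
  proof eventually_elim
    case (elim x)
    then have "\<bar>f x\<bar>\<^sup>2 \<le> B\<^sup>2" by (intro power_mono) auto
    then show ?case by (simp add: power_mult_distrib mult_right_mono)
  qed
  have i: "integrable torus (\<lambda>x. (f x * g x)\<^sup>2)"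
    by (rule Bochner_Integration.integrable_bound[OF gi]) (use f(1) ae in auto)
  then show "square_integrable (\<lambda>x. f x * g x)"
    unfolding square_integrable_def using f(1) by auto
  show "(\<integral>x. (f x * g x)\<^sup>2 \<partial>torus) \<le> B\<^sup>2 * (\<integral>x. (g x)\<^sup>2 \<partial>torus)"
    using integral_mono_AE[OF i gi ae] by simp
qed

section \<open>Representatives of classes of functions\<close>

lemma square_integrable_rep: "square_integrable (rep_l2 v)"
  using Quotient_rep_reflp[OF Quotient_l2, of v] by (simp add: l2_eq_def)

lemma of_fun_rep: "of_fun (rep_l2 v) = v"
  using Quotient_abs_rep[OF Quotient_l2] .

lemma l2_eq_refl: "square_integrable f \<Longrightarrow> l2_eq f f"
  by (simp add: l2_eq_def)

lemma of_fun_add: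
  "square_integrable f \<Longrightarrow> square_integrable g \<Longrightarrow> of_fun f + of_fun g = of_fun (\<lambda>x. f x + g x)"
  by (simp add: plus_l2.abs_eq l2_eq_refl)

lemma of_fun_scaleR: "square_integrable f \<Longrightarrow> c *\<^sub>R of_fun f = of_fun (\<lambda>x. c * f x)"
  by (simp add: scaleR_l2.abs_eq l2_eq_refl)

lemma inner_of_fun:
  "square_integrable f \<Longrightarrow> square_integrable g \<Longrightarrow> inner (of_fun f) (of_fun g) = (\<integral>x. f x * g x \<partial>torus)"
  by (simp add: inner_l2.abs_eq l2_eq_refl)

lemma norm_of_fun: "square_integrable f \<Longrightarrow> (norm (of_fun f))\<^sup>2 = (\<integral>x. (f x)\<^sup>2 \<partial>torus)"
  unfolding power2_norm_eq_inner by (subst inner_of_fun) (auto simp: power2_eq_square)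

lemma of_fun_minus:
  assumes "square_integrable f" "square_integrable g"
  shows "of_fun f - of_fun g = of_fun (\<lambda>x. f x - g x)"
  using of_fun_add[OF assms(1) square_integrable_scale[OF assms(2), of "-1"]]
  by (simp add: minus_l2_def uminus_l2_def of_fun_scaleR[OF assms(2)])

lemma of_fun_sum:
  assumes "\<And>k. k \<in> S \<Longrightarrow> square_integrable (f k)"
  shows "square_integrable (\<lambda>x. \<Sum>k\<in>S. f k x) \<and> (\<Sum>k\<in>S. of_fun (f k)) = of_fun (\<lambda>x. \<Sum>k\<in>S. f k x)"
  using assms
proof (induction S rule: infinite_finite_induct)
  case (insert k S)
  then show ?case by (auto simp: of_fun_add intro!: square_integrable_add)
qed (auto simp: zero_l2_def square_integrable_zero)

lemma l2_cases:
  obtains f where "square_integrable f" "v = of_fun f"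
  using square_integrable_rep of_fun_rep by metis

lemma l2_mult_of_fun:
  assumes "square_integrable f" "square_integrable g" "square_integrable (\<lambda>x. f x * g x)"
  shows "of_fun f \<odot> of_fun g = of_fun (\<lambda>x. f x * g x)"
  using assms by (simp add: l2_mult.abs_eq l2_eq_refl)

section \<open>Fourier coefficients\<close>

definition theta :: "int \<times> int \<Rightarrow> real \<times> real \<Rightarrow> real" where
  "theta k x = of_int (fst k) * fst x + of_int (snd k) * snd x"

lemma theta_add: "theta (k + l) x = theta k x + theta l x"
  and theta_minus: "theta (- k) x = - theta k x"
  and theta_diff: "theta (k - l) x = theta k x - theta l x"
  and theta_zero [simp]: "theta 0 x = 0"
  by (auto simp: theta_def algebra_simps)

lemma continuous_theta [continuous_intros]: "continuous_on A (theta k)"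
  unfolding theta_def[abs_def] by (intro continuous_intros)

lemma theta_measurable [measurable]: "theta k \<in> borel_measurable torus"
  by (intro continuous_measurable_torus continuous_intros)

lemma cis_theta_per: "cis (theta k (2 * pi, y)) = cis (theta k (0, y))"
    "cis (theta k (x, 2 * pi)) = cis (theta k (x, 0))"
proof -
  have *: "cis (2 * pi * of_int m) = 1" for m :: int
    using cis_multiple_2pi[of "of_int m"] by (simp add: )
  show "cis (theta k (2 * pi, y)) = cis (theta k (0, y))"
    using *[of "fst k"] by (simp add: theta_def cis_mult[symmetric] mult_ac)
  show "cis (theta k (x, 2 * pi)) = cis (theta k (x, 0))"
    using *[of "snd k"] by (simp add: theta_def cis_mult[symmetric] mult_ac)
qed

lemma has_vector_derivative_cis_theta:
  "((\<lambda>s. cis (theta k (s, y))) has_vector_derivative \<i> * of_int (fst k) * cis (theta k (x, y))) (at x)"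
  "((\<lambda>s. cis (theta k (x, s))) has_vector_derivative \<i> * of_int (snd k) * cis (theta k (x, y))) (at y)"
proof -
  have *: "((\<lambda>s. cis (a * s + c)) has_vector_derivative \<i> * of_real a * cis (a * t + c)) (at t)" for a c t
  proof -
    have "((\<lambda>z. exp (\<i> * (of_real a * z + of_real c))) has_field_derivative
        \<i> * of_real a * exp (\<i> * (of_real a * of_real t + of_real c))) (at (of_real t))"
      by (auto intro!: derivative_eq_intros)
    from has_vector_derivative_real_field[OF this] show ?thesis
      by (simp add: cis_conv_exp)
  qed
  show "((\<lambda>s. cis (theta k (s, y))) has_vector_derivative \<i> * of_int (fst k) * cis (theta k (x, y))) (at x)"
    using *[of "of_int (fst k)" "of_int (snd k) * y" x] by (simp add: theta_def)
  show "((\<lambda>s. cis (theta k (x, s))) has_vector_derivative \<i> * of_int (snd k) * cis (theta k (x, y))) (at y)"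
    using *[of "of_int (snd k)" "of_int (fst k) * x" y] by (simp add: theta_def add.commute)
qed

lemma integrable_mult_cis:
  assumes "integrable torus f"
  shows "integrable torus (\<lambda>x. complex_of_real (f x) * cis (theta k x))"
proof (rule Bochner_Integration.integrable_bound[OF assms])
  show "(\<lambda>x. complex_of_real (f x) * cis (theta k x)) \<in> borel_measurable torus"
    using assms unfolding cis_conv_exp by measurable
qed (simp add: norm_mult)

lift_definition fc :: "l2 \<Rightarrow> int \<times> int \<Rightarrow> complex" is
  "\<lambda>f k. (\<integral>x. complex_of_real (f x) * cis (- theta k x) \<partial>torus) / complex_of_real (4 * pi\<^sup>2)"
proof (rule ext)
  fix f g :: "real \<times> real \<Rightarrow> real" and k :: "int \<times> int"
  assume eq: "l2_eq f g"
  have "(\<integral>x. complex_of_real (f x) * cis (theta (- k) x) \<partial>torus) =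
      (\<integral>x. complex_of_real (g x) * cis (theta (- k) x) \<partial>torus)"
    using eq by (intro integral_cong_AE borel_measurable_integrable integrable_mult_cis
        square_integrable_imp_integrable) (auto simp: l2_eq_def)
  then show "(\<integral>x. complex_of_real (f x) * cis (- theta k x) \<partial>torus) / complex_of_real (4 * pi\<^sup>2) =
      (\<integral>x. complex_of_real (g x) * cis (- theta k x) \<partial>torus) / complex_of_real (4 * pi\<^sup>2)"
    by (simp add: theta_minus)
qed

lemma fc_of_fun:
  assumes "square_integrable f"
  shows "fc (of_fun f) k =
    (\<integral>x. complex_of_real (f x) * cis (theta (- k) x) \<partial>torus) / complex_of_real (4 * pi\<^sup>2)"
  by (simp add: fc.abs_eq l2_eq_refl assms theta_minus)

lemma fc_add: "fc (v + w) k = fc v k + fc w k"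
proof (cases v rule: l2_cases, cases w rule: l2_cases)
  fix f g assume *: "square_integrable f" "v = of_fun f" "square_integrable g" "w = of_fun g"
  then show ?thesis
    by (simp add: of_fun_add fc_of_fun square_integrable_add distrib_right integrable_mult_cis
        square_integrable_imp_integrable add_divide_distrib)
qed

lemma fc_scaleR: "fc (c *\<^sub>R v) k = c *\<^sub>R fc v k"
proof (cases v rule: l2_cases)
  fix f assume *: "square_integrable f" "v = of_fun f"
  then show ?thesis
    by (simp add: of_fun_scaleR fc_of_fun square_integrable_scale scaleR_conv_of_real mult.assoc)
qed

lemma fc_bound: "cmod (fc v k) \<le> norm v"
proof (cases v rule: l2_cases)
  fix f assume *: "square_integrable f" "v = of_fun f"
  have "cmod (\<integral>x. complex_of_real (f x) * cis (theta (- k) x) \<partial>torus) \<le> (\<integral>x. \<bar>f x\<bar> * 1 \<partial>torus)"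
    by (rule order_trans[OF integral_norm_bound]) (simp add: norm_mult)
  also have "\<dots> = inner (of_fun (\<lambda>x. \<bar>f x\<bar>)) (of_fun (\<lambda>x. 1))"
    using * by (subst inner_of_fun) (auto intro: square_integrable_continuous simp: square_integrable_def)
  also have "\<dots> \<le> norm (of_fun (\<lambda>x. \<bar>f x\<bar>)) * norm (of_fun (\<lambda>x. 1))"
    by (rule norm_cauchy_schwarz)
  also have "norm (of_fun (\<lambda>x. \<bar>f x\<bar>)) = norm v"
  proof -
    have "square_integrable (\<lambda>x. \<bar>f x\<bar>)" using * by (auto simp: square_integrable_def)
    then have "(norm (of_fun (\<lambda>x. \<bar>f x\<bar>)))\<^sup>2 = (norm v)\<^sup>2" using * by (simp add: norm_of_fun)
    then show ?thesis by simp
  qed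
  also have "norm (of_fun (\<lambda>x. 1)) = 2 * pi"
  proof -
    have "(norm (of_fun (\<lambda>x. 1)))\<^sup>2 = (2 * pi)\<^sup>2"
      using measure_torus by (subst norm_of_fun) (auto intro: square_integrable_continuous simp: power2_eq_square)
    then show ?thesis by (rule power2_eq_imp_eq) auto
  qed
  finally have "cmod (\<integral>x. complex_of_real (f x) * cis (theta (- k) x) \<partial>torus) / (4 * pi\<^sup>2)
      \<le> norm v * (2 * pi) / (4 * pi\<^sup>2)"
    by (intro divide_right_mono) auto
  then have "cmod (fc v k) \<le> norm v * (2 * pi) / (4 * pi\<^sup>2)"
    unfolding *(2) fc_of_fun[OF *(1)] norm_divide by (simp add: norm_mult norm_power)
  also have "\<dots> = norm v * (1 / (2 * pi))"
    by (simp add: power2_eq_square)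
  also have "\<dots> \<le> norm v * 1"
    using pi_gt3 by (intro mult_left_mono) auto
  finally show ?thesis by simp
qed

lemma bounded_linear_fc: "bounded_linear (\<lambda>v. fc v k)"
  by (rule bounded_linear_intro[where K = 1]) (auto simp: fc_add fc_scaleR fc_bound)

lemma fc_diff: "fc (v - w) k = fc v k - fc w k"
  using linear_diff[OF bounded_linear.linear[OF bounded_linear_fc]] .

lemma fc_uminus: "fc (- v) k = - fc v k"
  using linear_neg[OF bounded_linear.linear[OF bounded_linear_fc]] .

lemma fc_zero [simp]: "fc 0 k = 0"
  using linear_0[OF bounded_linear.linear[OF bounded_linear_fc]] .

lemma fc_hermitian: "fc v (- k) = cnj (fc v k)"
proof (cases v rule: l2_cases)
  fix f assume *: "square_integrable f" "v = of_fun f"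
  have "(\<integral>x. complex_of_real (f x) * cis (theta k x) \<partial>torus) =
      (\<integral>x. cnj (complex_of_real (f x) * cis (- theta k x)) \<partial>torus)"
    by (simp add: cis_cnj)
  also have "\<dots> = cnj (\<integral>x. complex_of_real (f x) * cis (- theta k x) \<partial>torus)"
    by (rule Bochner_Integration.integral_cnj)
  finally show ?thesis
    using * by (simp add: fc_of_fun theta_minus)
qed

definition trig :: "complex \<Rightarrow> int \<times> int \<Rightarrow> real \<times> real \<Rightarrow> real" where
  "trig z k x = Re (z * cis (theta k x))"

lemma continuous_trig [continuous_intros]: "continuous_on A (trig z k)"
  unfolding trig_def[abs_def] by (intro continuous_intros)

lemma trig_measurable [measurable]: "trig z k \<in> borel_measurable torus"
  by (intro continuous_measurable_torus continuous_intros)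

lemma square_integrable_trig: "square_integrable (trig z k)"
  by (intro square_integrable_continuous continuous_intros)

lemma abs_trig_le: "\<bar>trig z k x\<bar> \<le> cmod z"
  using abs_Re_le_cmod[of "z * cis (theta k x)"] by (simp add: trig_def norm_mult)

lemma inner_trig: "inner v (of_fun (trig z k)) = 4 * pi\<^sup>2 * Re (z * cnj (fc v k))"
proof (cases v rule: l2_cases)
  fix f assume *: "square_integrable f" "v = of_fun f"
  have "fc v (- k) * complex_of_real (4 * pi\<^sup>2) = (\<integral>x. complex_of_real (f x) * cis (theta k x) \<partial>torus)"
    using * by (simp add: fc_of_fun)
  then have "complex_of_real (4 * pi\<^sup>2) * (z * cnj (fc v k)) =
      z * (\<integral>x. complex_of_real (f x) * cis (theta k x) \<partial>torus)"
    by (simp add: fc_hermitian mult_ac)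
  also have "\<dots> = (\<integral>x. z * (complex_of_real (f x) * cis (theta k x)) \<partial>torus)"
    by simp
  finally have "4 * pi\<^sup>2 * Re (z * cnj (fc v k)) = Re (\<integral>x. z * (complex_of_real (f x) * cis (theta k x)) \<partial>torus)"
    by (metis Re_complex_of_real times_complex.simps(1) Im_complex_of_real mult_zero_left diff_zero)
  also have "\<dots> = (\<integral>x. Re (z * (complex_of_real (f x) * cis (theta k x))) \<partial>torus)"
    using * by (intro integral_Re[symmetric] integrable_mult_right integrable_mult_cis
        square_integrable_imp_integrable)
  also have "\<dots> = (\<integral>x. f x * trig z k x \<partial>torus)"
    by (intro Bochner_Integration.integral_cong) (auto simp: trig_def algebra_simps)
  finally show ?thesis using * by (simp add: inner_of_fun square_integrable_trig)
qed

lemma integral_cis: "(\<integral>x. cis (theta k x) \<partial>torus) = (if k = 0 then complex_of_real (4 * pi\<^sup>2) else 0)"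
proof (cases "k = 0")
  case True
  then show ?thesis using measure_torus by (simp add: scaleR_conv_of_real)
next
  case False
  have c: "continuous_on UNIV (\<lambda>x. z * cis (theta k x))" for z by (intro continuous_intros)
  consider "fst k \<noteq> 0" | "snd k \<noteq> 0" using False by (metis prod.collapse zero_prod_def)
  then show ?thesis
  proof cases
    case 1
    have "integral\<^sup>L torus (\<lambda>x. \<i> * of_int (fst k) * cis (theta k x)) = 0"
      by (rule integral_torus_dx[OF c, of "\<lambda>x. cis (theta k x)"])
        (auto intro!: has_vector_derivative_cis_theta cis_theta_per)
    then show ?thesis using 1 False by simp
  next
    case 2
    have "integral\<^sup>L torus (\<lambda>x. \<i> * of_int (snd k) * cis (theta k x)) = 0"
      by (rule integral_torus_dy[OF c, of "\<lambda>x. cis (theta k x)"])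
        (auto intro!: has_vector_derivative_cis_theta cis_theta_per)
    then show ?thesis using 2 False by simp
  qed
qed

lemma fc_mult_trig:
  assumes "square_integrable f"
  shows "fc (of_fun (\<lambda>x. trig z l x * f x)) k =
    (z * fc (of_fun f) (k - l) + cnj z * fc (of_fun f) (k + l)) / 2"
proof -
  have si: "square_integrable (\<lambda>x. trig z l x * f x)"
    by (rule square_integrable_mult_bounded(1)[OF trig_measurable _ assms])
      (auto intro!: AE_torusI abs_trig_le)
  have *: "complex_of_real (trig z l x * f x) * cis (theta (- k) x) =
      (z * (complex_of_real (f x) * cis (theta (- (k - l)) x)) +
       cnj z * (complex_of_real (f x) * cis (theta (- (k + l)) x))) / 2" for x
  proof -
    have tr: "complex_of_real (trig z l x) = (z * cis (theta l x) + cnj z * cis (- theta l x)) / 2"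
      unfolding trig_def by (simp add: complex_eq_iff)
    have c: "cis (theta (- (k - l)) x) = cis (theta (- k) x) * cis (theta l x)"
        "cis (theta (- (k + l)) x) = cis (theta (- k) x) * cis (- theta l x)"
      by (simp_all add: theta_add theta_minus theta_diff cis_mult)
    show ?thesis
      unfolding of_real_mult tr c by (simp add: field_simps)
  qed
  note i = integrable_mult_cis[OF square_integrable_imp_integrable[OF assms]]
  show ?thesis unfolding fc_of_fun[OF si] fc_of_fun[OF assms] *
    using i by (simp add: add_divide_distrib)
qed

lemma fc_one: "fc (of_fun (\<lambda>_. 1)) k = (if k = 0 then 1 else 0)"
proof -
  have "fc (of_fun (\<lambda>_. 1)) k = (\<integral>x. cis (theta (- k) x) \<partial>torus) / complex_of_real (4 * pi\<^sup>2)"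
    by (subst fc_of_fun) (simp_all add: square_integrable_continuous)
  also have "\<dots> = (if k = 0 then 1 else 0)"
    unfolding integral_cis by simp
  finally show ?thesis .
qed

lemma fc_trig: "fc (of_fun (trig z l)) k = ((if k = l then z else 0) + (if k = - l then cnj z else 0)) / 2"
proof -
  have "fc (of_fun (\<lambda>x. trig z l x * 1)) k =
      (z * (if k - l = 0 then 1 else 0) + cnj z * (if k + l = 0 then 1 else 0)) / 2"
    by (subst fc_mult_trig) (simp_all only: fc_one square_integrable_continuous continuous_on_const)
  moreover have "k - l = 0 \<longleftrightarrow> k = l" "k + l = 0 \<longleftrightarrow> k = - l"
    by (simp_all add: eq_neg_iff_add_eq_0)
  ultimately show ?thesis by simp
qed

section \<open>Density of trigonometric polynomials\<close>

inductive trig_poly :: "(real \<times> real \<Rightarrow> real) \<Rightarrow> bool" where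
  trig_poly_trig: "trig_poly (trig z k)"
| trig_poly_add: "trig_poly f \<Longrightarrow> trig_poly g \<Longrightarrow> trig_poly (\<lambda>x. f x + g x)"

lemma trig_mult: "trig z k x * trig w l x = trig (z * w / 2) (k + l) x + trig (z * cnj w / 2) (k - l) x"
proof -
  define a b where "a = z * cis (theta k x)" and "b = w * cis (theta l x)"
  have c: "cis (theta (k + l) x) = cis (theta k x) * cis (theta l x)"
    "cis (theta (k - l) x) = cis (theta k x) * cnj (cis (theta l x))"
    by (simp_all add: theta_add theta_diff cis_cnj cis_mult)
  have "trig (z * w / 2) (k + l) x + trig (z * cnj w / 2) (k - l) x = Re (a * b / 2) + Re (a * cnj b / 2)"
    unfolding trig_def a_def b_def c complex_cnj_mult by (simp only: mult_ac times_divide_eq_left times_divide_eq_right)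
  also have "\<dots> = Re a * Re b" by (simp add: field_simps)
  finally show ?thesis by (simp add: trig_def a_def b_def)
qed

lemma trig_poly_const: "trig_poly (\<lambda>x. c)"
proof -
  have "trig (complex_of_real c) 0 = (\<lambda>x. c)" by (auto simp: trig_def)
  then show ?thesis using trig_poly_trig by metis
qed

lemma trig_poly_mult:
  assumes "trig_poly f" "trig_poly g"
  shows "trig_poly (\<lambda>x. f x * g x)"
  using assms(1)
proof induction
  case (trig_poly_trig z k)
  show ?case using assms(2)
  proof induction
    case (trig_poly_trig w l)
    show ?case unfolding trig_mult
      by (intro trig_poly.intros)
  next
    case (trig_poly_add f g)
    then show ?case by (simp add: distrib_left trig_poly.trig_poly_add)
  qed
next
  case (trig_poly_add f g)
  then show ?case by (simp add: distrib_right trig_poly.trig_poly_add)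
qed

lemma trig_poly_continuous: "trig_poly f \<Longrightarrow> continuous_on UNIV f"
  by (induction rule: trig_poly.induct) (auto intro!: continuous_intros)

lemma real_polynomial_function_cis:
  assumes "real_polynomial_function (p :: complex \<times> complex \<Rightarrow> real)"
  shows "trig_poly (\<lambda>x. p (cis (fst x), cis (snd x)))"
  using assms
proof induction
  case (linear f)
  have decomp: "f (u, v) = Re u * f (1, 0) + Im u * f (\<i>, 0) + (Re v * f (0, 1) + Im v * f (0, \<i>))" for u v
  proof -
    have "(u, v) = Re u *\<^sub>R (1, 0) + Im u *\<^sub>R (\<i>, 0) + (Re v *\<^sub>R (0, 1) + Im v *\<^sub>R (0, \<i>))"
      by (simp add: complex_eq_iff)
    then show ?thesis
      using linear_add[OF bounded_linear.linear[OF linear]]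
        linear_scale[OF bounded_linear.linear[OF linear]] by (metis real_scaleR_def)
  qed
  have "(\<lambda>x. f (cis (fst x), cis (snd x))) =
      (\<lambda>x. trig (Complex (f (1, 0)) (- f (\<i>, 0))) (1, 0) x + trig (Complex (f (0, 1)) (- f (0, \<i>))) (0, 1) x)"
    by (rule ext, subst decomp) (simp add: trig_def theta_def)
  then show ?case by (auto intro: trig_poly.intros)
qed (auto intro: trig_poly_const trig_poly_add trig_poly_mult)

definition cutoff :: "nat \<Rightarrow> complex \<Rightarrow> real" where
  "cutoff n z = min 1 (real n * infdist z \<real>\<^sub>\<ge>\<^sub>0)"

lemma continuous_cutoff: "isCont (cutoff n) z"
  unfolding cutoff_def by (intro continuous_intros)

lemma cutoff_bounds: "0 \<le> cutoff n z" "cutoff n z \<le> 1"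
  by (auto simp: cutoff_def infdist_nonneg)

lemma cutoff_eq_0: "z \<in> \<real>\<^sub>\<ge>\<^sub>0 \<Longrightarrow> cutoff n z = 0"
  by (simp add: cutoff_def)

lemma cutoff_tendsto:
  assumes "z \<notin> \<real>\<^sub>\<ge>\<^sub>0"
  shows "(\<lambda>n. cutoff n z) \<longlonglongrightarrow> 1"
proof -
  have pos: "infdist z \<real>\<^sub>\<ge>\<^sub>0 > 0"
    by (rule infdist_pos_not_in_closed[OF closed_nonneg_Reals_complex _ assms]) (auto simp: nonneg_Reals_def intro: exI[of _ 0])
  obtain N where N: "real N * infdist z \<real>\<^sub>\<ge>\<^sub>0 > 1"
    using reals_Archimedean3[OF pos] by blast
  have "cutoff n z = 1" if "n \<ge> N" for n
  proof -
    have "real N * infdist z \<real>\<^sub>\<ge>\<^sub>0 \<le> real n * infdist z \<real>\<^sub>\<ge>\<^sub>0"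
      using that pos by (intro mult_right_mono) auto
    then show ?thesis using N by (simp add: cutoff_def)
  qed
  then show ?thesis
    by (intro tendsto_eventually eventually_sequentiallyI)
qed

lemma cis_not_nonneg_Reals:
  assumes "0 < t" "t < 2 * pi"
  shows "cis t \<notin> \<real>\<^sub>\<ge>\<^sub>0" "Arg2pi (cis t) = t"
proof -
  show *: "Arg2pi (cis t) = t"
    by (rule Arg2pi_unique[of 1]) (use assms in \<open>auto simp: cis_conv_exp\<close>)
  show "cis t \<notin> \<real>\<^sub>\<ge>\<^sub>0"
  proof
    assume "cis t \<in> \<real>\<^sub>\<ge>\<^sub>0"
    then have "cis t \<in> \<real> \<and> 0 \<le> Re (cis t)"
      by (simp add: complex_nonneg_Reals_iff complex_is_Real_iff)
    then show False using * assms Arg2pi_eq_0[of "cis t"] by simp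
  qed
qed

lemma periodic_approximation:
  fixes g :: "real \<times> real \<Rightarrow> real"
  assumes g: "continuous_on UNIV g" and M: "0 \<le> M" and e: "0 < e"
  obtains p where "trig_poly p"
    and "\<And>x. \<bar>cutoff n (cis (fst x)) * cutoff n (cis (snd x)) *
        max (- M) (min M (g (Arg2pi (cis (fst x)), Arg2pi (cis (snd x))))) - p x\<bar> < e"
proof -
  define H where "H q = cutoff n (fst q) * cutoff n (snd q) *
      max (- M) (min M (g (Arg2pi (fst q), Arg2pi (snd q))))" for q
  have cc: "isCont (\<lambda>q. cutoff n (fst q) * cutoff n (snd q)) q" for q :: "complex \<times> complex"
    by (intro continuous_intros continuous_at_compose[of _ fst "cutoff n", unfolded o_def]
        continuous_at_compose[of _ snd "cutoff n", unfolded o_def] continuous_cutoff)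
  have "isCont H q" for q
  proof (cases "fst q \<in> \<real>\<^sub>\<ge>\<^sub>0 \<or> snd q \<in> \<real>\<^sub>\<ge>\<^sub>0")
    case True
    then have 0: "cutoff n (fst q) * cutoff n (snd q) = 0" by (auto simp: cutoff_eq_0)
    have "((\<lambda>r. M * (cutoff n (fst r) * cutoff n (snd r))) \<longlongrightarrow> M * (cutoff n (fst q) * cutoff n (snd q))) (at q)"
      by (rule tendsto_mult[OF tendsto_const cc[unfolded isCont_def]])
    then have lim: "((\<lambda>r. M * (cutoff n (fst r) * cutoff n (snd r))) \<longlongrightarrow> 0) (at q)"
      using 0 by simp
    have "norm (H r) \<le> M * (cutoff n (fst r) * cutoff n (snd r))" for r
    proof -
      have "\<bar>max (- M) (min M (g (Arg2pi (fst r), Arg2pi (snd r))))\<bar> \<le> M" using M by auto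
      then have "\<bar>H r\<bar> \<le> (cutoff n (fst r) * cutoff n (snd r)) * M"
        unfolding H_def abs_mult by (intro mult_mono) (auto simp: cutoff_bounds)
      then show ?thesis by (simp add: mult.commute)
    qed
    then have "(H \<longlongrightarrow> 0) (at q)"
      by (intro Lim_null_comparison[OF _ lim]) auto
    moreover have "H q = 0" unfolding H_def 0 by simp
    ultimately show ?thesis by (simp add: isCont_def)
  next
    case False
    have A: "isCont (\<lambda>r. (Arg2pi (fst r), Arg2pi (snd r))) q"
      using False by (intro continuous_intros continuous_at_compose[of _ fst Arg2pi, unfolded o_def]
        continuous_at_compose[of _ snd Arg2pi, unfolded o_def] continuous_at_Arg2pi) auto
    have "isCont (\<lambda>r. g (Arg2pi (fst r), Arg2pi (snd r))) q"
      using continuous_at_compose[OF A, of g] g by (simp add: o_def continuous_on_eq_continuous_at)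
    then show ?thesis unfolding H_def by (intro continuous_intros cc)
  qed
  then have "continuous_on (sphere 0 1 \<times> sphere 0 1) H"
    by (simp add: continuous_at_imp_continuous_on)
  then obtain p where p: "real_polynomial_function p" "\<And>q. q \<in> sphere 0 1 \<times> sphere 0 1 \<Longrightarrow> \<bar>H q - p q\<bar> < e"
    using Stone_Weierstrass_real_polynomial_function[of "sphere 0 1 \<times> sphere 0 1" H e] e
    by (auto simp: compact_Times)
  show thesis
    by (rule that[OF real_polynomial_function_cis[OF p(1)]])
      (use p(2)[of "(cis a, cis b)" for a b] in \<open>auto simp: H_def\<close>)
qed

lemma norm_diff_tendsto:
  assumes g: "square_integrable g" and f: "\<And>n. square_integrable (f n)" and w: "integrable torus w"
    and lim: "AE x in torus. (\<lambda>n. f n x) \<longlonglongrightarrow> g x"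
    and bd: "\<And>n. AE x in torus. (g x - f n x)\<^sup>2 \<le> w x"
  shows "(\<lambda>n. norm (of_fun g - of_fun (f n))) \<longlonglongrightarrow> 0"
proof -
  have [measurable]: "g \<in> borel_measurable torus" "f n \<in> borel_measurable torus" for n
    using g f by (auto simp: square_integrable_def)
  have "(\<lambda>n. \<integral>x. (g x - f n x)\<^sup>2 \<partial>torus) \<longlonglongrightarrow> (\<integral>x. 0 \<partial>torus)"
  proof (rule integral_dominated_convergence[OF _ _ w])
    show "AE x in torus. (\<lambda>n. (g x - f n x)\<^sup>2) \<longlonglongrightarrow> 0"
      using lim
    proof eventually_elim
      case (elim x)
      have "(\<lambda>n. (g x - f n x)\<^sup>2) \<longlonglongrightarrow> (g x - g x)\<^sup>2" by (intro tendsto_intros elim)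
      then show ?case by simp
    qed
  qed (use bd in auto)
  moreover have "(norm (of_fun g - of_fun (f n)))\<^sup>2 = (\<integral>x. (g x - f n x)\<^sup>2 \<partial>torus)" for n
    unfolding of_fun_minus[OF g f]
    using square_integrable_add[OF g square_integrable_scale[OF f, of "-1"]] by (intro norm_of_fun) simp
  ultimately have "(\<lambda>n. (norm (of_fun g - of_fun (f n)))\<^sup>2) \<longlonglongrightarrow> 0" by simp
  then have "(\<lambda>n. sqrt ((norm (of_fun g - of_fun (f n)))\<^sup>2)) \<longlonglongrightarrow> sqrt 0"
    by (rule tendsto_real_sqrt)
  then show ?thesis by simp
qed

lemma trig_poly_dense_bounded:
  assumes [measurable]: "g \<in> borel_measurable torus" and gM: "\<And>x. \<bar>g x\<bar> \<le> M" and e: "0 < e"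
  shows "\<exists>p. trig_poly p \<and> norm (of_fun g - of_fun p) < e"
proof -
  have M: "0 \<le> M" using gM[of 0] by linarith
  define h where "h x = indicator cell x *\<^sub>R g x" for x
  have "h \<in> borel_measurable lborel"
    using assms(1) borel_measurable_restrict_space_iff[of cell lborel g]
    unfolding torus_def h_def by simp
  then have "h \<in> borel_measurable lebesgue"
    by (simp add: measurable_completion)
  then have "h measurable_on UNIV"
    by (intro lebesgue_measurable_imp_measurable_on_real) auto
  then obtain N s where N: "negligible N" and s: "\<And>n. continuous_on UNIV (s n)"
    and lim: "\<And>x. x \<notin> N \<Longrightarrow> (\<lambda>n. s n x) \<longlonglongrightarrow> h x"
    unfolding measurable_on_def by auto
  define F where "F n x = cutoff n (cis (fst x)) * cutoff n (cis (snd x)) *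
        max (- M) (min M (s n (Arg2pi (cis (fst x)), Arg2pi (cis (snd x)))))" for n and x :: "real \<times> real"
  have "\<exists>p. trig_poly p \<and> (\<forall>x. \<bar>F n x - p x\<bar> < 1 / real (Suc n))" for n
    unfolding F_def by (rule periodic_approximation[OF s[of n] M, where e = "1 / real (Suc n)" and n = n]) auto
  then obtain p where p: "\<And>n. trig_poly (p n)" "\<And>n x. \<bar>F n x - p n x\<bar> < 1 / real (Suc n)"
    by metis
  have FM: "\<bar>F n x\<bar> \<le> M" for n x
  proof -
    have "\<bar>F n x\<bar> \<le> (1 * 1) * M"
      unfolding F_def abs_mult using M by (intro mult_mono) (auto simp: cutoff_bounds)
    then show ?thesis by simp
  qed
  have "negligible (N \<union> (cell - box (0, 0) (2 * pi, 2 * pi)))"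
    by (intro negligible_Un N negligible_frontier_interval)
  then have "AE x in lebesgue. x \<notin> N \<union> (cell - box (0, 0) (2 * pi, 2 * pi))"
    by (intro AE_not_in) (simp add: negligible_iff_null_sets)
  then have "AE x in lborel. x \<notin> N \<union> (cell - box (0, 0) (2 * pi, 2 * pi))"
    using AE_completion_iff by blast
  then have ae: "AE x in torus. x \<notin> N \<union> (cell - box (0, 0) (2 * pi, 2 * pi))"
    unfolding torus_def by (subst AE_restrict_space_iff) (auto elim: eventually_mono)
  have conv: "AE x in torus. (\<lambda>n. p n x) \<longlonglongrightarrow> g x"
    using ae AE_space
  proof eventually_elim
    case (elim x)
    then have x: "x \<in> cell" "x \<notin> N" "0 < fst x" "fst x < 2 * pi" "0 < snd x" "snd x < 2 * pi"
      by (cases x; auto simp: space_torus mem_box Basis_prod_def)+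
    have "F n x = cutoff n (cis (fst x)) * cutoff n (cis (snd x)) * max (- M) (min M (s n x))" for n
      unfolding F_def using x by (simp add: cis_not_nonneg_Reals)
    moreover have "(\<lambda>n. cutoff n (cis (fst x)) * cutoff n (cis (snd x)) * max (- M) (min M (s n x)))
        \<longlonglongrightarrow> 1 * 1 * max (- M) (min M (h x))"
      using x by (intro tendsto_intros cutoff_tendsto cis_not_nonneg_Reals lim)
    moreover have "max (- M) (min M (h x)) = g x"
      using x gM[of x] by (simp add: h_def abs_le_iff max_def min_def)
    ultimately have "(\<lambda>n. F n x) \<longlonglongrightarrow> g x" by simp
    moreover have "(\<lambda>n. F n x - p n x) \<longlonglongrightarrow> 0"
    proof (rule Lim_null_comparison)
      show "\<forall>\<^sub>F n in sequentially. norm (F n x - p n x) \<le> 1 / real (Suc n)"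
        unfolding real_norm_def by (intro always_eventually allI less_imp_le p(2))
      show "(\<lambda>n. 1 / real (Suc n)) \<longlonglongrightarrow> 0"
        using LIMSEQ_inverse_real_of_nat by (simp add: inverse_eq_divide)
    qed
    ultimately have "(\<lambda>n. F n x - (F n x - p n x)) \<longlonglongrightarrow> g x - 0"
      by (rule tendsto_diff)
    then show ?case by simp
  qed
  have "(\<lambda>n. norm (of_fun g - of_fun (p n))) \<longlonglongrightarrow> 0"
  proof (rule norm_diff_tendsto[OF _ _ _ conv, of "\<lambda>x. (2 * M + 1)\<^sup>2"])
    show "square_integrable g" by (rule square_integrable_bounded) (use gM in auto)
    show "square_integrable (p n)" for n
      by (intro square_integrable_continuous trig_poly_continuous p)
    show "AE x in torus. (g x - p n x)\<^sup>2 \<le> (2 * M + 1)\<^sup>2" for n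
    proof (rule AE_I2)
      fix x
      have "1 / real (Suc n) \<le> 1" by simp
      then have "\<bar>g x - p n x\<bar> \<le> 2 * M + 1"
        using gM[of x] FM[of n x] p(2)[of n x] by linarith
      then have "\<bar>g x - p n x\<bar>\<^sup>2 \<le> (2 * M + 1)\<^sup>2" by (intro power_mono) auto
      then show "(g x - p n x)\<^sup>2 \<le> (2 * M + 1)\<^sup>2" by simp
    qed
  qed auto
  then have "\<forall>\<^sub>F n in sequentially. norm (of_fun g - of_fun (p n)) < e"
    using e by (intro order_tendstoD(2)) auto
  then obtain n where "norm (of_fun g - of_fun (p n)) < e"
    unfolding eventually_sequentially by blast
  then show ?thesis using p(1) by blast
qed

lemma trig_poly_dense:
  assumes "0 < e"
  shows "\<exists>p. trig_poly p \<and> norm (v - of_fun p) < e"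
proof (cases v rule: l2_cases)
  fix g assume g: "square_integrable g" "v = of_fun g"
  have [measurable]: "g \<in> borel_measurable torus" using g(1) by (simp add: square_integrable_def)
  define T where "T n x = max (- real n) (min (real n) (g x))" for n :: nat and x
  have T: "T n \<in> borel_measurable torus" "\<bar>T n x\<bar> \<le> real n" for n x
    unfolding T_def[abs_def] by auto
  have "(\<lambda>n. norm (of_fun g - of_fun (T n))) \<longlonglongrightarrow> 0"
  proof (rule norm_diff_tendsto[OF g(1), of T "\<lambda>x. (g x)\<^sup>2"])
    show "square_integrable (T n)" for n by (rule square_integrable_bounded) (use T in auto)
    show "integrable torus (\<lambda>x. (g x)\<^sup>2)" using g by (simp add: square_integrable_def)
    show "AE x in torus. (\<lambda>n. T n x) \<longlonglongrightarrow> g x"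
    proof (rule AE_I2)
      fix x
      obtain m :: nat where m: "\<bar>g x\<bar> \<le> real m" using real_arch_simple by blast
      have "T n x = g x" if "n \<ge> m" for n
        using m that of_nat_mono[OF that, where 'a = real] unfolding T_def by auto
      then show "(\<lambda>n. T n x) \<longlonglongrightarrow> g x"
        by (intro tendsto_eventually eventually_sequentiallyI)
    qed
    show "AE x in torus. (g x - T n x)\<^sup>2 \<le> (g x)\<^sup>2" for n
      by (rule AE_I2) (auto simp: T_def abs_le_square_iff[symmetric])
  qed
  then have "\<forall>\<^sub>F n in sequentially. norm (of_fun g - of_fun (T n)) < e / 2"
    using assms by (intro order_tendstoD(2)) auto
  then obtain n where n: "norm (of_fun g - of_fun (T n)) < e / 2"
    unfolding eventually_sequentially by blast
  obtain p where p: "trig_poly p" "norm (of_fun (T n) - of_fun p) < e / 2"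
    using trig_poly_dense_bounded[OF T, of "e / 2"] assms by auto
  have "norm (v - of_fun p) < e"
    using norm_triangle_lt[of "of_fun g - of_fun (T n)" "of_fun (T n) - of_fun p" e] n p g by simp
  then show ?thesis using p by blast
qed

section \<open>Parseval's identity\<close>

lemma trig_poly_orthogonal:
  assumes "trig_poly p"
  shows "\<exists>S. finite S \<and> (\<forall>r. (\<forall>k\<in>S. fc r k = 0) \<longrightarrow> inner r (of_fun p) = 0)"
  using assms
proof induction
  case (trig_poly_trig z k)
  show ?case by (rule exI[of _ "{k}"]) (simp add: inner_trig)
next
  case (trig_poly_add f g)
  then obtain S T where "finite S" "\<And>r. (\<forall>k\<in>S. fc r k = 0) \<Longrightarrow> inner r (of_fun f) = 0"
    "finite T" "\<And>r. (\<forall>k\<in>T. fc r k = 0) \<Longrightarrow> inner r (of_fun g) = 0" by blast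
  moreover have "of_fun (\<lambda>x. f x + g x) = of_fun f + of_fun g"
    using trig_poly_add by (intro of_fun_add[symmetric] square_integrable_continuous trig_poly_continuous)
  ultimately show ?case
    by (intro exI[of _ "S \<union> T"]) (auto simp: inner_add_right)
qed

definition fourier_sum :: "(int \<times> int) set \<Rightarrow> l2 \<Rightarrow> l2" where
  "fourier_sum S v = (\<Sum>k\<in>S. of_fun (trig (fc v k) k))"

lemma fc_sum: "fc (\<Sum>i\<in>S. v i) k = (\<Sum>i\<in>S. fc (v i) k)"
  by (rule linear_sum[OF bounded_linear.linear[OF bounded_linear_fc]])

lemma fc_fourier_sum:
  assumes S: "finite S" "uminus ` S = S" and k: "k \<in> S"
  shows "fc (fourier_sum S v) k = fc v k"
proof -
  have "- k \<in> S" using S k by auto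
  have eq: "(k = - l) = (l = - k)" for l by auto
  have "fc (fourier_sum S v) k = ((\<Sum>l\<in>S. if k = l then fc v l else 0) + (\<Sum>l\<in>S. if l = - k then cnj (fc v l) else 0)) / 2"
    unfolding fourier_sum_def fc_sum fc_trig sum_divide_distrib[symmetric] sum.distrib eq ..
  also have "\<dots> = fc v k"
    using S(1) k \<open>- k \<in> S\<close> by (simp add: fc_hermitian)
  finally show ?thesis .
qed

lemma fourier_sum_error:
  assumes S: "finite S" "uminus ` S = S"
  shows "(norm (v - fourier_sum S v))\<^sup>2 = (norm v)\<^sup>2 - 4 * pi\<^sup>2 * (\<Sum>k\<in>S. (cmod (fc v k))\<^sup>2)"
    and "inner (v - fourier_sum S v) (fourier_sum S v) = 0"
proof -
  let ?r = "v - fourier_sum S v"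
  have r: "fc ?r k = 0" if "k \<in> S" for k
    using fc_fourier_sum[OF S that] by (simp add: fc_diff)
  show 0: "inner ?r (fourier_sum S v) = 0"
    unfolding fourier_sum_def[of S v] inner_sum_right unfolding fourier_sum_def[symmetric]
    by (simp add: inner_trig r)
  have "inner v (fourier_sum S v) = 4 * pi\<^sup>2 * (\<Sum>k\<in>S. (cmod (fc v k))\<^sup>2)"
    unfolding fourier_sum_def inner_sum_right inner_trig sum_distrib_left
    by (intro sum.cong refl) (simp add: power2_eq_square[symmetric] cmod_power2)
  then show "(norm ?r)\<^sup>2 = (norm v)\<^sup>2 - 4 * pi\<^sup>2 * (\<Sum>k\<in>S. (cmod (fc v k))\<^sup>2)"
    using 0 by (simp add: power2_norm_eq_inner inner_diff_left inner_diff_right inner_commute)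
qed

lemma parseval_norm: "((\<lambda>k. (cmod (fc v k))\<^sup>2) has_sum (norm v)\<^sup>2 / (4 * pi\<^sup>2)) UNIV"
proof -
  have bessel: "(\<Sum>k\<in>S. (cmod (fc v k))\<^sup>2) \<le> (norm v)\<^sup>2 / (4 * pi\<^sup>2)" if "finite S" for S
  proof -
    have T: "finite (S \<union> uminus ` S)" "uminus ` (S \<union> uminus ` S) = S \<union> uminus ` S"
      using that by (auto simp: image_Un image_image)
    have "(\<Sum>k\<in>S. (cmod (fc v k))\<^sup>2) \<le> (\<Sum>k\<in>S \<union> uminus ` S. (cmod (fc v k))\<^sup>2)"
      by (intro sum_mono2 T) auto
    also have "4 * pi\<^sup>2 * \<dots> \<le> (norm v)\<^sup>2"
      using fourier_sum_error(1)[OF T, of v] by (metis diff_ge_0_iff_ge zero_le_power2)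
    finally show ?thesis by (simp add: field_simps)
  qed
  have "(norm v)\<^sup>2 / (4 * pi\<^sup>2) \<le> (SUP S\<in>{S. finite S}. \<Sum>k\<in>S. (cmod (fc v k))\<^sup>2)" (is "_ \<le> ?s")
  proof (rule field_le_epsilon)
    fix e :: real assume "0 < e"
    define d where "d = sqrt (4 * pi\<^sup>2 * e)"
    have d: "0 < d" "d\<^sup>2 = 4 * pi\<^sup>2 * e" using \<open>0 < e\<close> by (auto simp: d_def)
    obtain p where p: "trig_poly p" "norm (v - of_fun p) < d" using trig_poly_dense[OF d(1)] by blast
    obtain S where S: "finite S" "\<And>r. (\<forall>k\<in>S. fc r k = 0) \<Longrightarrow> inner r (of_fun p) = 0"
      using trig_poly_orthogonal[OF p(1)] by blast
    define T where "T = S \<union> uminus ` S"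
    have T: "finite T" "uminus ` T = T"
      using S(1) by (auto simp: T_def image_Un image_image)
    define r where "r = v - fourier_sum T v"
    have "fc r k = 0" if "k \<in> T" for k
      using fc_fourier_sum[OF T that] by (simp add: fc_diff r_def)
    then have 0: "inner r (of_fun p) = 0" using S(2) by (simp add: T_def)
    have 1: "inner r (fourier_sum T v) = 0" unfolding r_def by (rule fourier_sum_error[OF T])
    have "(norm (v - of_fun p))\<^sup>2 = (norm (r + (fourier_sum T v - of_fun p)))\<^sup>2" by (simp add: r_def)
    also have "\<dots> = (norm r)\<^sup>2 + (norm (fourier_sum T v - of_fun p))\<^sup>2"
      using 0 1 by (simp add: norm_add_Pythagorean orthogonal_def inner_diff_right)
    finally have "(norm r)\<^sup>2 \<le> (norm (v - of_fun p))\<^sup>2" by simp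
    also have "\<dots> \<le> d\<^sup>2" using p(2) by (intro power_mono) auto
    finally have "(norm v)\<^sup>2 - 4 * pi\<^sup>2 * (\<Sum>k\<in>T. (cmod (fc v k))\<^sup>2) \<le> 4 * pi\<^sup>2 * e"
      unfolding r_def fourier_sum_error(1)[OF T] d .
    then have "(norm v)\<^sup>2 / (4 * pi\<^sup>2) \<le> (\<Sum>k\<in>T. (cmod (fc v k))\<^sup>2) + e"
      by (simp add: field_simps)
    also have "(\<Sum>k\<in>T. (cmod (fc v k))\<^sup>2) \<le> ?s"
      using T(1) bessel by (intro cSUP_upper) (auto intro!: bdd_aboveI2)
    finally show "(norm v)\<^sup>2 / (4 * pi\<^sup>2) \<le> ?s + e" by simp
  qed
  moreover have "?s \<le> (norm v)\<^sup>2 / (4 * pi\<^sup>2)"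
    using bessel by (intro cSUP_least) auto
  moreover have "((\<lambda>k. (cmod (fc v k))\<^sup>2) has_sum (SUP S\<in>{S. finite S \<and> S \<subseteq> UNIV}. \<Sum>k\<in>S. (cmod (fc v k))\<^sup>2)) UNIV"
    using bessel by (intro nonneg_bdd_above_has_sum) (auto intro!: bdd_aboveI2)
  moreover from calculation have "?s = (norm v)\<^sup>2 / (4 * pi\<^sup>2)" by (intro order_antisym) auto
  ultimately show ?thesis by simp
qed

lemma fc_eqI:
  assumes "\<And>k. fc v k = fc w k"
  shows "v = w"
proof -
  have "((\<lambda>k. (cmod (fc (v - w) k))\<^sup>2) has_sum 0) UNIV" by (simp add: fc_diff assms)
  then have "(norm (v - w))\<^sup>2 / (4 * pi\<^sup>2) = 0" using parseval_norm has_sum_unique by blast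
  then show ?thesis by simp
qed

lemma parseval: "((\<lambda>k. Re (fc v k * cnj (fc w k))) has_sum inner v w / (4 * pi\<^sup>2)) UNIV"
proof -
  have eq: "Re (a * cnj b) = ((cmod (a + b))\<^sup>2 - (cmod (a - b))\<^sup>2) / 4" for a b
    unfolding cmod_power2 by (simp add: power2_eq_square algebra_simps)
  have in_eq: "inner v w = ((norm (v + w))\<^sup>2 - (norm (v - w))\<^sup>2) / 4"
    by (simp add: power2_norm_eq_inner inner_commute algebra_simps)
  have "((\<lambda>k. (cmod (fc (v + w) k))\<^sup>2 * (1/4) + (cmod (fc (v - w) k))\<^sup>2 * (-1/4)) has_sum
      ((norm (v + w))\<^sup>2 / (4 * pi\<^sup>2) * (1/4) + (norm (v - w))\<^sup>2 / (4 * pi\<^sup>2) * (-1/4))) UNIV"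
    by (intro has_sum_add has_sum_cmult_left parseval_norm)
  then show ?thesis
    unfolding eq in_eq by (simp add: fc_add fc_diff field_simps)
qed

section \<open>Test functions\<close>

definition dsym :: "nat \<Rightarrow> nat \<Rightarrow> int \<times> int \<Rightarrow> complex" where
  "dsym i j k = (\<i> * of_int (fst k)) ^ i * (\<i> * of_int (snd k)) ^ j"

lemma cnj_dsym: "cnj (dsym i j k) = (- 1) ^ (i + j) * dsym i j k"
  by (simp add: dsym_def power_add power_minus[of "\<i> * complex_of_int (fst k)"] power_minus[of "\<i> * complex_of_int (snd k)"])

lemma trig_has_derivative: "(trig z k has_derivative (\<lambda>h. trig (\<i> * z) k x * theta k h)) (at x)"
proof -
  have th: "((\<lambda>x. theta k x) has_derivative theta k) (at x)"
    unfolding theta_def by (auto intro!: derivative_eq_intros)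
  have "((\<lambda>x. Re z * cos (theta k x) - Im z * sin (theta k x)) has_derivative
      (\<lambda>h. Re z * (theta k h * (- sin (theta k x))) - Im z * (theta k h * cos (theta k x)))) (at x)"
    by (rule derivative_eq_intros th refl ext | simp)+
  moreover have "(\<lambda>h. Re z * (theta k h * (- sin (theta k x))) - Im z * (theta k h * cos (theta k x))) =
      (\<lambda>h. trig (\<i> * z) k x * theta k h)"
    by (rule ext) (simp add: trig_def algebra_simps)
  moreover have "trig z k = (\<lambda>x. Re z * cos (theta k x) - Im z * sin (theta k x))"
    by (rule ext) (simp add: trig_def)
  ultimately show ?thesis by metis
qed

lemma partial_deriv_trig: "partial_deriv e (trig z k) = trig (\<i> * theta k e * z) k"
proof
  fix x
  have "frechet_derivative (trig z k) (at x) = (\<lambda>h. trig (\<i> * z) k x * theta k h)"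
    by (rule frechet_derivative_at[OF trig_has_derivative, symmetric])
  then show "partial_deriv e (trig z k) x = trig (\<i> * theta k e * z) k x"
    by (simp add: partial_deriv_def trig_def algebra_simps)
qed

lemma pderivs_trig: "pderivs i j (trig z k) = trig (dsym i j k * z) k"
proof -
  have "(partial_deriv (0, 1) ^^ j) (trig z k) = trig ((\<i> * of_int (snd k)) ^ j * z) k" for z
    by (induction j) (auto simp: partial_deriv_trig theta_def mult_ac)
  moreover have "(partial_deriv (1, 0) ^^ i) (trig z k) = trig ((\<i> * of_int (fst k)) ^ i * z) k" for z
    by (induction i) (auto simp: partial_deriv_trig theta_def mult_ac)
  ultimately show ?thesis by (simp add: pderivs_def dsym_def mult_ac)
qed

lemma test_fun_trig: "test_fun (trig z k)"
proof -
  have "trig w k differentiable (at x)" for w x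
    using trig_has_derivative differentiable_def by blast
  moreover have "cis (theta k (x + 2 * pi, y)) = cis (theta k (x, y))" "cis (theta k (x, y + 2 * pi)) = cis (theta k (x, y))" for x y
    using cis_theta_per(1)[of k 0] cis_theta_per(2)[of k 0]
    by (simp_all add: theta_def distrib_left cis_mult[symmetric])
  ultimately show ?thesis by (simp add: test_fun_def pderivs_trig) (simp add: trig_def)
qed

definition periodic :: "(real \<times> real \<Rightarrow> real) \<Rightarrow> bool" where
  "periodic g \<longleftrightarrow> (\<forall>x. g (x + (2 * pi, 0)) = g x \<and> g (x + (0, 2 * pi)) = g x)"

lemma periodic_partial_deriv:
  assumes per: "periodic g" and diff: "\<And>x. g differentiable (at x)"
  shows "periodic (partial_deriv e g)"
proof -
  have *: "frechet_derivative g (at (x + p)) = frechet_derivative g (at x)" if "\<And>x. g (x + p) = g x" for p x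
  proof -
    have "(g has_derivative frechet_derivative g (at (x + p))) (at (x + p))"
      using diff frechet_derivative_works by blast
    then have "((\<lambda>y. g (y + p)) has_derivative (\<lambda>h. frechet_derivative g (at (x + p)) h)) (at x)"
      by (rule has_derivative_compose[OF has_derivative_add_const[OF has_derivative_ident]])
    then show ?thesis
      using that by (simp add: frechet_derivative_at[symmetric])
  qed
  have "g (x + (2 * pi, 0)) = g x" "g (x + (0, 2 * pi)) = g x" for x
    using per unfolding periodic_def by blast+
  from this(1)[THEN *] this(2)[THEN *] show ?thesis
    unfolding periodic_def partial_deriv_def by simp
qed

lemma partial_derivs_real:
  assumes "g differentiable (at (x, y))"
  shows "((\<lambda>s. g (s, y)) has_vector_derivative partial_deriv (1, 0) g (x, y)) (at x)"
    and "((\<lambda>s. g (x, s)) has_vector_derivative partial_deriv (0, 1) g (x, y)) (at y)"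
proof -
  have g: "(g has_derivative frechet_derivative g (at (x, y))) (at (x, y))"
    using assms frechet_derivative_works by blast
  have lin: "h *\<^sub>R frechet_derivative g (at (x, y)) (1, 0) = frechet_derivative g (at (x, y)) (h, 0)"
    "h *\<^sub>R frechet_derivative g (at (x, y)) (0, 1) = frechet_derivative g (at (x, y)) (0, h)" for h
    using linear_scale[OF has_derivative_linear[OF g], of h "(1, 0)"]
      linear_scale[OF has_derivative_linear[OF g], of h "(0, 1)"] by simp_all
  have "((\<lambda>s. g (s, y)) has_derivative (\<lambda>h. frechet_derivative g (at (x, y)) (h, 0))) (at x)"
    by (rule has_derivative_compose[of "\<lambda>s. (s, y)" "\<lambda>h. (h, 0)"]) (auto intro!: derivative_eq_intros g)
  then show "((\<lambda>s. g (s, y)) has_vector_derivative partial_deriv (1, 0) g (x, y)) (at x)"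
    by (simp only: has_vector_derivative_def partial_deriv_def lin)
  have "((\<lambda>s. g (x, s)) has_derivative (\<lambda>h. frechet_derivative g (at (x, y)) (0, h))) (at y)"
    by (rule has_derivative_compose[of "\<lambda>s. (x, s)" "\<lambda>h. (0, h)"]) (auto intro!: derivative_eq_intros g)
  then show "((\<lambda>s. g (x, s)) has_vector_derivative partial_deriv (0, 1) g (x, y)) (at y)"
    by (simp only: has_vector_derivative_def partial_deriv_def lin)
qed

lemma has_vector_derivative_mult_cis:
  assumes "(f has_vector_derivative f') (at t)" "(c has_vector_derivative c') (at t)"
  shows "((\<lambda>s. complex_of_real (f s) * c s) has_vector_derivative
    (complex_of_real (f t) * c' + complex_of_real f' * c t)) (at t)"
proof -
  have "(f has_real_derivative f') (at t)"
    using assms(1) by (simp add: has_real_derivative_iff_has_vector_derivative)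
  then show ?thesis
    by (intro has_vector_derivative_mult has_vector_derivative_of_real assms(2))
qed

lemma fc_partial_deriv:
  assumes per: "periodic g" and diff: "\<And>x. g differentiable (at x)"
  shows "continuous_on UNIV (partial_deriv (1, 0) g) \<Longrightarrow>
      fc (of_fun (partial_deriv (1, 0) g)) k = \<i> * of_int (fst k) * fc (of_fun g) k"
    and "continuous_on UNIV (partial_deriv (0, 1) g) \<Longrightarrow>
      fc (of_fun (partial_deriv (0, 1) g)) k = \<i> * of_int (snd k) * fc (of_fun g) k"
proof -
  have cg: "continuous_on UNIV g"
    using diff by (simp add: continuous_on_eq_continuous_within differentiable_imp_continuous_within)
  have gper: "g (2 * pi, y) = g (0, y)" "g (x, 2 * pi) = g (x, 0)" for x y
    using per[unfolded periodic_def, rule_format, of "(0, y)"] per[unfolded periodic_def, rule_format, of "(x, 0)"] by auto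
  have key: "fc (of_fun g') k = \<i> * m * fc (of_fun g) k"
    if c': "continuous_on UNIV g'" and 0: "(\<integral>x. complex_of_real (g x) * (\<i> * - m * cis (theta (- k) x)) +
        complex_of_real (g' x) * cis (theta (- k) x) \<partial>torus) = 0" for g' and m :: complex
  proof -
    have i: "integrable torus (\<lambda>x. complex_of_real (f x) * cis (theta (- k) x))" if "continuous_on UNIV f" for f
      by (intro integrable_mult_cis square_integrable_imp_integrable square_integrable_continuous that)
    have "(\<integral>x. complex_of_real (g' x) * cis (theta (- k) x) \<partial>torus) =
        (\<integral>x. \<i> * m * (complex_of_real (g x) * cis (theta (- k) x)) +
          (complex_of_real (g x) * (\<i> * - m * cis (theta (- k) x)) +
        complex_of_real (g' x) * cis (theta (- k) x)) \<partial>torus)"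
      by (intro Bochner_Integration.integral_cong) (auto simp: algebra_simps)
    also have "\<dots> = (\<integral>x. \<i> * m * (complex_of_real (g x) * cis (theta (- k) x)) \<partial>torus) + 0"
    proof (subst Bochner_Integration.integral_add)
      have "integrable torus (\<lambda>x. \<i> * - m * (complex_of_real (g x) * cis (theta (- k) x)) +
          complex_of_real (g' x) * cis (theta (- k) x))"
        by (intro Bochner_Integration.integrable_add integrable_mult_right i c' cg)
      then show "integrable torus (\<lambda>x. complex_of_real (g x) * (\<i> * - m * cis (theta (- k) x)) +
          complex_of_real (g' x) * cis (theta (- k) x))"
        by (simp add: mult_ac)
    qed (use 0 in \<open>auto intro!: integrable_mult_right i cg\<close>)
    also have "\<dots> = \<i> * m * (\<integral>x. complex_of_real (g x) * cis (theta (- k) x) \<partial>torus)"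
      by (simp only: Bochner_Integration.integral_mult_right_zero add_0_right)
    finally show ?thesis
      using cg c' by (simp add: fc_of_fun square_integrable_continuous)
  qed
  show "fc (of_fun (partial_deriv (1, 0) g)) k = \<i> * of_int (fst k) * fc (of_fun g) k"
    if c: "continuous_on UNIV (partial_deriv (1, 0) g)"
  proof (rule key[OF c])
    show "(\<integral>x. complex_of_real (g x) * (\<i> * - of_int (fst k) * cis (theta (- k) x)) +
        complex_of_real (partial_deriv (1, 0) g x) * cis (theta (- k) x) \<partial>torus) = 0"
    proof (rule integral_torus_dx[where G = "\<lambda>x. complex_of_real (g x) * cis (theta (- k) x)"])
      show "((\<lambda>s. complex_of_real (g (s, y)) * cis (theta (- k) (s, y))) has_vector_derivative
          complex_of_real (g (x, y)) * (\<i> * - of_int (fst k) * cis (theta (- k) (x, y))) +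
          complex_of_real (partial_deriv (1, 0) g (x, y)) * cis (theta (- k) (x, y))) (at x)" for x y
        using has_vector_derivative_mult_cis[OF partial_derivs_real(1)[OF diff]
            has_vector_derivative_cis_theta(1)[of "- k" y x]] by simp
    qed (auto intro!: continuous_intros c cg simp: gper cis_theta_per)
  qed
  show "fc (of_fun (partial_deriv (0, 1) g)) k = \<i> * of_int (snd k) * fc (of_fun g) k"
    if c: "continuous_on UNIV (partial_deriv (0, 1) g)"
  proof (rule key[OF c])
    show "(\<integral>x. complex_of_real (g x) * (\<i> * - of_int (snd k) * cis (theta (- k) x)) +
        complex_of_real (partial_deriv (0, 1) g x) * cis (theta (- k) x) \<partial>torus) = 0"
    proof (rule integral_torus_dy[where G = "\<lambda>x. complex_of_real (g x) * cis (theta (- k) x)"])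
      show "((\<lambda>s. complex_of_real (g (x, s)) * cis (theta (- k) (x, s))) has_vector_derivative
          complex_of_real (g (x, y)) * (\<i> * - of_int (snd k) * cis (theta (- k) (x, y))) +
          complex_of_real (partial_deriv (0, 1) g (x, y)) * cis (theta (- k) (x, y))) (at y)" for x y
        using has_vector_derivative_mult_cis[OF partial_derivs_real(2)[OF diff]
            has_vector_derivative_cis_theta(2)[of "- k" x y]] by simp
    qed (auto intro!: continuous_intros c cg simp: gper cis_theta_per)
  qed
qed

lemma test_fun_pderivs:
  assumes "test_fun \<phi>"
  shows "pderivs i j \<phi> differentiable (at x)" "continuous_on UNIV (pderivs i j \<phi>)" "periodic (pderivs i j \<phi>)"
proof -
  show d: "pderivs i j \<phi> differentiable (at x)" for i j x
    using assms unfolding test_fun_def by blast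
  show "continuous_on UNIV (pderivs i j \<phi>)"
    using d by (simp add: continuous_on_eq_continuous_within differentiable_imp_continuous_within)
  have 0: "periodic (pderivs 0 0 \<phi>)" using assms by (auto simp: pderivs_def periodic_def test_fun_def)
  have 1: "periodic (pderivs 0 j \<phi>)"
  proof (induction j)
    case (Suc j)
    have "pderivs 0 (Suc j) \<phi> = partial_deriv (0, 1) (pderivs 0 j \<phi>)" by (simp add: pderivs_def)
    then show ?case using periodic_partial_deriv[OF Suc d] by simp
  qed (rule 0)
  show "periodic (pderivs i j \<phi>)"
  proof (induction i)
    case (Suc i)
    have "pderivs (Suc i) j \<phi> = partial_deriv (1, 0) (pderivs i j \<phi>)" by (simp add: pderivs_def)
    then show ?case using periodic_partial_deriv[OF Suc d] by simp
  qed (rule 1)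
qed

lemma fc_pderivs:
  assumes "test_fun \<phi>"
  shows "fc (of_fun (pderivs i j \<phi>)) k = dsym i j k * fc (of_fun \<phi>) k"
proof (induction i)
  case 0
  show ?case
  proof (induction j)
    case (Suc j)
    have "pderivs 0 (Suc j) \<phi> = partial_deriv (0, 1) (pderivs 0 j \<phi>)" by (simp add: pderivs_def)
    then show ?case
      using fc_partial_deriv(2)[OF test_fun_pderivs(3,1)[OF assms, of 0 j], of k] Suc
        test_fun_pderivs(2)[OF assms, of 0 "Suc j"] by (simp add: dsym_def)
  qed (simp add: pderivs_def dsym_def)
next
  case (Suc i)
  have "pderivs (Suc i) j \<phi> = partial_deriv (1, 0) (pderivs i j \<phi>)" by (simp add: pderivs_def)
  then show ?case
    using fc_partial_deriv(1)[OF test_fun_pderivs(3,1)[OF assms, of i j], of k] Suc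
      test_fun_pderivs(2)[OF assms, of "Suc i" j] by (simp add: dsym_def)
qed

section \<open>Weak derivatives and Fourier coefficients\<close>

lemma has_weak_deriv_iff: "has_weak_deriv i j v w \<longleftrightarrow> (\<forall>k. fc w k = dsym i j k * fc v k)"
proof
  assume w: "has_weak_deriv i j v w"
  show "\<forall>k. fc w k = dsym i j k * fc v k"
  proof
    fix k
    have "Re (dsym i j k * z * cnj (fc v k)) = (- 1) ^ (i + j) * Re (z * cnj (fc w k))" for z
      using w[unfolded has_weak_deriv_def, rule_format, OF test_fun_trig, of z k]
      unfolding pderivs_trig inner_trig by simp
    then have *: "Re (z * (dsym i j k * cnj (fc v k))) = Re (z * ((- 1) ^ (i + j) * cnj (fc w k)))" for z
      by (cases "even (i + j)") (simp_all add: mult_ac)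
    have "dsym i j k * cnj (fc v k) = (- 1) ^ (i + j) * cnj (fc w k)"
      using *[of 1] *[of "- \<i>"] by (simp add: complex_eq_iff)
    then have "cnj (dsym i j k * cnj (fc v k)) = cnj ((- 1) ^ (i + j) * cnj (fc w k))" by simp
    then show "fc w k = dsym i j k * fc v k"
      by (cases "even (i + j)") (simp_all add: cnj_dsym)
  qed
next
  assume w: "\<forall>k. fc w k = dsym i j k * fc v k"
  show "has_weak_deriv i j v w"
    unfolding has_weak_deriv_def
  proof (intro allI impI)
    fix \<phi> assume \<phi>: "test_fun \<phi>"
    have "((\<lambda>k. (- 1) ^ (i + j) * Re (fc w k * cnj (fc (of_fun \<phi>) k))) has_sum
        ((- 1) ^ (i + j) * (inner w (of_fun \<phi>) / (4 * pi\<^sup>2)))) UNIV"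
      by (intro has_sum_cmult_right parseval)
    moreover have "(- 1) ^ (i + j) * Re (fc w k * cnj (fc (of_fun \<phi>) k)) =
        Re (fc v k * cnj (fc (of_fun (pderivs i j \<phi>)) k))" for k
      by (cases "even (i + j)") (simp_all add: w fc_pderivs[OF \<phi>] cnj_dsym mult_ac)
    ultimately have "inner v (of_fun (pderivs i j \<phi>)) / (4 * pi\<^sup>2) = (- 1) ^ (i + j) * (inner w (of_fun \<phi>) / (4 * pi\<^sup>2))"
      using parseval[of v "of_fun (pderivs i j \<phi>)"] has_sum_unique by (metis (no_types, lifting) has_sum_cong)
    then show "inner v (of_fun (pderivs i j \<phi>)) = (- 1) ^ (i + j) * inner w (of_fun \<phi>)"
      by (simp add: field_simps)
  qed
qed

lemma weak_deriv_eq: "has_weak_deriv i j v w \<Longrightarrow> weak_deriv i j v = w"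
  unfolding weak_deriv_def by (rule the_equality) (auto simp: has_weak_deriv_iff intro: fc_eqI)

lemma fc_weak_deriv:
  assumes "v \<in> sobolev m" "i + j \<le> m"
  shows "fc (weak_deriv i j v) k = dsym i j k * fc v k"
proof -
  obtain w where w: "has_weak_deriv i j v w" using assms by (auto simp: sobolev_def)
  then show ?thesis unfolding weak_deriv_eq[OF w] has_weak_deriv_iff by blast
qed

lemma has_weak_div_iff:
  "has_weak_div F w \<longleftrightarrow>
    (\<forall>k. fc w k = \<i> * of_int (fst k) * fc (fst F) k + \<i> * of_int (snd k) * fc (snd F) k)"
proof
  assume w: "has_weak_div F w"
  show "\<forall>k. fc w k = \<i> * of_int (fst k) * fc (fst F) k + \<i> * of_int (snd k) * fc (snd F) k"
  proof
    fix k
    have *: "Re (dsym 1 0 k * z * cnj (fc (fst F) k)) + Re (dsym 0 1 k * z * cnj (fc (snd F) k)) = - Re (z * cnj (fc w k))" for z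
    proof -
      have "4 * pi\<^sup>2 * (Re (dsym 1 0 k * z * cnj (fc (fst F) k)) + Re (dsym 0 1 k * z * cnj (fc (snd F) k))) =
          4 * pi\<^sup>2 * (- Re (z * cnj (fc w k)))"
        using w[unfolded has_weak_div_def, rule_format, OF test_fun_trig, of z k]
        unfolding pderivs_trig inner_trig by (simp only: distrib_left mult_minus_right)
      then show ?thesis by (subst (asm) mult_cancel_left) simp
    qed
    have "Re (fc w k) = - (of_int (fst k) * Im (fc (fst F) k) + of_int (snd k) * Im (fc (snd F) k))"
      using *[of 1] by (simp add: dsym_def)
    moreover have "Im (fc w k) = of_int (fst k) * Re (fc (fst F) k) + of_int (snd k) * Re (fc (snd F) k)"
      using *[of "- \<i>"] by (simp add: dsym_def)
    ultimately show "fc w k = \<i> * of_int (fst k) * fc (fst F) k + \<i> * of_int (snd k) * fc (snd F) k"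
      by (simp add: complex_eq_iff)
  qed
next
  assume w: "\<forall>k. fc w k = \<i> * of_int (fst k) * fc (fst F) k + \<i> * of_int (snd k) * fc (snd F) k"
  show "has_weak_div F w"
    unfolding has_weak_div_def
  proof (intro allI impI)
    fix \<phi> assume \<phi>: "test_fun \<phi>"
    have "((\<lambda>k. Re (fc (fst F) k * cnj (fc (of_fun (pderivs 1 0 \<phi>)) k)) +
          Re (fc (snd F) k * cnj (fc (of_fun (pderivs 0 1 \<phi>)) k))) has_sum
        (inner (fst F) (of_fun (pderivs 1 0 \<phi>)) / (4 * pi\<^sup>2) + inner (snd F) (of_fun (pderivs 0 1 \<phi>)) / (4 * pi\<^sup>2))) UNIV"
      by (intro has_sum_add parseval)
    moreover have "Re (fc (fst F) k * cnj (fc (of_fun (pderivs 1 0 \<phi>)) k)) +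
          Re (fc (snd F) k * cnj (fc (of_fun (pderivs 0 1 \<phi>)) k)) = - Re (fc w k * cnj (fc (of_fun \<phi>) k))" for k
      by (simp add: w fc_pderivs[OF \<phi>] dsym_def algebra_simps)
    moreover have "((\<lambda>k. - Re (fc w k * cnj (fc (of_fun \<phi>) k))) has_sum - (inner w (of_fun \<phi>) / (4 * pi\<^sup>2))) UNIV"
      unfolding has_sum_uminus minus_minus by (rule parseval)
    ultimately have "inner (fst F) (of_fun (pderivs 1 0 \<phi>)) / (4 * pi\<^sup>2) + inner (snd F) (of_fun (pderivs 0 1 \<phi>)) / (4 * pi\<^sup>2)
        = - (inner w (of_fun \<phi>) / (4 * pi\<^sup>2))"
      using has_sum_unique by (metis (no_types, lifting) has_sum_cong)
    then show "inner (fst F) (of_fun (pderivs 1 0 \<phi>)) + inner (snd F) (of_fun (pderivs 0 1 \<phi>)) = - inner w (of_fun \<phi>)"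
      unfolding add_divide_distrib[symmetric] minus_divide_left by (subst (asm) divide_cancel_right) simp
  qed
qed

lemma weak_div_eq: "has_weak_div F w \<Longrightarrow> weak_div F = w"
  unfolding weak_div_def by (rule the_equality) (auto simp: has_weak_div_iff intro: fc_eqI)

section \<open>Absolutely convergent Fourier series and products\<close>

lemma norm_of_fun_mult_le:
  assumes "f \<in> borel_measurable torus" "AE x in torus. \<bar>f x\<bar> \<le> B" "0 \<le> B" "square_integrable g"
  shows "norm (of_fun (\<lambda>x. f x * g x)) \<le> B * norm (of_fun g)"
proof (rule power2_le_imp_le)
  show "(norm (of_fun (\<lambda>x. f x * g x)))\<^sup>2 \<le> (B * norm (of_fun g))\<^sup>2"
    using square_integrable_mult_bounded[OF assms(1,2,4)]
    by (simp add: norm_of_fun power_mult_distrib assms(4))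
qed (use assms(3) in simp)

lemma synthesis:
  assumes sm: "(\<lambda>k. norm (c k)) summable_on UNIV" and herm: "\<And>k. c (- k) = cnj (c k)"
  obtains F where "continuous_on UNIV F" "\<And>x. \<bar>F x\<bar> \<le> (\<Sum>\<^sub>\<infinity>k. norm (c k))"
    and "\<And>k. fc (of_fun F) k = c k"
    and "\<And>g k. square_integrable g \<Longrightarrow> ((\<lambda>l. c l * fc (of_fun g) (k - l)) has_sum fc (of_fun (\<lambda>x. F x * g x)) k) UNIV"
proof -
  define F where "F x = (\<Sum>\<^sub>\<infinity>l. trig (c l) l x)" for x
  have ul: "uniform_limit UNIV (\<lambda>S x. \<Sum>l\<in>S. trig (c l) l x) F (finite_subsets_at_top UNIV)"
    unfolding F_def[abs_def]
    by (rule Weierstrass_m_test_general[where M = "\<lambda>k. norm (c k)"]) (auto simp: sm abs_trig_le)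
  have cont: "continuous_on UNIV F"
    by (rule uniform_limit_theorem[OF _ ul]) (auto intro!: always_eventually continuous_intros)
  have sums: "(\<lambda>l. \<bar>trig (c l) l x\<bar>) summable_on UNIV" for x
    by (rule summable_on_comparison_test[OF sm]) (auto simp: abs_trig_le)
  have bound: "\<bar>F x\<bar> \<le> (\<Sum>\<^sub>\<infinity>k. norm (c k))" for x
  proof -
    have "norm (F x) \<le> (\<Sum>\<^sub>\<infinity>l. norm (trig (c l) l x))"
      unfolding F_def using sums[of x] by (intro norm_infsum_bound) simp
    also have "\<dots> \<le> (\<Sum>\<^sub>\<infinity>k. norm (c k))"
      using sums[of x] sm by (intro infsum_mono) (auto simp: abs_trig_le)
    finally show ?thesis by simp
  qed
  have mult: "((\<lambda>l. of_fun (\<lambda>x. trig (c l) l x * g x)) has_sum of_fun (\<lambda>x. F x * g x)) UNIV"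
    if g: "square_integrable g" for g
    unfolding has_sum_def
  proof (rule tendstoI)
    fix e :: real assume e: "0 < e"
    define d where "d = e / (1 + norm (of_fun g))"
    have n0: "0 < 1 + norm (of_fun g)" using norm_ge_zero[of "of_fun g"] by linarith
    have d: "0 < d" using e n0 by (simp add: d_def)
    have si: "square_integrable (\<lambda>x. trig (c l) l x * g x)" for l
      by (rule square_integrable_mult_bounded(1)[OF trig_measurable _ g])
        (auto intro!: AE_torusI abs_trig_le)
    have siF: "square_integrable (\<lambda>x. F x * g x)"
      by (rule square_integrable_mult_bounded(1)[OF continuous_measurable_torus[OF cont] _ g])
        (auto intro!: AE_torusI bound)
    show "\<forall>\<^sub>F S in finite_subsets_at_top UNIV.
        dist (\<Sum>l\<in>S. of_fun (\<lambda>x. trig (c l) l x * g x)) (of_fun (\<lambda>x. F x * g x)) < e"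
      using uniform_limitD[OF ul d]
    proof eventually_elim
      case (elim S)
      have "(\<Sum>l\<in>S. of_fun (\<lambda>x. trig (c l) l x * g x)) - of_fun (\<lambda>x. F x * g x) =
          of_fun (\<lambda>x. (\<Sum>l\<in>S. trig (c l) l x * g x) - F x * g x)"
        using of_fun_sum[of S "\<lambda>l x. trig (c l) l x * g x"] si siF by (simp add: of_fun_minus)
      also have "\<dots> = of_fun (\<lambda>x. ((\<Sum>l\<in>S. trig (c l) l x) - F x) * g x)"
        by (simp add: sum_distrib_right left_diff_distrib)
      finally have "dist (\<Sum>l\<in>S. of_fun (\<lambda>x. trig (c l) l x * g x)) (of_fun (\<lambda>x. F x * g x)) =
          norm (of_fun (\<lambda>x. ((\<Sum>l\<in>S. trig (c l) l x) - F x) * g x))"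
        by (simp add: dist_norm)
      also have "\<dots> \<le> d * norm (of_fun g)"
        using elim d g
        by (intro norm_of_fun_mult_le)
          (auto simp: dist_real_def less_imp_le intro!: AE_torusI continuous_measurable_torus continuous_intros cont)
      also have "\<dots> < d * (1 + norm (of_fun g))" using d by simp
      also have "\<dots> = e" using n0 by (simp add: d_def)
      finally show ?case .
    qed
  qed
  have conv: "((\<lambda>l. c l * fc (of_fun g) (k - l)) has_sum fc (of_fun (\<lambda>x. F x * g x)) k) UNIV"
    if g: "square_integrable g" for g k
  proof -
    have 0: "((\<lambda>l. c l * fc (of_fun g) (k - l) / 2 + cnj (c l) * fc (of_fun g) (k + l) / 2) has_sum
        fc (of_fun (\<lambda>x. F x * g x)) k) UNIV"
      using has_sum_bounded_linear[OF bounded_linear_fc[of k] mult[OF g]]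
      unfolding fc_mult_trig[OF g] by (simp add: add_divide_distrib)
    have "(\<lambda>l. norm (c l * fc (of_fun g) (k - l))) summable_on UNIV"
    proof (rule Infinite_Sum.abs_summable_on_comparison_test'[where g = "\<lambda>l. norm (c l) * norm (of_fun g)"])
      show "(\<lambda>l. norm (c l) * norm (of_fun g)) summable_on UNIV"
        by (intro summable_on_cmult_left sm)
    qed (auto simp: norm_mult fc_bound mult_left_mono)
    then have s: "((\<lambda>l. c l * fc (of_fun g) (k - l)) has_sum (\<Sum>\<^sub>\<infinity>l. c l * fc (of_fun g) (k - l))) UNIV" (is "(_ has_sum ?s) _")
      by (rule has_sum_infsum[OF abs_summable_summable])
    have s': "((\<lambda>l. cnj (c l) * fc (of_fun g) (k + l)) has_sum ?s) UNIV"
      using s by (subst has_sum_reindex_bij_witness[of _ uminus uminus UNIV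
        "\<lambda>l. c l * fc (of_fun g) (k - l)"]) (auto simp: herm)
    have "((\<lambda>l. c l * fc (of_fun g) (k - l) / 2 + cnj (c l) * fc (of_fun g) (k + l) / 2) has_sum
        (?s / 2 + ?s / 2)) UNIV"
      by (intro has_sum_add has_sum_divide_const s s')
    then have "fc (of_fun (\<lambda>x. F x * g x)) k = ?s"
      using 0 has_sum_unique by fastforce
    then show ?thesis using s by simp
  qed
  have "fc (of_fun F) k = c k" for k
  proof -
    have "((\<lambda>l. c l * (if k - l = 0 then 1 else 0)) has_sum fc (of_fun (\<lambda>x. F x * 1)) k) UNIV"
      using conv[of "\<lambda>_. 1" k] by (simp only: fc_one square_integrable_continuous continuous_on_const)
    moreover have "((\<lambda>l. c l * (if k - l = 0 then 1 else 0)) has_sum c k) UNIV"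
      by (rule has_sum_finite_neutralI[of "{k}"]) auto
    ultimately show ?thesis using has_sum_unique by fastforce
  qed
  then show thesis by (intro that[OF cont bound _ conv])
qed

lemma synthesis_exists:
  assumes "(\<lambda>k. norm (c k)) summable_on UNIV" "\<And>k. c (- k) = cnj (c k)"
  obtains v where "\<And>k. fc v k = c k"
  by (rule synthesis[OF assms], rule that) assumption+

definition wiener :: "l2 \<Rightarrow> bool" where
  "wiener v \<longleftrightarrow> (\<lambda>k. norm (fc v k)) summable_on UNIV"

definition wnorm :: "l2 \<Rightarrow> real" where
  "wnorm v = (\<Sum>\<^sub>\<infinity>k. norm (fc v k))"

lemma wnorm_nonneg: "0 \<le> wnorm v"
  unfolding wnorm_def by (intro infsum_nonneg) auto

lemma l2_mult_commute: "v \<odot> w = w \<odot> v"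
proof (cases v rule: l2_cases, cases w rule: l2_cases)
  fix f g assume "square_integrable f" "v = of_fun f" "square_integrable g" "w = of_fun g"
  then show ?thesis by (simp add: l2_mult.abs_eq l2_eq_refl mult.commute)
qed

lemma wiener_mult:
  assumes "wiener v"
  obtains F where "continuous_on UNIV F" "\<And>x. \<bar>F x\<bar> \<le> wnorm v" "v = of_fun F"
    "\<And>g. square_integrable g \<Longrightarrow> square_integrable (\<lambda>x. F x * g x)"
    "\<And>g. square_integrable g \<Longrightarrow> v \<odot> of_fun g = of_fun (\<lambda>x. F x * g x)"
    "\<And>g k. square_integrable g \<Longrightarrow> ((\<lambda>l. fc v l * fc (of_fun g) (k - l)) has_sum fc (v \<odot> of_fun g) k) UNIV"
proof -
  obtain F where F: "continuous_on UNIV F" "\<And>x. \<bar>F x\<bar> \<le> wnorm v"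
    "\<And>k. fc (of_fun F) k = fc v k"
    "\<And>g k. square_integrable g \<Longrightarrow> ((\<lambda>l. fc v l * fc (of_fun g) (k - l)) has_sum fc (of_fun (\<lambda>x. F x * g x)) k) UNIV"
    by (rule synthesis[OF assms[unfolded wiener_def] fc_hermitian, folded wnorm_def], rule that) assumption+
  have v: "v = of_fun F" using F(3) by (intro fc_eqI) simp
  have si: "square_integrable (\<lambda>x. F x * g x)" if "square_integrable g" for g
    by (rule square_integrable_mult_bounded(1)[OF continuous_measurable_torus[OF F(1)] _ that])
      (auto intro!: AE_torusI F(2))
  have m: "v \<odot> of_fun g = of_fun (\<lambda>x. F x * g x)" if "square_integrable g" for g
    unfolding v by (intro l2_mult_of_fun si square_integrable_continuous F(1) that)
  have "((\<lambda>l. fc v l * fc (of_fun g) (k - l)) has_sum fc (v \<odot> of_fun g) k) UNIV" if "square_integrable g" for g k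
    unfolding m[OF that] by (rule F(4)[OF that])
  then show thesis by (intro that[OF F(1,2) v si m])
qed

lemma norm_wiener_mult:
  assumes "wiener v"
  shows "norm (v \<odot> w) \<le> wnorm v * norm w"
proof -
  obtain F where F: "continuous_on UNIV F" "\<And>x. \<bar>F x\<bar> \<le> wnorm v"
    "\<And>g. square_integrable g \<Longrightarrow> v \<odot> of_fun g = of_fun (\<lambda>x. F x * g x)"
    by (rule wiener_mult[OF assms], rule that) assumption+
  obtain g where g: "square_integrable g" "w = of_fun g" by (rule l2_cases)
  show ?thesis unfolding g(2) F(3)[OF g(1)]
    by (rule norm_of_fun_mult_le[OF continuous_measurable_torus[OF F(1)] _ wnorm_nonneg g(1)])
      (intro AE_torusI F(2))
qed

lemma fc_wiener_mult:
  assumes "wiener v"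
  shows "((\<lambda>l. fc v (k - l) * fc w l) has_sum fc (v \<odot> w) k) UNIV"
proof -
  obtain g where g: "square_integrable g" "w = of_fun g" by (rule l2_cases)
  have "((\<lambda>l. fc v l * fc w (k - l)) has_sum fc (v \<odot> w) k) UNIV"
    unfolding g(2) by (rule wiener_mult[OF assms]) (drule meta_spec, drule meta_spec, erule meta_mp, rule g(1))
  then show ?thesis
    by (subst has_sum_reindex_bij_witness[of _ "\<lambda>l. k - l" "\<lambda>l. k - l" UNIV "\<lambda>l. fc v l * fc w (k - l)"]) auto
qed

lemma wiener_diff:
  assumes "wiener v" "wiener w"
  shows "wiener (v - w)"
proof -
  have "(\<lambda>k. norm (fc v k) + norm (fc w k)) summable_on UNIV"
    using assms unfolding wiener_def by (rule summable_on_add)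
  then show ?thesis
    unfolding wiener_def fc_diff
    by (rule Infinite_Sum.abs_summable_on_comparison_test') (rule norm_triangle_ineq4)
qed

lemma has_sum_minus:
  fixes f g :: "'a \<Rightarrow> 'b::real_normed_vector"
  assumes "(f has_sum a) A" "(g has_sum b) A"
  shows "((\<lambda>x. f x - g x) has_sum (a - b)) A"
  using has_sum_add[OF assms(1) has_sum_bounded_linear[OF bounded_linear_minus[OF bounded_linear_ident] assms(2)]]
  by simp

lemma wiener_mult_diff:
  assumes "wiener v" "wiener v'"
  shows "(v - v') \<odot> w = v \<odot> w - v' \<odot> w"
proof (rule fc_eqI)
  fix k
  have "((\<lambda>l. fc v (k - l) * fc w l - fc v' (k - l) * fc w l) has_sum (fc (v \<odot> w) k - fc (v' \<odot> w) k)) UNIV"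
    by (intro has_sum_minus fc_wiener_mult assms)
  moreover have "((\<lambda>l. fc (v - v') (k - l) * fc w l) has_sum fc ((v - v') \<odot> w) k) UNIV"
    by (intro fc_wiener_mult wiener_diff assms)
  ultimately show "fc ((v - v') \<odot> w) k = fc (v \<odot> w - v' \<odot> w) k"
    using has_sum_unique by (fastforce simp: fc_diff left_diff_distrib)
qed

lemma wiener_mult_diff_right:
  assumes "wiener v"
  shows "v \<odot> (w - w') = v \<odot> w - v \<odot> w'"
proof (rule fc_eqI)
  fix k
  have "((\<lambda>l. fc v (k - l) * fc w l - fc v (k - l) * fc w' l) has_sum (fc (v \<odot> w) k - fc (v \<odot> w') k)) UNIV"
    by (intro has_sum_minus fc_wiener_mult assms)
  moreover have "((\<lambda>l. fc v (k - l) * fc (w - w') l) has_sum fc (v \<odot> (w - w')) k) UNIV"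
    by (intro fc_wiener_mult assms)
  ultimately show "fc (v \<odot> (w - w')) k = fc (v \<odot> w - v \<odot> w') k"
    using has_sum_unique by (fastforce simp: fc_diff right_diff_distrib)
qed

section \<open>Sobolev norms and Fourier coefficients\<close>

definition jap :: "int \<times> int \<Rightarrow> real" where
  "jap k = 1 + (of_int (fst k))\<^sup>2 + (of_int (snd k))\<^sup>2"

lemma jap_ge_1: "1 \<le> jap k" and jap_pos: "0 < jap k" and jap_nonneg: "0 \<le> jap k"
  by (auto simp: jap_def add_pos_nonneg)

lemma jap_minus [simp]: "jap (- k) = jap k"
  by (simp add: jap_def)

lemma summable_int_inverse_squares: "(\<lambda>a::int. 1 / (1 + (real_of_int a)\<^sup>2)) summable_on UNIV"
proof -
  have "summable (\<lambda>n. 1 / (1 + (real n)\<^sup>2))"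
  proof (rule summable_comparison_test)
    show "summable (\<lambda>n. inverse (real n ^ 2))" by (intro inverse_power_summable) auto
    have "norm (1 / (1 + (real n)\<^sup>2)) \<le> inverse (real n ^ 2)" if "n \<ge> 1" for n
      using that frac_le[of 1 1 "(real n)\<^sup>2" "1 + (real n)\<^sup>2"] by (simp add: inverse_eq_divide)
    then show "\<exists>N. \<forall>n\<ge>N. norm (1 / (1 + (real n)\<^sup>2)) \<le> inverse (real n ^ 2)" by blast
  qed
  then have nat: "(\<lambda>n. 1 / (1 + (real n)\<^sup>2)) summable_on UNIV"
    by (subst summable_on_UNIV_nonneg_real_iff) auto
  have "(\<lambda>a::int. 1 / (1 + (real_of_int a)\<^sup>2)) summable_on (range int \<union> range (\<lambda>n. - int n))"
  proof (rule summable_on_union)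
    show "(\<lambda>a::int. 1 / (1 + (real_of_int a)\<^sup>2)) summable_on range int"
      using nat by (subst summable_on_reindex) (auto simp: o_def)
    show "(\<lambda>a::int. 1 / (1 + (real_of_int a)\<^sup>2)) summable_on range (\<lambda>n. - int n)"
      using nat by (subst summable_on_reindex) (auto simp: o_def inj_on_def)
  qed
  moreover have "range int \<union> range (\<lambda>n. - int n) = UNIV"
  proof -
    have "a \<in> range int \<union> range (\<lambda>n. - int n)" for a :: int
      by (cases "a \<ge> 0") (auto simp: image_iff intro: exI[of _ "nat a"] exI[of _ "nat (- a)"])
    then show ?thesis by blast
  qed
  ultimately show ?thesis by simp
qed

lemma summable_jap: "(\<lambda>k. 1 / (jap k)\<^sup>2) summable_on UNIV"
proof -
  let ?f = "\<lambda>a::int. 1 / (1 + (real_of_int a)\<^sup>2)"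
  have "(\<lambda>(a, b). ?f a * ?f b) summable_on UNIV \<times> UNIV"
  proof (rule summable_on_SigmaI)
    show "((\<lambda>b. (\<lambda>(a, b). ?f a * ?f b) (a, b)) has_sum ?f a * infsum ?f UNIV) UNIV" for a
      unfolding prod.case by (intro has_sum_cmult_right has_sum_infsum summable_int_inverse_squares)
    show "(\<lambda>a. ?f a * infsum ?f UNIV) summable_on UNIV"
      by (intro summable_on_cmult_left summable_int_inverse_squares)
  qed (auto simp: add_nonneg_nonneg)
  then have s: "(\<lambda>(a, b). ?f a * ?f b) summable_on UNIV" by simp
  show ?thesis
  proof (rule summable_on_comparison_test[OF s])
    fix k :: "int \<times> int"
    let ?a = "(real_of_int (fst k))\<^sup>2" and ?b = "(real_of_int (snd k))\<^sup>2"
    have "(1 + ?a) * (1 + ?b) \<le> (jap k)\<^sup>2"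
      unfolding power2_eq_square[of "jap k"] by (intro mult_mono) (auto simp: jap_def)
    then have "1 / (jap k)\<^sup>2 \<le> 1 / ((1 + ?a) * (1 + ?b))"
      by (intro frac_le mult_pos_pos add_pos_nonneg) auto
    then show "1 / (jap k)\<^sup>2 \<le> (case k of (a, b) \<Rightarrow> ?f a * ?f b)"
      by (simp add: case_prod_beta)
  qed (simp add: zero_le_divide_iff)
qed

definition cw :: real where
  "cw = sqrt (\<Sum>\<^sub>\<infinity>k. 1 / (jap k)\<^sup>2)"

lemma cw_nonneg: "0 \<le> cw"
  unfolding cw_def by (auto intro!: infsum_nonneg simp: zero_le_divide_iff)

definition fsob :: "nat \<Rightarrow> l2 \<Rightarrow> bool" where
  "fsob m v \<longleftrightarrow> (\<lambda>k. jap k ^ m * (cmod (fc v k))\<^sup>2) summable_on UNIV"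

definition hs :: "nat \<Rightarrow> l2 \<Rightarrow> real" where
  "hs m v = (\<Sum>\<^sub>\<infinity>k. jap k ^ m * (cmod (fc v k))\<^sup>2)"

lemma hs_nonneg: "0 \<le> hs m v"
  unfolding hs_def by (intro infsum_nonneg) (simp add: jap_nonneg)

lemma fsob_0: "fsob 0 v" and hs_0: "hs 0 v = (norm v)\<^sup>2 / (4 * pi\<^sup>2)"
  using parseval_norm[of v] by (auto simp: fsob_def hs_def has_sum_iff)

lemma hs_finite_sum_le:
  assumes "fsob m v" "finite S"
  shows "(\<Sum>k\<in>S. jap k ^ m * (cmod (fc v k))\<^sup>2) \<le> hs m v"
  unfolding hs_def using assms by (intro finite_sum_le_infsum) (auto simp: fsob_def jap_nonneg)

lemma fsob_mono:
  assumes "fsob n v" "m \<le> n"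
  shows "fsob m v" "hs m v \<le> hs n v"
proof -
  have *: "jap k ^ m * (cmod (fc v k))\<^sup>2 \<le> jap k ^ n * (cmod (fc v k))\<^sup>2" for k
    by (intro mult_right_mono power_increasing assms jap_ge_1) auto
  show 1: "fsob m v"
    unfolding fsob_def by (rule summable_on_comparison_test[OF assms(1)[unfolded fsob_def] *]) (simp add: jap_nonneg)
  show "hs m v \<le> hs n v"
    unfolding hs_def using 1 assms(1) * by (intro infsum_mono) (auto simp: fsob_def)
qed

lemma weighted_l1_finite:
  assumes "fsob (m + 2) v" "finite S"
  shows "(\<Sum>k\<in>S. sqrt (jap k ^ m) * cmod (fc v k)) \<le> cw * sqrt (hs (m + 2) v)"
proof -
  let ?f = "\<lambda>k. 1 / jap k" and ?g = "\<lambda>k. jap k * (sqrt (jap k ^ m) * cmod (fc v k))"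
  have "(\<Sum>k\<in>S. sqrt (jap k ^ m) * cmod (fc v k)) = (\<Sum>k\<in>S. \<bar>?f k\<bar> * \<bar>?g k\<bar>)"
    using jap_pos by (intro sum.cong) (auto simp: abs_mult less_imp_neq[symmetric] jap_nonneg)
  also have "\<dots> \<le> L2_set ?f S * L2_set ?g S" by (rule L2_set_mult_ineq)
  also have "\<dots> \<le> cw * sqrt (hs (m + 2) v)"
  proof (intro mult_mono)
    show "L2_set ?f S \<le> cw"
      unfolding L2_set_def cw_def using assms(2) summable_jap
      by (intro real_sqrt_le_mono) (auto simp: power_divide intro!: finite_sum_le_infsum)
    have "(?g k)\<^sup>2 = jap k ^ (m + 2) * (cmod (fc v k))\<^sup>2" for k
      by (simp add: power_mult_distrib power_add jap_nonneg) (simp add: power2_eq_square)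
    then show "L2_set ?g S \<le> sqrt (hs (m + 2) v)"
      unfolding L2_set_def using hs_finite_sum_le[OF assms] by (intro real_sqrt_le_mono) simp
  qed (auto simp: cw_nonneg hs_nonneg L2_set_nonneg)
  finally show ?thesis .
qed

lemma fsob_wiener:
  assumes "fsob 2 v"
  shows "wiener v" "wnorm v \<le> cw * sqrt (hs 2 v)"
proof -
  have b: "(\<Sum>k\<in>S. cmod (fc v k)) \<le> cw * sqrt (hs 2 v)" if "finite S" for S
    using weighted_l1_finite[of 0 v S] assms that by (simp add: numeral_2_eq_2)
  show "wiener v" unfolding wiener_def
    by (rule nonneg_bdd_above_summable_on) (use b in \<open>auto intro!: bdd_aboveI2\<close>)
  then show "wnorm v \<le> cw * sqrt (hs 2 v)" unfolding wnorm_def wiener_def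
    by (rule infsum_le_finite_sums) (rule b)
qed

lemma cmod_dsym: "(cmod (dsym i j k))\<^sup>2 = ((of_int (fst k))\<^sup>2) ^ i * ((of_int (snd k))\<^sup>2) ^ j"
proof -
  have *: "(\<bar>x\<bar> ^ n)\<^sup>2 = (x\<^sup>2) ^ n" for x :: real and n
    by (metis mult.commute power2_abs power_mult)
  show ?thesis unfolding dsym_def norm_mult norm_power power_mult_distrib by (simp add: *)
qed

lemma cmod_dsym_le:
  assumes "i + j \<le> m"
  shows "(cmod (dsym i j k))\<^sup>2 \<le> jap k ^ m"
proof -
  have "(cmod (dsym i j k))\<^sup>2 \<le> jap k ^ i * jap k ^ j"
    unfolding cmod_dsym by (intro mult_mono power_mono) (auto simp: jap_def)
  also have "\<dots> \<le> jap k ^ m"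
    unfolding power_add[symmetric] by (intro power_increasing assms jap_ge_1)
  finally show ?thesis .
qed

lemma sobolev_fc_exists:
  assumes "(\<lambda>k. jap k ^ n * cmod (fc v k)) summable_on UNIV" "m \<le> 2 * n"
  shows "v \<in> sobolev m"
  unfolding sobolev_def
proof safe
  fix i j assume ij: "i + j \<le> m"
  have "(\<lambda>k. norm (dsym i j k * fc v k)) summable_on UNIV"
  proof (rule Infinite_Sum.abs_summable_on_comparison_test'[OF assms(1)])
    fix k
    have "(cmod (dsym i j k))\<^sup>2 \<le> (jap k ^ n)\<^sup>2"
      using cmod_dsym_le[of i j "2 * n" k] ij assms(2) by (simp add: power_mult[symmetric] mult.commute)
    then have "cmod (dsym i j k) \<le> jap k ^ n" by (rule power2_le_imp_le) (simp add: jap_nonneg)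
    then show "norm (dsym i j k * fc v k) \<le> jap k ^ n * cmod (fc v k)"
      by (simp add: norm_mult mult_right_mono)
  qed
  moreover have "dsym i j (- k) * fc v (- k) = cnj (dsym i j k * fc v k)" for k
  proof -
    have "dsym i j (- k) = (- 1) ^ (i + j) * dsym i j k"
      by (simp add: dsym_def power_add power_minus[of "\<i> * complex_of_int (fst k)"] power_minus[of "\<i> * complex_of_int (snd k)"])
    then show ?thesis by (simp add: fc_hermitian cnj_dsym)
  qed
  ultimately obtain w where "\<And>k. fc w k = dsym i j k * fc v k" by (rule synthesis_exists) blast
  then show "\<exists>w. has_weak_deriv i j v w" by (auto simp: has_weak_deriv_iff)
qed

lemma sobolev_mono: "v \<in> sobolev n \<Longrightarrow> m \<le> n \<Longrightarrow> v \<in> sobolev m"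
  by (auto simp: sobolev_def)

lemma sobolev_diff:
  assumes "v \<in> sobolev m" "w \<in> sobolev m"
  shows "v - w \<in> sobolev m"
  unfolding sobolev_def
proof safe
  fix i j assume "i + j \<le> m"
  then obtain v' w' where "has_weak_deriv i j v v'" "has_weak_deriv i j w w'"
    using assms unfolding sobolev_def by blast
  then have "has_weak_deriv i j (v - w) (v' - w')"
    by (simp add: has_weak_deriv_iff fc_diff right_diff_distrib)
  then show "\<exists>u. has_weak_deriv i j (v - w) u" by blast
qed

lemma weak_deriv_diff:
  assumes "v \<in> sobolev m" "w \<in> sobolev m" "i + j \<le> m"
  shows "weak_deriv i j (v - w) = weak_deriv i j v - weak_deriv i j w"
  by (rule fc_eqI) (simp add: fc_diff fc_weak_deriv[OF _ assms(3)] assms sobolev_diff right_diff_distrib)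

lemma finite_multi_index: "finite {(i, j). i + j \<le> (m::nat)}"
  by (rule finite_subset[of _ "{..m} \<times> {..m}"]) auto

lemma norm_weak_deriv_le:
  assumes "i + j \<le> m"
  shows "(norm (weak_deriv i j v))\<^sup>2 \<le> (sobolev_norm m v)\<^sup>2"
proof -
  have "(norm (weak_deriv i j v))\<^sup>2 = (\<lambda>(i, j). (norm (weak_deriv i j v))\<^sup>2) (i, j)" by simp
  also have "\<dots> \<le> (\<Sum>(i, j)\<in>{(i, j). i + j \<le> m}. (norm (weak_deriv i j v))\<^sup>2)"
    by (rule member_le_sum) (use assms finite_multi_index in auto)
  also have "\<dots> = (sobolev_norm m v)\<^sup>2"
    unfolding sobolev_norm_def by (subst real_sqrt_pow2) (auto intro!: sum_nonneg)
  finally show ?thesis .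
qed

lemma sobolev_norm_nonneg: "0 \<le> sobolev_norm m v"
  unfolding sobolev_norm_def by (auto intro!: sum_nonneg)

lemma sobolev_imp_fsob:
  assumes "v \<in> sobolev m"
  shows "fsob m v" "hs m v \<le> 3 ^ (m + 1) * (sobolev_norm m v)\<^sup>2"
proof -
  let ?W = "\<lambda>i j k. (cmod (fc (weak_deriv i j v) k))\<^sup>2"
  let ?N = "\<lambda>i j. (norm (weak_deriv i j v))\<^sup>2 / (4 * pi\<^sup>2)"
  have s: "((\<lambda>k. 3 ^ m * (?W 0 0 k + ?W m 0 k + ?W 0 m k)) has_sum 3 ^ m * (?N 0 0 + ?N m 0 + ?N 0 m)) UNIV"
    by (intro has_sum_cmult_right has_sum_add parseval_norm)
  have le: "jap k ^ m * (cmod (fc v k))\<^sup>2 \<le> 3 ^ m * (?W 0 0 k + ?W m 0 k + ?W 0 m k)" for k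
  proof -
    let ?a = "(real_of_int (fst k))\<^sup>2" and ?b = "(real_of_int (snd k))\<^sup>2"
    let ?M = "max 1 (max ?a ?b)"
    have "jap k \<le> 3 * ?M" by (simp add: jap_def)
    then have "jap k ^ m \<le> (3 * ?M) ^ m" by (intro power_mono jap_nonneg)
    also have "\<dots> = 3 ^ m * ?M ^ m" by (rule power_mult_distrib)
    also have "?M ^ m \<le> 1 + ?a ^ m + ?b ^ m" by (auto simp: max_def)
    finally have "jap k ^ m \<le> 3 ^ m * (1 + ?a ^ m + ?b ^ m)" by simp
    then have "jap k ^ m * (cmod (fc v k))\<^sup>2 \<le> 3 ^ m * (1 + ?a ^ m + ?b ^ m) * (cmod (fc v k))\<^sup>2"
      by (intro mult_right_mono) auto
    also have "\<dots> = 3 ^ m * (?W 0 0 k + ?W m 0 k + ?W 0 m k)"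
      using assms by (simp add: fc_weak_deriv[where m = m] norm_mult power_mult_distrib cmod_dsym algebra_simps)
    finally show ?thesis .
  qed
  show f: "fsob m v" unfolding fsob_def
    by (rule summable_on_comparison_test[OF has_sum_imp_summable[OF s] le]) (simp add: jap_nonneg)
  have "hs m v \<le> 3 ^ m * (?N 0 0 + ?N m 0 + ?N 0 m)"
    unfolding hs_def using f le by (intro has_sum_mono[OF has_sum_infsum s]) (auto simp: fsob_def)
  also have "?N i j \<le> (sobolev_norm m v)\<^sup>2" if "i + j \<le> m" for i j
  proof -
    have "1 \<le> 4 * pi\<^sup>2" using one_le_power[of pi 2] pi_gt3 by linarith
    then have "?N i j \<le> (norm (weak_deriv i j v))\<^sup>2 / 1" by (intro divide_left_mono) auto
    then show ?thesis using norm_weak_deriv_le[OF that, of v] by simp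
  qed
  from this[of 0 0] this[of m 0] this[of 0 m]
  have "3 ^ m * (?N 0 0 + ?N m 0 + ?N 0 m) \<le> 3 ^ m * (3 * (sobolev_norm m v)\<^sup>2)"
    by (intro mult_left_mono) auto
  finally show "hs m v \<le> 3 ^ (m + 1) * (sobolev_norm m v)\<^sup>2" by simp
qed

definition csob :: "nat \<Rightarrow> real" where
  "csob m = real (card {(i, j). i + j \<le> m}) * (4 * pi\<^sup>2)"

lemma csob_nonneg: "0 \<le> csob m"
  by (simp add: csob_def)

lemma sobolev_norm_le:
  assumes "v \<in> sobolev m"
  shows "(sobolev_norm m v)\<^sup>2 \<le> csob m * hs m v"
proof -
  have f: "fsob m v" using assms by (rule sobolev_imp_fsob)
  have *: "(norm (weak_deriv i j v))\<^sup>2 \<le> 4 * pi\<^sup>2 * hs m v" if "i + j \<le> m" for i j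
  proof -
    have "(norm (weak_deriv i j v))\<^sup>2 / (4 * pi\<^sup>2) \<le> hs m v"
      unfolding hs_def
    proof (rule has_sum_mono[OF parseval_norm has_sum_infsum])
      show "(cmod (fc (weak_deriv i j v) k))\<^sup>2 \<le> jap k ^ m * (cmod (fc v k))\<^sup>2" for k
        unfolding fc_weak_deriv[OF assms that] norm_mult power_mult_distrib
        by (intro mult_right_mono cmod_dsym_le that) auto
    qed (use f in \<open>auto simp: fsob_def\<close>)
    then show ?thesis by (simp add: field_simps)
  qed
  have "(sobolev_norm m v)\<^sup>2 = (\<Sum>(i, j)\<in>{(i, j). i + j \<le> m}. (norm (weak_deriv i j v))\<^sup>2)"
    unfolding sobolev_norm_def by (subst real_sqrt_pow2) (auto intro!: sum_nonneg)
  also have "\<dots> \<le> real (card {(i, j). i + j \<le> m}) * (4 * pi\<^sup>2 * hs m v)"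
    by (rule sum_bounded_above) (use * in auto)
  finally show ?thesis by (simp add: csob_def mult_ac)
qed

lemma continuous_sobolev_weak_deriv:
  assumes "continuous_sobolev m T v" "i + j \<le> m"
  shows "continuous_on {0..T} (\<lambda>t. weak_deriv i j (v t))"
  unfolding continuous_on_def
proof
  fix t assume t: "t \<in> {0..T}"
  have "((\<lambda>s. weak_deriv i j (v s) - weak_deriv i j (v t)) \<longlongrightarrow> 0) (at t within {0..T})"
  proof (rule Lim_null_comparison)
    show "((\<lambda>s. sobolev_norm m (v s - v t)) \<longlongrightarrow> 0) (at t within {0..T})"
      using assms t by (simp add: continuous_sobolev_def)
    show "\<forall>\<^sub>F s in at t within {0..T}. norm (weak_deriv i j (v s) - weak_deriv i j (v t)) \<le> sobolev_norm m (v s - v t)"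
      unfolding eventually_at_filter
    proof (intro always_eventually allI impI)
      fix s assume "s \<in> {0..T}"
      then have "weak_deriv i j (v s) - weak_deriv i j (v t) = weak_deriv i j (v s - v t)"
        using assms t by (intro weak_deriv_diff[symmetric]) (auto simp: continuous_sobolev_def)
      then show "norm (weak_deriv i j (v s) - weak_deriv i j (v t)) \<le> sobolev_norm m (v s - v t)"
        using power2_le_imp_le[OF norm_weak_deriv_le[OF assms(2)] sobolev_norm_nonneg] by simp
    qed
  qed
  then show "((\<lambda>s. weak_deriv i j (v s)) \<longlongrightarrow> weak_deriv i j (v t)) (at t within {0..T})"
    by (simp add: LIM_zero_iff)
qed

lemma weak_deriv_0_0: "weak_deriv 0 0 v = v"
  by (rule weak_deriv_eq) (simp add: has_weak_deriv_iff dsym_def)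

lemma continuous_sobolev_l2:
  assumes "continuous_sobolev m T v"
  shows "continuous_on {0..T} v"
  using continuous_sobolev_weak_deriv[OF assms, of 0 0] by (simp add: weak_deriv_0_0)

lemma continuous_sobolev_norm:
  assumes "continuous_sobolev m T v"
  shows "continuous_on {0..T} (\<lambda>t. (sobolev_norm m (v t))\<^sup>2)"
proof -
  have "(sobolev_norm m w)\<^sup>2 = (\<Sum>p\<in>{(i, j). i + j \<le> m}. (norm (weak_deriv (fst p) (snd p) w))\<^sup>2)" for w
    unfolding sobolev_norm_def by (subst real_sqrt_pow2) (auto intro!: sum_nonneg simp: case_prod_beta)
  then show ?thesis
    using continuous_sobolev_weak_deriv[OF assms] by (auto intro!: continuous_intros)
qed

section \<open>Advection by a divergence free field\<close>

definition div_free :: "l2 \<times> l2 \<Rightarrow> bool" where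
  "div_free u \<longleftrightarrow> (\<forall>k. of_int (fst k) * fc (fst u) k + of_int (snd k) * fc (snd u) k = 0)"

definition advect :: "l2 \<times> l2 \<Rightarrow> l2 \<Rightarrow> l2" where
  "advect u v = fst u \<odot> weak_deriv 1 0 v + snd u \<odot> weak_deriv 0 1 v"

definition tsym :: "l2 \<times> l2 \<Rightarrow> int \<times> int \<Rightarrow> int \<times> int \<Rightarrow> complex" where
  "tsym u k l = of_int (fst l) * fc (fst u) (k - l) + of_int (snd l) * fc (snd u) (k - l)"

definition umag :: "l2 \<times> l2 \<Rightarrow> int \<times> int \<Rightarrow> real" where
  "umag u d = cmod (fc (fst u) d) + cmod (fc (snd u) d)"

lemma umag_nonneg: "0 \<le> umag u d"
  by (simp add: umag_def)

lemma umag_minus: "umag u (- d) = umag u d"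
  by (simp add: umag_def fc_hermitian)

lemma tsym_commute:
  assumes "div_free u"
  shows "tsym u l k = cnj (tsym u k l)"
proof -
  have "tsym u l k = cnj (of_int (fst k) * fc (fst u) (k - l) + of_int (snd k) * fc (snd u) (k - l))"
    using fc_hermitian[of "fst u" "k - l"] fc_hermitian[of "snd u" "k - l"] by (simp add: tsym_def)
  also have "of_int (fst k) * fc (fst u) (k - l) + of_int (snd k) * fc (snd u) (k - l) = tsym u k l"
    using assms[unfolded div_free_def, rule_format, of "k - l"] by (simp add: tsym_def algebra_simps)
  finally show ?thesis .
qed

lemma norm_tsym_le: "cmod (tsym u k l) \<le> sqrt (jap l) * umag u (k - l)"
proof -
  have "\<bar>real_of_int (fst l)\<bar> \<le> sqrt (jap l)" "\<bar>real_of_int (snd l)\<bar> \<le> sqrt (jap l)"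
    by (rule real_le_rsqrt, simp add: jap_def)+
  then have "cmod (of_int (fst l) * fc (fst u) (k - l)) + cmod (of_int (snd l) * fc (snd u) (k - l))
      \<le> sqrt (jap l) * umag u (k - l)"
    unfolding norm_mult umag_def distrib_left by (intro add_mono mult_right_mono) auto
  then show ?thesis unfolding tsym_def using norm_triangle_ineq order_trans by blast
qed

lemma norm_tsym_le':
  assumes "div_free u"
  shows "cmod (tsym u k l) \<le> sqrt (jap k) * umag u (k - l)"
proof -
  have "cmod (tsym u k l) = cmod (tsym u l k)" by (subst tsym_commute[OF assms]) simp
  also have "\<dots> \<le> sqrt (jap k) * umag u (l - k)" by (rule norm_tsym_le)
  finally show ?thesis using umag_minus[of u "k - l"] by simp
qed

lemma fc_advect:
  assumes u: "wiener (fst u)" "wiener (snd u)" and v: "v \<in> sobolev 1"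
  shows "((\<lambda>l. \<i> * tsym u k l * fc v l) has_sum fc (advect u v) k) UNIV"
proof -
  have "((\<lambda>l. fc (fst u) (k - l) * fc (weak_deriv 1 0 v) l + fc (snd u) (k - l) * fc (weak_deriv 0 1 v) l)
      has_sum fc (advect u v) k) UNIV"
    unfolding advect_def fc_add by (intro has_sum_add fc_wiener_mult u)
  then show ?thesis
    by (rule has_sum_cong[THEN iffD1, rotated])
      (simp add: fc_weak_deriv[OF v] tsym_def dsym_def algebra_simps)
qed

lemma weak_div_scale_field:
  assumes u: "wiener (fst u)" "wiener (snd u)" "div_free u" and v: "v \<in> sobolev 1"
  shows "weak_div (v \<odot>\<^sub>v u) = advect u v"
proof (rule weak_div_eq, unfold has_weak_div_iff, rule allI)
  fix k
  have "((\<lambda>l. \<i> * of_int (fst k) * (fc (fst u) (k - l) * fc v l) + \<i> * of_int (snd k) * (fc (snd u) (k - l) * fc v l))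
      has_sum (\<i> * of_int (fst k) * fc (fst u \<odot> v) k + \<i> * of_int (snd k) * fc (snd u \<odot> v) k)) UNIV"
    by (intro has_sum_add has_sum_cmult_right fc_wiener_mult u)
  moreover have "\<i> * of_int (fst k) * (fc (fst u) (k - l) * fc v l) + \<i> * of_int (snd k) * (fc (snd u) (k - l) * fc v l)
      = \<i> * tsym u k l * fc v l" for l
  proof -
    have "of_int (fst k) * fc (fst u) (k - l) + of_int (snd k) * fc (snd u) (k - l) = tsym u k l"
      using u(3)[unfolded div_free_def, rule_format, of "k - l"] by (simp add: tsym_def algebra_simps)
    then have "\<i> * (of_int (fst k) * fc (fst u) (k - l) + of_int (snd k) * fc (snd u) (k - l)) * fc v l
      = \<i> * tsym u k l * fc v l" by simp
    then show ?thesis by (simp add: algebra_simps)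
  qed
  ultimately have "fc (advect u v) k = \<i> * of_int (fst k) * fc (fst u \<odot> v) k + \<i> * of_int (snd k) * fc (snd u \<odot> v) k"
    using fc_advect[OF u(1,2) v, of k] has_sum_unique by fastforce
  then show "fc (advect u v) k = \<i> * of_int (fst k) * fc (fst (v \<odot>\<^sub>v u)) k + \<i> * of_int (snd k) * fc (snd (v \<odot>\<^sub>v u)) k"
    by (simp add: scale_field_def l2_mult_commute[of v])
qed

lemma norm_advect_le:
  assumes u: "wiener (fst u)" "wiener (snd u)"
  shows "norm (advect u v) \<le> wnorm (fst u) * norm (weak_deriv 1 0 v) + wnorm (snd u) * norm (weak_deriv 0 1 v)"
  unfolding advect_def by (rule norm_triangle_le) (intro add_mono norm_wiener_mult u)

section \<open>Trilinear sums\<close>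

text \<open>The trilinear forms are estimated on finite sets of pairs of frequencies, which avoids questions
  of summability for double series.\<close>

definition l2b :: "('a \<Rightarrow> real) \<Rightarrow> real \<Rightarrow> bool" where
  "l2b a A \<longleftrightarrow> 0 \<le> A \<and> (\<forall>k. 0 \<le> a k) \<and> (\<forall>S. finite S \<longrightarrow> L2_set a S \<le> A)"

definition l1b :: "('a \<Rightarrow> real) \<Rightarrow> real \<Rightarrow> bool" where
  "l1b a A \<longleftrightarrow> 0 \<le> A \<and> (\<forall>k. 0 \<le> a k) \<and> (\<forall>S. finite S \<longrightarrow> sum a S \<le> A)"

lemma young_mid:
  fixes a g c :: "'g::ab_group_add \<Rightarrow> real"
  assumes a: "l2b a A" and g: "l1b g G" and c: "l2b c C" and F: "finite F"
  shows "(\<Sum>(k, l)\<in>F. a k * g (k - l) * c l) \<le> A * G * C"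
proof -
  let ?h = "\<lambda>(k, l). (k - l, l)"
  define D where "D = fst ` ?h ` F"
  define L where "L = snd ` ?h ` F"
  have fin: "finite D" "finite L" using F by (auto simp: D_def L_def)
  have nn: "0 \<le> a k" "0 \<le> g k" "0 \<le> c k" "0 \<le> A" "0 \<le> C" for k
    using a g c by (auto simp: l2b_def l1b_def)
  have "(\<Sum>(k, l)\<in>F. a k * g (k - l) * c l) = (\<Sum>(d, l)\<in>?h ` F. a (d + l) * g d * c l)"
    by (subst sum.reindex) (auto simp: inj_on_def intro!: sum.cong)
  also have "\<dots> \<le> (\<Sum>(d, l)\<in>D \<times> L. a (d + l) * g d * c l)"
    by (intro sum_mono2 finite_cartesian_product fin subset_fst_snd[of "?h ` F", folded D_def L_def])
      (auto simp: nn)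
  also have "\<dots> = (\<Sum>d\<in>D. g d * (\<Sum>l\<in>L. a (d + l) * c l))"
    by (simp add: sum.cartesian_product[symmetric] sum_distrib_left mult_ac)
  also have "\<dots> \<le> (\<Sum>d\<in>D. g d * (A * C))"
  proof (intro sum_mono mult_left_mono nn)
    fix d
    have "(\<Sum>l\<in>L. a (d + l) * c l) = (\<Sum>l\<in>L. \<bar>a (d + l)\<bar> * \<bar>c l\<bar>)" using nn by simp
    also have "\<dots> \<le> L2_set (\<lambda>l. a (d + l)) L * L2_set c L" by (rule L2_set_mult_ineq)
    also have "L2_set (\<lambda>l. a (d + l)) L = L2_set a ((+) d ` L)"
      unfolding L2_set_def by (subst sum.reindex) auto
    also have "\<dots> * L2_set c L \<le> A * C"
      using a c fin nn by (intro mult_mono) (auto simp: l2b_def L2_set_nonneg)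
    finally show "(\<Sum>l\<in>L. a (d + l) * c l) \<le> A * C" .
  qed
  also have "\<dots> = sum g D * (A * C)" by (simp add: sum_distrib_right)
  also have "\<dots> \<le> G * (A * C)" using g fin nn by (intro mult_right_mono) (auto simp: l1b_def)
  finally show ?thesis by (simp add: mult_ac)
qed

lemma young_right:
  fixes a g c :: "'g::ab_group_add \<Rightarrow> real"
  assumes a: "l2b a A" and g: "l2b g G" and c: "l1b c C" and F: "finite F"
  shows "(\<Sum>(k, l)\<in>F. a k * g (k - l) * c l) \<le> A * G * C"
proof -
  let ?h = "\<lambda>(k, l). (k, k - l)"
  have "(\<Sum>(k, l)\<in>F. a k * g (k - l) * c l) = (\<Sum>(k, l)\<in>?h ` F. a k * c (k - l) * g l)"
    by (subst sum.reindex) (auto simp: inj_on_def intro!: sum.cong)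
  also have "\<dots> \<le> A * C * G" using F by (intro young_mid a c g) auto
  finally show ?thesis by (simp add: mult_ac)
qed

lemma young_left:
  fixes a g c :: "'g::ab_group_add \<Rightarrow> real"
  assumes a: "l1b a A" and g: "l2b g G" "\<And>d. g (- d) = g d" and c: "l2b c C" and F: "finite F"
  shows "(\<Sum>(k, l)\<in>F. a k * g (k - l) * c l) \<le> A * G * C"
proof -
  have sw: "g (l - k) = g (k - l)" for k l using g(2)[of "k - l"] by simp
  have "(\<Sum>(k, l)\<in>F. a k * g (k - l) * c l) = (\<Sum>(k, l)\<in>prod.swap ` F. c k * g (k - l) * a l)"
    by (rule sum.reindex_bij_witness[of _ prod.swap prod.swap]) (auto simp: sw mult_ac)
  also have "\<dots> \<le> C * G * A" using F by (intro young_right a c g) auto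
  finally show ?thesis by (simp add: mult_ac)
qed

lemma l2b_fc:
  assumes "fsob m v"
  shows "l2b (\<lambda>k. sqrt (jap k) ^ m * cmod (fc v k)) (sqrt (hs m v))"
  unfolding l2b_def
proof (intro conjI allI impI)
  fix S :: "(int \<times> int) set" assume S: "finite S"
  have "(sqrt (jap k) ^ m * cmod (fc v k))\<^sup>2 = jap k ^ m * (cmod (fc v k))\<^sup>2" for k
    by (simp add: power_mult_distrib power_mult[symmetric] mult.commute[of m])
      (simp add: power_mult jap_nonneg)
  then show "L2_set (\<lambda>k. sqrt (jap k) ^ m * cmod (fc v k)) S \<le> sqrt (hs m v)"
    unfolding L2_set_def using hs_finite_sum_le[OF assms S] by simp
qed (auto simp: hs_nonneg jap_nonneg)

lemma l1b_fc:
  assumes "fsob (m + 2) v"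
  shows "l1b (\<lambda>k. sqrt (jap k) ^ m * cmod (fc v k)) (cw * sqrt (hs (m + 2) v))"
  using weighted_l1_finite[OF assms] by (simp add: l1b_def hs_nonneg cw_nonneg jap_nonneg real_sqrt_power)

definition unorm :: "l2 \<times> l2 \<Rightarrow> real" where
  "unorm u = sqrt (hs 3 (fst u)) + sqrt (hs 3 (snd u))"

definition good_field :: "l2 \<times> l2 \<Rightarrow> bool" where
  "good_field u \<longleftrightarrow> fsob 3 (fst u) \<and> fsob 3 (snd u) \<and> div_free u"

lemma unorm_nonneg: "0 \<le> unorm u"
  by (simp add: unorm_def hs_nonneg)

lemma good_field_wiener:
  assumes "good_field u"
  shows "wiener (fst u)" "wiener (snd u)" "wnorm (fst u) \<le> cw * unorm u" "wnorm (snd u) \<le> cw * unorm u"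
proof -
  have *: "wiener v \<and> wnorm v \<le> cw * sqrt (hs 3 v)" if "fsob 3 v" for v
  proof
    have f: "fsob 2 v" "hs 2 v \<le> hs 3 v" using fsob_mono[OF that, of 2] by auto
    show "wiener v" by (rule fsob_wiener[OF f(1)])
    have "wnorm v \<le> cw * sqrt (hs 2 v)" by (rule fsob_wiener[OF f(1)])
    also have "\<dots> \<le> cw * sqrt (hs 3 v)" using f(2) by (intro mult_left_mono cw_nonneg) simp
    finally show "wnorm v \<le> cw * sqrt (hs 3 v)" .
  qed
  have "cw * sqrt (hs 3 (fst u)) \<le> cw * unorm u" "cw * sqrt (hs 3 (snd u)) \<le> cw * unorm u"
    unfolding unorm_def by (intro mult_left_mono cw_nonneg; simp add: hs_nonneg)+
  then show "wiener (fst u)" "wiener (snd u)" "wnorm (fst u) \<le> cw * unorm u" "wnorm (snd u) \<le> cw * unorm u"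
    using *[of "fst u"] *[of "snd u"] assms by (auto simp: good_field_def)
qed

lemma l2b_umag:
  assumes "good_field u" "m \<le> 3"
  shows "l2b (\<lambda>d. sqrt (jap d) ^ m * umag u d) (unorm u)"
  unfolding l2b_def
proof (intro conjI allI impI)
  fix S :: "(int \<times> int) set" assume S: "finite S"
  have "L2_set (\<lambda>d. sqrt (jap d) ^ m * umag u d) S \<le> L2_set (\<lambda>d. sqrt (jap d) ^ 3 * umag u d) S"
    using jap_ge_1 by (intro L2_set_mono mult_right_mono power_increasing assms umag_nonneg)
      (auto simp: umag_nonneg jap_nonneg)
  also have "\<dots> = L2_set (\<lambda>d. sqrt (jap d) ^ 3 * cmod (fc (fst u) d) + sqrt (jap d) ^ 3 * cmod (fc (snd u) d)) S"
    by (simp add: umag_def distrib_left)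
  also have "\<dots> \<le> L2_set (\<lambda>d. sqrt (jap d) ^ 3 * cmod (fc (fst u) d)) S + L2_set (\<lambda>d. sqrt (jap d) ^ 3 * cmod (fc (snd u) d)) S"
    by (rule L2_set_triangle_ineq)
  also have "\<dots> \<le> unorm u"
    unfolding unorm_def using l2b_fc[of 3 "fst u"] l2b_fc[of 3 "snd u"] assms(1) S
    by (intro add_mono) (auto simp: l2b_def good_field_def)
  finally show "L2_set (\<lambda>d. sqrt (jap d) ^ m * umag u d) S \<le> unorm u" .
qed (auto simp: unorm_nonneg umag_nonneg jap_nonneg)

lemma l1b_umag:
  assumes "good_field u" "m \<le> 1"
  shows "l1b (\<lambda>d. sqrt (jap d) ^ m * umag u d) (cw * unorm u)"
  unfolding l1b_def
proof (intro conjI allI impI)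
  fix S :: "(int \<times> int) set" assume S: "finite S"
  have "(\<Sum>d\<in>S. sqrt (jap d) ^ m * umag u d) \<le> (\<Sum>d\<in>S. sqrt (jap d) ^ 1 * umag u d)"
    using jap_ge_1 by (intro sum_mono mult_right_mono power_increasing assms umag_nonneg) auto
  also have "\<dots> = (\<Sum>d\<in>S. sqrt (jap d) ^ 1 * cmod (fc (fst u) d)) + (\<Sum>d\<in>S. sqrt (jap d) ^ 1 * cmod (fc (snd u) d))"
    by (simp add: umag_def distrib_left sum.distrib)
  also have "\<dots> \<le> cw * sqrt (hs 3 (fst u)) + cw * sqrt (hs 3 (snd u))"
    using l1b_fc[of 1 "fst u"] l1b_fc[of 1 "snd u"] assms(1) S
    by (intro add_mono) (auto simp: l1b_def good_field_def numeral_3_eq_3)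
  finally show "(\<Sum>d\<in>S. sqrt (jap d) ^ m * umag u d) \<le> cw * unorm u"
    by (simp add: unorm_def distrib_left)
qed (auto simp: unorm_nonneg umag_nonneg jap_nonneg cw_nonneg)

lemma finite_weight_bound:
  fixes R :: "'a \<Rightarrow> 'a \<Rightarrow> real"
  assumes S: "finite S" and A: "\<And>k. ((\<lambda>l. R k l) has_sum A k) UNIV"
    and B: "\<And>L. finite L \<Longrightarrow> S \<subseteq> L \<Longrightarrow> \<bar>\<Sum>l\<in>L. \<Sum>k\<in>S. p k * R k l\<bar> \<le> B"
  shows "\<bar>\<Sum>k\<in>S. p k * A k\<bar> \<le> B"
proof -
  have "((\<lambda>l. \<Sum>k\<in>S. p k * R k l) has_sum (\<Sum>k\<in>S. p k * A k)) UNIV"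
    using S by (induction S rule: finite_induct) (auto intro!: has_sum_add has_sum_cmult_right A)
  then have "((\<lambda>L. \<bar>\<Sum>l\<in>L. \<Sum>k\<in>S. p k * R k l\<bar>) \<longlongrightarrow> \<bar>\<Sum>k\<in>S. p k * A k\<bar>) (finite_subsets_at_top UNIV)"
    unfolding has_sum_def by (rule tendsto_rabs)
  then show ?thesis
  proof (rule tendsto_upperbound)
    show "\<forall>\<^sub>F L in finite_subsets_at_top UNIV. \<bar>\<Sum>l\<in>L. \<Sum>k\<in>S. p k * R k l\<bar> \<le> B"
      unfolding eventually_finite_subsets_at_top using S B by blast
  qed simp
qed

text \<open>Antisymmetry replaces the weight by its increments, which gains one derivative.\<close>

lemma antisymmetric_weight_bound:
  fixes R :: "'a \<Rightarrow> 'a \<Rightarrow> real"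
  assumes S: "finite S" and A: "\<And>k. ((\<lambda>l. R k l) has_sum A k) UNIV"
    and anti: "\<And>k l. R l k = - R k l" and p: "\<And>k. k \<notin> S \<Longrightarrow> p k = 0"
    and B: "\<And>F. finite F \<Longrightarrow> (\<Sum>(k, l)\<in>F. \<bar>p k - p l\<bar> * \<bar>R k l\<bar>) \<le> B"
  shows "\<bar>\<Sum>k\<in>S. p k * A k\<bar> \<le> B / 2"
proof (rule finite_weight_bound[OF S A])
  fix L assume L: "finite L" "S \<subseteq> L"
  have 1: "(\<Sum>l\<in>L. \<Sum>k\<in>S. p k * R k l) = (\<Sum>l\<in>L. \<Sum>k\<in>L. p k * R k l)"
    using L p by (intro sum.cong refl sum.mono_neutral_left) auto
  have 2: "(\<Sum>l\<in>L. \<Sum>k\<in>L. p k * R k l) = - (\<Sum>l\<in>L. \<Sum>k\<in>L. p l * R k l)"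
  proof -
    have "(\<Sum>l\<in>L. \<Sum>k\<in>L. p k * R k l) = (\<Sum>k\<in>L. \<Sum>l\<in>L. p k * R k l)" by (rule sum.swap)
    also have "\<dots> = (\<Sum>k\<in>L. \<Sum>l\<in>L. - (p k * R l k))"
    proof (intro sum.cong refl)
      fix k l show "p k * R k l = - (p k * R l k)" using anti[of k l] by simp
    qed
    finally show ?thesis by (simp add: sum_negf)
  qed
  have "2 * (\<Sum>l\<in>L. \<Sum>k\<in>S. p k * R k l) = (\<Sum>l\<in>L. \<Sum>k\<in>L. (p k - p l) * R k l)"
    unfolding 1 using 2 by (simp add: left_diff_distrib sum_subtractf)
  also have "\<dots> = (\<Sum>(l, k)\<in>L \<times> L. (p k - p l) * R k l)" by (simp add: sum.cartesian_product)
  also have "\<bar>\<dots>\<bar> \<le> (\<Sum>(l, k)\<in>L \<times> L. \<bar>p k - p l\<bar> * \<bar>R k l\<bar>)"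
    by (rule order_trans[OF sum_abs]) (simp add: abs_mult case_prod_beta)
  also have "\<dots> = (\<Sum>(l, k)\<in>L \<times> L. \<bar>p l - p k\<bar> * \<bar>R l k\<bar>)"
  proof (intro sum.cong refl, clarify)
    fix l k
    have "\<bar>R k l\<bar> = \<bar>R l k\<bar>" using anti[of k l] by simp
    then show "\<bar>p k - p l\<bar> * \<bar>R k l\<bar> = \<bar>p l - p k\<bar> * \<bar>R l k\<bar>" by (simp add: abs_minus_commute)
  qed
  also have "\<dots> \<le> B" using B[of "L \<times> L"] L by simp
  finally show "\<bar>\<Sum>l\<in>L. \<Sum>k\<in>S. p k * R k l\<bar> \<le> B / 2" by simp
qed

definition advect_form :: "l2 \<times> l2 \<Rightarrow> l2 \<Rightarrow> l2 \<Rightarrow> int \<times> int \<Rightarrow> int \<times> int \<Rightarrow> real" where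
  "advect_form u w v k l = Re (cnj (fc w k) * (\<i> * tsym u k l * fc v l))"

lemma advect_form_has_sum:
  assumes "wiener (fst u)" "wiener (snd u)" "v \<in> sobolev 1"
  shows "(advect_form u w v k has_sum Re (cnj (fc w k) * fc (advect u v) k)) UNIV"
  unfolding advect_form_def by (intro has_sum_Re has_sum_cmult_right fc_advect assms)

lemma advect_form_antisym:
  assumes "div_free u"
  shows "advect_form u v v l k = - advect_form u v v k l"
proof -
  show ?thesis
    unfolding advect_form_def tsym_commute[OF assms, of l k] by (simp add: algebra_simps)
qed

lemma abs_advect_form_le:
  "\<bar>advect_form u w v k l\<bar> \<le> cmod (fc w k) * cmod (tsym u k l) * cmod (fc v l)"
proof -
  have "\<bar>advect_form u w v k l\<bar> \<le> cmod (cnj (fc w k) * (\<i> * tsym u k l * fc v l))"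
    unfolding advect_form_def by (rule abs_Re_le_cmod)
  then show ?thesis by (simp add: norm_mult mult_ac)
qed

lemma jap_triangle: "sqrt (jap k) \<le> sqrt (jap l) + sqrt (jap (k - l))"
  and jap_diff: "\<bar>jap k - jap l\<bar> \<le> sqrt (jap (k - l)) * (sqrt (jap k) + sqrt (jap l))"
proof -
  let ?v = "\<lambda>k. (1::real, real_of_int (fst k), real_of_int (snd k))"
  have n: "norm (?v k) = sqrt (jap k)" for k by (simp add: norm_prod_def jap_def add.assoc)
  have d: "norm (?v k - ?v l) \<le> sqrt (jap (k - l))"
    by (simp add: norm_prod_def jap_def)
  have t: "\<bar>norm (?v k) - norm (?v l)\<bar> \<le> norm (?v k - ?v l)" by (rule norm_triangle_ineq3)
  then show "sqrt (jap k) \<le> sqrt (jap l) + sqrt (jap (k - l))" using d unfolding n by linarith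
  have "jap k - jap l = (sqrt (jap k) - sqrt (jap l)) * (sqrt (jap k) + sqrt (jap l))"
    by (simp add: algebra_simps jap_nonneg)
  then have "\<bar>jap k - jap l\<bar> = \<bar>sqrt (jap k) - sqrt (jap l)\<bar> * (sqrt (jap k) + sqrt (jap l))"
    by (simp add: abs_mult jap_nonneg add_nonneg_nonneg)
  also have "\<dots> \<le> sqrt (jap (k - l)) * (sqrt (jap k) + sqrt (jap l))"
    using t d unfolding n by (intro mult_right_mono) (auto simp: jap_nonneg add_nonneg_nonneg)
  finally show "\<bar>jap k - jap l\<bar> \<le> sqrt (jap (k - l)) * (sqrt (jap k) + sqrt (jap l))" .
qed

text \<open>Compactly supported truncation of \<open>s\<^sup>m\<close> whose increments are bounded uniformly in \<open>N\<close>.\<close>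

definition wgt :: "nat \<Rightarrow> real \<Rightarrow> real \<Rightarrow> real" where
  "wgt m N s = s ^ (m - 1) * max 0 (min s (2 * N - s))"

lemma wgt_bounds: "0 \<le> s \<Longrightarrow> 0 < m \<Longrightarrow> 0 \<le> wgt m N s \<and> wgt m N s \<le> s ^ m"
proof -
  assume s: "0 \<le> s" "0 < m"
  have "s ^ (m - 1) * max 0 (min s (2 * N - s)) \<le> s ^ (m - 1) * s"
    using s by (intro mult_left_mono) auto
  also have "\<dots> = s ^ m" by (rule power_minus_mult) (rule s)
  finally show ?thesis using s by (simp add: wgt_def)
qed

lemma wgt_eq:
  assumes "0 \<le> s" "s \<le> N" "0 < m"
  shows "wgt m N s = s ^ m"
proof -
  have "max 0 (min s (2 * N - s)) = s" using assms by auto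
  then show ?thesis unfolding wgt_def by (simp only: power_minus_mult[OF assms(3)])
qed

lemma wgt_0: "2 * N \<le> s \<Longrightarrow> wgt m N s = 0"
  by (simp add: wgt_def max_def min_def)

lemma wgt_diff:
  assumes "0 \<le> t" "t \<le> s"
  shows "\<bar>wgt 3 N s - wgt 3 N t\<bar> \<le> 3 * s\<^sup>2 * (s - t)"
    and "\<bar>wgt 2 N s - wgt 2 N t\<bar> \<le> 2 * s * (s - t)"
proof -
  define g where "g s = max 0 (min s (2 * N - s))" for s
  have g: "\<bar>g s - g t\<bar> \<le> s - t" "0 \<le> g t" "g t \<le> t"
    using assms by (auto simp: g_def max_def min_def)
  have "\<bar>s\<^sup>2 * (g s - g t) + g t * (s\<^sup>2 - t\<^sup>2)\<bar> \<le> s\<^sup>2 * (s - t) + t * (s\<^sup>2 - t\<^sup>2)"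
    using assms g by (intro order_trans[OF abs_triangle_ineq] add_mono)
      (auto simp: abs_mult power_mono intro!: mult_mono)
  also have "t * (s\<^sup>2 - t\<^sup>2) \<le> 2 * s\<^sup>2 * (s - t)"
  proof -
    have "t * (s\<^sup>2 - t\<^sup>2) = t * (s + t) * (s - t)" by (simp add: power2_eq_square algebra_simps)
    also have "\<dots> \<le> s * (s + s) * (s - t)" using assms by (intro mult_mono) auto
    finally show ?thesis by (simp add: power2_eq_square)
  qed
  finally show "\<bar>wgt 3 N s - wgt 3 N t\<bar> \<le> 3 * s\<^sup>2 * (s - t)"
    by (simp add: wgt_def g_def algebra_simps)
  have "\<bar>s * (g s - g t) + g t * (s - t)\<bar> \<le> s * (s - t) + t * (s - t)"
    using assms g by (intro order_trans[OF abs_triangle_ineq] add_mono)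
      (auto simp: abs_mult intro!: mult_mono)
  also have "t * (s - t) \<le> s * (s - t)" using assms by (intro mult_right_mono) auto
  finally show "\<bar>wgt 2 N s - wgt 2 N t\<bar> \<le> 2 * s * (s - t)"
    by (simp add: wgt_def g_def algebra_simps)
qed

lemma commutator_symbol_3:
  assumes xy: "0 \<le> y" "y \<le> x" and z: "0 \<le> z" "x \<le> y + z" and d: "x\<^sup>2 - y\<^sup>2 \<le> z * (x + y)"
  shows "\<bar>wgt 3 N (x\<^sup>2) - wgt 3 N (y\<^sup>2)\<bar> * y \<le> 12 * (x ^ 3 * z * y ^ 3 + x ^ 3 * z ^ 3 * y)"
proof -
  have x: "0 \<le> x" using xy by linarith
  have "\<bar>wgt 3 N (x\<^sup>2) - wgt 3 N (y\<^sup>2)\<bar> \<le> 3 * (x\<^sup>2)\<^sup>2 * (x\<^sup>2 - y\<^sup>2)"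
    using xy by (intro wgt_diff power_mono) auto
  also have "\<dots> \<le> 3 * (x\<^sup>2)\<^sup>2 * (z * (x + x))"
    using d xy z mult_left_mono[of "x + y" "x + x" z] by (intro mult_left_mono) auto
  finally have "\<bar>wgt 3 N (x\<^sup>2) - wgt 3 N (y\<^sup>2)\<bar> * y \<le> 3 * (x\<^sup>2)\<^sup>2 * (z * (x + x)) * y"
    using xy by (intro mult_right_mono)
  also have "\<dots> = 6 * (x ^ 3 * z * y) * x\<^sup>2" by (simp add: power2_eq_square power3_eq_cube)
  also have "\<dots> \<le> 6 * (x ^ 3 * z * y) * (2 * y\<^sup>2 + 2 * z\<^sup>2)"
  proof (intro mult_left_mono)
    have "x\<^sup>2 \<le> (y + z)\<^sup>2" using x z by (intro power_mono) auto
    also have "\<dots> \<le> 2 * y\<^sup>2 + 2 * z\<^sup>2" using sum_squares_bound[of y z] by (simp add: power2_sum)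
    finally show "x\<^sup>2 \<le> 2 * y\<^sup>2 + 2 * z\<^sup>2" .
  qed (use x xy z in auto)
  finally show ?thesis by (simp add: power2_eq_square power3_eq_cube algebra_simps)
qed

lemma commutator_symbol_2:
  assumes xy: "0 \<le> y" "y \<le> x" and z: "0 \<le> z" "x \<le> y + z" and d: "x\<^sup>2 - y\<^sup>2 \<le> z * (x + y)"
  shows "\<bar>wgt 2 N (x\<^sup>2) - wgt 2 N (y\<^sup>2)\<bar> * y \<le> 4 * (2 * (x\<^sup>2 * z * y\<^sup>2) + x\<^sup>2 * z ^ 3)"
proof -
  have x: "0 \<le> x" using xy by linarith
  have "\<bar>wgt 2 N (x\<^sup>2) - wgt 2 N (y\<^sup>2)\<bar> \<le> 2 * x\<^sup>2 * (x\<^sup>2 - y\<^sup>2)"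
    using xy by (intro wgt_diff power_mono) auto
  also have "\<dots> \<le> 2 * x\<^sup>2 * (z * (x + x))"
    using d xy z mult_left_mono[of "x + y" "x + x" z] by (intro mult_left_mono) auto
  finally have "\<bar>wgt 2 N (x\<^sup>2) - wgt 2 N (y\<^sup>2)\<bar> * y \<le> 2 * x\<^sup>2 * (z * (x + x)) * y"
    using xy by (intro mult_right_mono)
  also have "\<dots> = 4 * (x\<^sup>2 * z * y) * x" by (simp add: power2_eq_square)
  also have "\<dots> \<le> 4 * (x\<^sup>2 * z * y) * (y + z)"
    using x xy z by (intro mult_left_mono) auto
  also have "\<dots> = 4 * x\<^sup>2 * z * (y\<^sup>2 + y * z)" by (simp add: power2_eq_square algebra_simps)
  also have "\<dots> \<le> 4 * x\<^sup>2 * z * (y\<^sup>2 + (y\<^sup>2 + z\<^sup>2))"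
  proof (intro mult_left_mono add_left_mono)
    show "y * z \<le> y\<^sup>2 + z\<^sup>2"
      using sum_squares_bound[of y z] mult_nonneg_nonneg[OF xy(1) z(1)] by linarith
  qed (use x z in auto)
  finally show ?thesis by (simp add: power2_eq_square power3_eq_cube algebra_simps)
qed

lemma commutator_regroup:
  fixes c e v w x x' y y' z Z g :: real
  shows "v * (c * (e * (x * z * y) + x * Z * y' + x' * Z * y) * g) * w =
    c * (e * ((x * v) * (z * g) * (y * w)) + (x * v) * (Z * g) * (y' * w) + (x' * v) * (Z * g) * (y * w))"
  by (simp add: algebra_simps)

lemma forcing_regroup:
  fixes v w x y z g :: real
  shows "x * (2 * y\<^sup>2 + 2 * z) * (w * (y * g) * v) =
    2 * ((x * w) * (1 * g) * (y ^ 3 * v) + (x * w) * (z * g) * (y * v))"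
  by (simp add: algebra_simps power2_eq_square power3_eq_cube)

definition wset :: "real \<Rightarrow> (int \<times> int) set" where
  "wset N = {k. jap k \<le> 2 * N}"

lemma finite_wset: "finite (wset N)"
proof (rule finite_subset)
  let ?n = "\<lceil>2 * \<bar>N\<bar>\<rceil>"
  show "wset N \<subseteq> {- ?n..?n} \<times> {- ?n..?n}"
  proof
    fix k assume k: "k \<in> wset N"
    have b: "- ?n \<le> a \<and> a \<le> ?n" if "(real_of_int a)\<^sup>2 \<le> jap k - 1" for a
    proof -
      have "\<bar>a\<bar> \<le> a\<^sup>2" using self_le_power[of "\<bar>a\<bar>" 2] by (cases "a = 0") auto
      then have "real_of_int \<bar>a\<bar> \<le> (real_of_int a)\<^sup>2" by (metis of_int_le_iff of_int_power)
      also have "\<dots> \<le> 2 * \<bar>N\<bar>" using that k by (simp add: wset_def)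
      finally show ?thesis by linarith
    qed
    show "k \<in> {- ?n..?n} \<times> {- ?n..?n}"
      using b[of "fst k"] b[of "snd k"] by (cases k) (auto simp: jap_def)
  qed
qed simp

lemma sum_pair_distrib3:
  fixes f g h :: "'a \<Rightarrow> 'b \<Rightarrow> real"
  shows "(\<Sum>(k, l)\<in>F. c * (e * f k l + g k l + h k l)) =
    c * (e * (\<Sum>(k, l)\<in>F. f k l) + (\<Sum>(k, l)\<in>F. g k l) + (\<Sum>(k, l)\<in>F. h k l))"
  by (simp add: case_prod_beta sum.distrib sum_distrib_left distrib_left)

definition wsum :: "nat \<Rightarrow> real \<Rightarrow> l2 \<Rightarrow> l2 \<Rightarrow> real" where
  "wsum m N w v = (\<Sum>k\<in>wset N. wgt m N (jap k) * Re (cnj (fc w k) * fc v k))"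

lemma wsum_uminus: "wsum m N w (- v) = - wsum m N w v"
  and wsum_add: "wsum m N w (v + v') = wsum m N w v + wsum m N w v'"
  by (simp_all add: wsum_def fc_uminus fc_add sum_negf[symmetric] sum.distrib[symmetric] algebra_simps)

lemma wsum_diff: "wsum m N w (v - v') = wsum m N w v - wsum m N w v'"
  using wsum_add[of m N w v "- v'"] by (simp add: wsum_uminus)

lemma energy_estimate:
  assumes u: "good_field u" and v: "v \<in> sobolev 1" and f: "fsob m v"
    and l1: "l1b (\<lambda>k. sqrt (jap k) ^ n * cmod (fc v k)) (cw * sqrt (hs m v))"
    and ce: "0 \<le> c" "0 \<le> e"
    and symbol: "\<And>x y z. 0 \<le> y \<Longrightarrow> y \<le> x \<Longrightarrow> 0 \<le> z \<Longrightarrow> x \<le> y + z \<Longrightarrow> x\<^sup>2 - y\<^sup>2 \<le> z * (x + y) \<Longrightarrow>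
      \<bar>wgt m N (x\<^sup>2) - wgt m N (y\<^sup>2)\<bar> * y \<le> c * (e * (x ^ m * z * y ^ m) + x ^ m * z ^ 3 * y ^ n)"
  shows "\<bar>wsum m N v (advect u v)\<bar> \<le> c * (e + 2) / 2 * cw * unorm u * hs m v"
proof -
  let ?x = "\<lambda>k. sqrt (jap k)" and ?v = "\<lambda>k. cmod (fc v k)"
  have df: "div_free u" using u by (simp add: good_field_def)
  let ?T1 = "\<lambda>k l. (?x k ^ m * ?v k) * (?x (k - l) ^ 1 * umag u (k - l)) * (?x l ^ m * ?v l)"
  let ?T2 = "\<lambda>k l. (?x k ^ m * ?v k) * (?x (k - l) ^ 3 * umag u (k - l)) * (?x l ^ n * ?v l)"
  let ?T3 = "\<lambda>k l. (?x k ^ n * ?v k) * (?x (k - l) ^ 3 * umag u (k - l)) * (?x l ^ m * ?v l)"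
  have pt: "\<bar>wgt m N (jap k) - wgt m N (jap l)\<bar> * \<bar>advect_form u v v k l\<bar> \<le> c * (e * ?T1 k l + ?T2 k l + ?T3 k l)" for k l
  proof -
    let ?W = "\<bar>wgt m N (jap k) - wgt m N (jap l)\<bar>" and ?z = "?x (k - l)"
    have z: "?x (l - k) = ?z" using jap_minus[of "k - l"] by simp
    have nn: "0 \<le> ?x k" "0 \<le> umag u (k - l)" for k l by (auto simp: jap_nonneg umag_nonneg)
    let ?B = "c * (e * (?x k ^ m * ?z * ?x l ^ m) + ?x k ^ m * ?z ^ 3 * ?x l ^ n + ?x k ^ n * ?z ^ 3 * ?x l ^ m)"
    have T: "?W * cmod (tsym u k l) \<le> ?B * umag u (k - l)"
    proof (cases "?x l \<le> ?x k")
      case True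
      have "?W * cmod (tsym u k l) \<le> ?W * (?x l * umag u (k - l))"
        by (intro mult_left_mono norm_tsym_le) auto
      also have "\<dots> = \<bar>wgt m N ((?x k)\<^sup>2) - wgt m N ((?x l)\<^sup>2)\<bar> * ?x l * umag u (k - l)" by (simp add: jap_nonneg)
      also have "\<dots> \<le> c * (e * (?x k ^ m * ?z * ?x l ^ m) + ?x k ^ m * ?z ^ 3 * ?x l ^ n) * umag u (k - l)"
        using True jap_triangle[of k l] jap_diff[of k l]
        by (intro mult_right_mono symbol nn) (auto simp: jap_nonneg)
      also have "\<dots> \<le> ?B * umag u (k - l)"
        by (intro mult_right_mono mult_left_mono ce) (auto simp: nn jap_nonneg)
      finally show ?thesis .
    next
      case False
      have "?W * cmod (tsym u k l) \<le> ?W * (?x k * umag u (k - l))"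
        by (intro mult_left_mono norm_tsym_le' df) auto
      also have "\<dots> = \<bar>wgt m N ((?x l)\<^sup>2) - wgt m N ((?x k)\<^sup>2)\<bar> * ?x k * umag u (k - l)"
        by (simp add: jap_nonneg abs_minus_commute)
      also have "\<dots> \<le> c * (e * (?x l ^ m * ?z * ?x k ^ m) + ?x l ^ m * ?z ^ 3 * ?x k ^ n) * umag u (k - l)"
        using False jap_triangle[of l k] jap_diff[of l k]
        by (intro mult_right_mono symbol nn) (auto simp: jap_nonneg z)
      also have "\<dots> \<le> ?B * umag u (k - l)"
        by (intro mult_right_mono mult_left_mono ce) (auto simp: nn jap_nonneg mult_ac)
      finally show ?thesis .
    qed
    have "?W * \<bar>advect_form u v v k l\<bar> \<le> ?W * (?v k * cmod (tsym u k l) * ?v l)"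
      by (intro mult_left_mono abs_advect_form_le) auto
    also have "\<dots> = ?v k * (?W * cmod (tsym u k l)) * ?v l" by (simp only: mult_ac)
    also have "\<dots> \<le> ?v k * (?B * umag u (k - l)) * ?v l"
      by (intro mult_right_mono mult_left_mono T) auto
    also have "\<dots> = c * (e * ?T1 k l + ?T2 k l + ?T3 k l)"
      unfolding power_one_right by (rule commutator_regroup)
    finally show ?thesis .
  qed
  let ?h = "sqrt (hs m v)"
  have B: "(\<Sum>(k, l)\<in>F. \<bar>wgt m N (jap k) - wgt m N (jap l)\<bar> * \<bar>advect_form u v v k l\<bar>) \<le> c * (e + 2) * cw * unorm u * hs m v"
    if F: "finite F" for F
  proof -
    have "(\<Sum>(k, l)\<in>F. \<bar>wgt m N (jap k) - wgt m N (jap l)\<bar> * \<bar>advect_form u v v k l\<bar>) \<le>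
        (\<Sum>(k, l)\<in>F. c * (e * ?T1 k l + ?T2 k l + ?T3 k l))"
      using pt by (intro sum_mono) auto
    also have "\<dots> = c * (e * (\<Sum>(k, l)\<in>F. ?T1 k l) + (\<Sum>(k, l)\<in>F. ?T2 k l) + (\<Sum>(k, l)\<in>F. ?T3 k l))"
      by (rule sum_pair_distrib3)
    also have "\<dots> \<le> c * (e * (?h * (cw * unorm u) * ?h) + ?h * unorm u * (cw * ?h) + (cw * ?h) * unorm u * ?h)"
    proof (intro mult_left_mono add_mono ce)
      show "(\<Sum>(k, l)\<in>F. ?T1 k l) \<le> ?h * (cw * unorm u) * ?h"
        by (rule young_mid[OF l2b_fc[OF f] l1b_umag[OF u order_refl] l2b_fc[OF f] F])
      show "(\<Sum>(k, l)\<in>F. ?T2 k l) \<le> ?h * unorm u * (cw * ?h)"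
        by (rule young_right[OF l2b_fc[OF f] l2b_umag[OF u order_refl] l1 F])
      show "(\<Sum>(k, l)\<in>F. ?T3 k l) \<le> (cw * ?h) * unorm u * ?h"
        by (rule young_left[OF l1 l2b_umag[OF u order_refl] _ l2b_fc[OF f] F]) (simp add: umag_minus)
    qed
    also have "\<dots> = c * (e + 2) * cw * unorm u * (?h * ?h)" by (simp add: algebra_simps)
    also have "?h * ?h = hs m v" by (simp add: hs_nonneg)
    finally show ?thesis .
  qed
  have "\<bar>wsum m N v (advect u v)\<bar> \<le> c * (e + 2) * cw * unorm u * hs m v / 2"
    unfolding wsum_def
  proof (rule antisymmetric_weight_bound[OF finite_wset _ _ _ B])
    show "(advect_form u v v k has_sum Re (cnj (fc v k) * fc (advect u v) k)) UNIV" for k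
      by (intro advect_form_has_sum good_field_wiener[OF u] v)
    show "advect_form u v v l k = - advect_form u v v k l" for k l by (rule advect_form_antisym[OF df])
    show "wgt m N (jap k) = 0" if "k \<notin> wset N" for k using that by (intro wgt_0) (simp add: wset_def)
  qed
  then show ?thesis by simp
qed

lemma energy_estimate_3:
  assumes u: "good_field u" and v: "v \<in> sobolev 3"
  shows "\<bar>wsum 3 N v (advect u v)\<bar> \<le> 18 * cw * unorm u * hs 3 v"
proof -
  have f: "fsob 3 v" using sobolev_imp_fsob[OF v] by simp
  have "\<bar>wsum 3 N v (advect u v)\<bar> \<le> 12 * (1 + 2) / 2 * cw * unorm u * hs 3 v"
    by (rule energy_estimate[OF u sobolev_mono[OF v] f, where n = 1])
      (use l1b_fc[of 1 v] f commutator_symbol_3 in \<open>auto simp: numeral_3_eq_3\<close>)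
  then show ?thesis by simp
qed

lemma energy_estimate_2:
  assumes u: "good_field u" and v: "v \<in> sobolev 2"
  shows "\<bar>wsum 2 N v (advect u v)\<bar> \<le> 8 * cw * unorm u * hs 2 v"
proof -
  have f: "fsob 2 v" using sobolev_imp_fsob[OF v] by simp
  have "\<bar>wsum 2 N v (advect u v)\<bar> \<le> 4 * (2 + 2) / 2 * cw * unorm u * hs 2 v"
    by (rule energy_estimate[OF u sobolev_mono[OF v] f, where n = 0])
      (use l1b_fc[of 0 v] f commutator_symbol_2 in \<open>auto simp: numeral_2_eq_2\<close>)
  then show ?thesis by simp
qed

lemma sum_pair_distrib:
  fixes f g :: "'a \<Rightarrow> 'b \<Rightarrow> real"
  shows "(\<Sum>(k, l)\<in>F. c * (f k l + g k l)) = c * ((\<Sum>(k, l)\<in>F. f k l) + (\<Sum>(k, l)\<in>F. g k l))"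
  by (simp add: case_prod_beta sum.distrib sum_distrib_left distrib_left)

lemma abs_sum_pair_le:
  fixes f h :: "'a \<Rightarrow> 'b \<Rightarrow> real"
  assumes "\<And>k l. \<bar>h k l\<bar> \<le> f k l"
  shows "\<bar>\<Sum>(k, l)\<in>F. h k l\<bar> \<le> (\<Sum>(k, l)\<in>F. f k l)"
  by (rule order_trans[OF sum_abs]) (auto intro!: sum_mono simp: case_prod_beta assms)

lemma forcing_estimate:
  assumes u: "good_field u" and v: "v \<in> sobolev 3" and w: "fsob 2 w"
  shows "\<bar>wsum 2 N w (advect u v)\<bar> \<le> 4 * cw * unorm u * sqrt (hs 2 w) * sqrt (hs 3 v)"
  unfolding wsum_def
proof (rule finite_weight_bound[OF finite_wset])
  show "(advect_form u w v k has_sum Re (cnj (fc w k) * fc (advect u v) k)) UNIV" for k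
    using sobolev_mono[OF v, of 1] by (intro advect_form_has_sum good_field_wiener[OF u]) auto
next
  fix L :: "(int \<times> int) set" assume L: "finite L" "wset N \<subseteq> L"
  let ?x = "\<lambda>k. sqrt (jap k)" and ?v = "\<lambda>k. cmod (fc v k)" and ?w = "\<lambda>k. cmod (fc w k)"
  have f: "fsob 3 v" using sobolev_imp_fsob[OF v] by simp
  let ?T1 = "\<lambda>k l. (?x k ^ 2 * ?w k) * (?x (k - l) ^ 0 * umag u (k - l)) * (?x l ^ 3 * ?v l)"
  let ?T2 = "\<lambda>k l. (?x k ^ 2 * ?w k) * (?x (k - l) ^ 2 * umag u (k - l)) * (?x l ^ 1 * ?v l)"
  have pt: "\<bar>wgt 2 N (jap k) * advect_form u w v k l\<bar> \<le> 2 * (?T1 k l + ?T2 k l)" for k l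
  proof -
    let ?z = "?x (k - l)"
    have "\<bar>wgt 2 N (jap k)\<bar> \<le> (?x k)\<^sup>2 * (?x k)\<^sup>2"
      using wgt_bounds[of "jap k" 2 N] by (simp add: jap_nonneg power2_eq_square)
    also have "\<dots> \<le> (?x k)\<^sup>2 * (2 * (?x l)\<^sup>2 + 2 * ?z\<^sup>2)"
    proof (rule mult_left_mono[OF _ zero_le_power2])
      have "(?x k)\<^sup>2 \<le> (?x l + ?z)\<^sup>2"
        by (rule power_mono[OF jap_triangle]) (rule real_sqrt_ge_zero[OF jap_nonneg])
      also have "\<dots> = (?x l)\<^sup>2 + ?z\<^sup>2 + 2 * ?x l * ?z" by (rule power2_sum)
      also have "\<dots> \<le> 2 * (?x l)\<^sup>2 + 2 * ?z\<^sup>2"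
        using sum_squares_bound[of "?x l" ?z] by linarith
      finally show "(?x k)\<^sup>2 \<le> 2 * (?x l)\<^sup>2 + 2 * ?z\<^sup>2" .
    qed
    finally have W: "\<bar>wgt 2 N (jap k)\<bar> \<le> (?x k)\<^sup>2 * (2 * (?x l)\<^sup>2 + 2 * ?z\<^sup>2)" .
    have "\<bar>advect_form u w v k l\<bar> \<le> ?w k * cmod (tsym u k l) * ?v l" by (rule abs_advect_form_le)
    also have "\<dots> \<le> ?w k * (?x l * umag u (k - l)) * ?v l"
      by (intro mult_right_mono mult_left_mono norm_tsym_le) auto
    finally have A: "\<bar>advect_form u w v k l\<bar> \<le> ?w k * (?x l * umag u (k - l)) * ?v l" .
    have "\<bar>wgt 2 N (jap k) * advect_form u w v k l\<bar> = \<bar>wgt 2 N (jap k)\<bar> * \<bar>advect_form u w v k l\<bar>"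
      by (rule abs_mult)
    also have "\<dots> \<le> ((?x k)\<^sup>2 * (2 * (?x l)\<^sup>2 + 2 * ?z\<^sup>2)) * (?w k * (?x l * umag u (k - l)) * ?v l)"
      by (rule mult_mono[OF W A _ abs_ge_zero])
        (intro mult_nonneg_nonneg add_nonneg_nonneg zero_le_power2 zero_le_numeral)
    also have "\<dots> = 2 * (?T1 k l + ?T2 k l)"
      unfolding power_one_right power_0 by (rule forcing_regroup)
    finally show ?thesis .
  qed
  let ?h = "sqrt (hs 3 v)" and ?g = "sqrt (hs 2 w)"
  let ?F = "L \<times> wset N"
  define F where "F = prod.swap ` ?F"
  have F: "finite F" using L finite_wset by (auto simp: F_def)
  have l1: "l1b (\<lambda>k. ?x k ^ 1 * ?v k) (cw * ?h)" using l1b_fc[of 1 v] f by (simp add: numeral_3_eq_3)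
  have t1: "(\<Sum>(k, l)\<in>F. ?T1 k l) \<le> ?g * (cw * unorm u) * ?h"
    by (rule young_mid[OF l2b_fc[OF w] l1b_umag[OF u] l2b_fc[OF f] F]; simp)
  have t2: "(\<Sum>(k, l)\<in>F. ?T2 k l) \<le> ?g * unorm u * (cw * ?h)"
    by (rule young_right[OF l2b_fc[OF w] l2b_umag[OF u] l1 F]; simp)
  have "(\<Sum>l\<in>L. \<Sum>k\<in>wset N. wgt 2 N (jap k) * advect_form u w v k l) =
      (\<Sum>(l, k)\<in>?F. wgt 2 N (jap k) * advect_form u w v k l)" by (simp add: sum.cartesian_product)
  also have "\<dots> = (\<Sum>(k, l)\<in>F. wgt 2 N (jap k) * advect_form u w v k l)"
    unfolding F_def by (subst sum.reindex) (auto intro!: sum.cong)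
  finally have eq: "(\<Sum>l\<in>L. \<Sum>k\<in>wset N. wgt 2 N (jap k) * advect_form u w v k l) =
      (\<Sum>(k, l)\<in>F. wgt 2 N (jap k) * advect_form u w v k l)" .
  have "\<bar>\<Sum>(k, l)\<in>F. wgt 2 N (jap k) * advect_form u w v k l\<bar> \<le> (\<Sum>(k, l)\<in>F. 2 * (?T1 k l + ?T2 k l))"
    by (rule abs_sum_pair_le[OF pt])
  also have "\<dots> = 2 * ((\<Sum>(k, l)\<in>F. ?T1 k l) + (\<Sum>(k, l)\<in>F. ?T2 k l))"
    by (rule sum_pair_distrib)
  also have "\<dots> \<le> 2 * (?g * (cw * unorm u) * ?h + ?g * unorm u * (cw * ?h))"
    by (intro mult_left_mono add_mono t1 t2) simp
  also have "\<dots> = 4 * cw * unorm u * ?g * ?h"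
    by simp
  finally show "\<bar>\<Sum>l\<in>L. \<Sum>k\<in>wset N. wgt 2 N (jap k) * advect_form u w v k l\<bar> \<le> 4 * cw * unorm u * ?g * ?h"
    unfolding eq .
qed

section \<open>The velocity field\<close>

lemma fc_laplacian:
  assumes "\<psi> \<in> sobolev 2"
  shows "fc (laplacian \<psi>) k = - of_real (jap k - 1) * fc \<psi> k"
  using assms
  by (simp add: laplacian_def fc_add fc_weak_deriv[where m = 2] dsym_def jap_def power_mult_distrib algebra_simps)

lemma inv_into_symbol:
  assumes sym: "\<And>\<psi> k. \<psi> \<in> sobolev 2 \<Longrightarrow> fc (L \<psi>) k = of_real (\<sigma> k) * fc \<psi> k"
    and even: "\<And>k. \<sigma> (- k) = \<sigma> k" and c: "0 < c" and lower: "\<And>k. c * jap k \<le> \<bar>\<sigma> k\<bar>"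
    and w: "wiener w"
  shows "inv_into (sobolev 2) L w \<in> sobolev 2"
    and "fc (inv_into (sobolev 2) L w) k = fc w k / of_real (\<sigma> k)"
proof -
  have \<sigma>: "\<sigma> k \<noteq> 0" for k using lower[of k] mult_pos_pos[OF c jap_pos[of k]] by auto
  have bd: "jap k * cmod (fc w k / of_real (\<sigma> k)) \<le> cmod (fc w k) / c" for k
  proof -
    have "cmod (fc w k) * (c * jap k) \<le> cmod (fc w k) * \<bar>\<sigma> k\<bar>" by (intro mult_left_mono lower) auto
    then show ?thesis using c \<sigma>[of k] by (simp add: norm_divide field_simps)
  qed
  have sw: "(\<lambda>k. cmod (fc w k) / c) summable_on UNIV"
    using w unfolding wiener_def divide_inverse by (rule summable_on_cmult_left)
  have s1: "(\<lambda>k. jap k ^ 1 * cmod (fc w k / of_real (\<sigma> k))) summable_on UNIV"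
    by (rule summable_on_comparison_test[OF sw]) (use bd in \<open>auto simp: jap_nonneg\<close>)
  have "(\<lambda>k. norm (fc w k / of_real (\<sigma> k))) summable_on UNIV"
  proof (rule summable_on_comparison_test[OF s1])
    show "norm (fc w k / of_real (\<sigma> k)) \<le> jap k ^ 1 * cmod (fc w k / of_real (\<sigma> k))" for k
      using mult_right_mono[OF jap_ge_1[of k], of "cmod (fc w k / of_real (\<sigma> k))"] by simp
  qed auto
  then obtain \<psi> where \<psi>: "\<And>k. fc \<psi> k = fc w k / of_real (\<sigma> k)"
    by (rule synthesis_exists) (auto simp: fc_hermitian even)
  have "\<psi> \<in> sobolev 2" by (rule sobolev_fc_exists[where n = 1]) (use s1 in \<open>auto simp: \<psi>\<close>)
  moreover from this have "L \<psi> = w" by (intro fc_eqI) (simp add: sym \<psi> \<sigma>)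
  ultimately have im: "w \<in> L ` sobolev 2" by blast
  show 1: "inv_into (sobolev 2) L w \<in> sobolev 2" by (rule inv_into_into[OF im])
  have "fc w k = of_real (\<sigma> k) * fc (inv_into (sobolev 2) L w) k"
    using sym[OF 1, of k] f_inv_into_f[OF im] by simp
  then show "fc (inv_into (sobolev 2) L w) k = fc w k / of_real (\<sigma> k)" using \<sigma>[of k] by simp
qed

definition vden :: "real \<Rightarrow> int \<times> int \<Rightarrow> real" where
  "vden \<alpha> k = jap k * (1 + \<alpha> * (jap k - 1))"

lemma helmholtz_lower: "0 < \<alpha> \<Longrightarrow> min 1 \<alpha> * jap k \<le> 1 + \<alpha> * (jap k - 1)"
  using mult_right_mono[of "min 1 \<alpha>" \<alpha> "jap k - 1"] jap_ge_1[of k] by (simp add: algebra_simps)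

lemma fc_velocity:
  assumes \<alpha>: "0 < \<alpha>" and w: "wiener (\<omega> - f)"
  shows "fc (fst (velocity \<alpha> f \<omega>)) k = \<i> * of_int (snd k) / of_real (vden \<alpha> k) * fc (\<omega> - f) k"
    and "fc (snd (velocity \<alpha> f \<omega>)) k = - \<i> * of_int (fst k) / of_real (vden \<alpha> k) * fc (\<omega> - f) k"
proof -
  define \<phi> where "\<phi> = inv_laplacian_minus_one (\<omega> - f)"
  define \<psi> where "\<psi> = inv_one_minus_laplacian \<alpha> \<phi>"
  have \<phi>: "\<phi> \<in> sobolev 2" "fc \<phi> k = fc (\<omega> - f) k / of_real (- jap k)" for k
    unfolding \<phi>_def inv_laplacian_minus_one_def
    by (rule inv_into_symbol[where c = 1 and \<sigma> = "\<lambda>k. - jap k"];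
        simp add: w fc_diff fc_laplacian algebra_simps jap_nonneg)+
  have w\<phi>: "wiener \<phi>" using sobolev_imp_fsob[OF \<phi>(1)] fsob_wiener by blast
  have sym: "fc (\<eta> - \<alpha> *\<^sub>R laplacian \<eta>) k = of_real (1 + \<alpha> * (jap k - 1)) * fc \<eta> k"
    if "\<eta> \<in> sobolev 2" for \<eta> k
    by (simp add: that fc_diff fc_scaleR fc_laplacian scaleR_conv_of_real algebra_simps)
  have lower: "min 1 \<alpha> * jap k \<le> \<bar>1 + \<alpha> * (jap k - 1)\<bar>" for k
    by (rule order_trans[OF helmholtz_lower[OF \<alpha>] abs_ge_self])
  have c: "0 < min 1 \<alpha>" using \<alpha> by simp
  note inv = inv_into_symbol[where L = "\<lambda>\<psi>. \<psi> - \<alpha> *\<^sub>R laplacian \<psi>" and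
      \<sigma> = "\<lambda>k. 1 + \<alpha> * (jap k - 1)", OF sym _ c lower w\<phi>]
  have \<psi>: "\<psi> \<in> sobolev 2" "fc \<psi> k = fc \<phi> k / of_real (1 + \<alpha> * (jap k - 1))" for k
    unfolding \<psi>_def inv_one_minus_laplacian_def using inv by simp_all
  have u: "velocity \<alpha> f \<omega> = (- weak_deriv 0 1 \<psi>, weak_deriv 1 0 \<psi>)"
    by (simp add: velocity_def grad_perp_def \<psi>_def \<phi>_def)
  have \<psi>': "fc \<psi> k = - fc (\<omega> - f) k / of_real (vden \<alpha> k)"
    unfolding \<psi>(2) \<phi>(2) vden_def by simp
  show "fc (fst (velocity \<alpha> f \<omega>)) k = \<i> * of_int (snd k) / of_real (vden \<alpha> k) * fc (\<omega> - f) k"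
    "fc (snd (velocity \<alpha> f \<omega>)) k = - \<i> * of_int (fst k) / of_real (vden \<alpha> k) * fc (\<omega> - f) k"
    unfolding u by (simp_all add: fc_uminus fc_weak_deriv[OF \<psi>(1)] dsym_def \<psi>')
qed

definition smoothing_bound :: "real \<Rightarrow> l2 \<Rightarrow> l2 \<Rightarrow> bool" where
  "smoothing_bound c z w \<longleftrightarrow> (\<forall>k. cmod (fc z k) \<le> cmod (fc w k) * (sqrt (jap k) / (c * (jap k)\<^sup>2)))"

lemma smoothing_boundI:
  assumes \<alpha>: "0 < \<alpha>" and z: "\<And>k. fc z k = \<i> * of_int (a k) / of_real (vden \<alpha> k) * fc w k"
    and a: "\<And>k. (real_of_int (a k))\<^sup>2 \<le> jap k"
  shows "smoothing_bound (min 1 \<alpha>) z w"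
  unfolding smoothing_bound_def
proof
  fix k
  have "jap k * (min 1 \<alpha> * jap k) \<le> vden \<alpha> k"
    unfolding vden_def by (intro mult_left_mono helmholtz_lower \<alpha> jap_nonneg)
  then have v: "min 1 \<alpha> * (jap k)\<^sup>2 \<le> vden \<alpha> k" by (simp add: power2_eq_square mult_ac)
  have p: "0 < min 1 \<alpha> * (jap k)\<^sup>2" using \<alpha> jap_pos[of k] by simp
  have "\<bar>real_of_int (a k)\<bar> \<le> sqrt (jap k)" by (rule real_le_rsqrt) (use a in simp)
  then have "\<bar>real_of_int (a k)\<bar> / vden \<alpha> k \<le> sqrt (jap k) / (min 1 \<alpha> * (jap k)\<^sup>2)"
    using v p by (intro frac_le) (auto simp: jap_nonneg)
  moreover have "cmod (fc z k) = cmod (fc w k) * (\<bar>real_of_int (a k)\<bar> / vden \<alpha> k)"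
    using v p by (simp add: z norm_mult norm_divide)
  ultimately show "cmod (fc z k) \<le> cmod (fc w k) * (sqrt (jap k) / (min 1 \<alpha> * (jap k)\<^sup>2))"
    by (simp only: mult_left_mono norm_ge_zero)
qed

lemma smoothing_bound_hs:
  assumes c: "0 < c" and z: "smoothing_bound c z w"
  shows "fsob 3 z" "sqrt (hs 3 z) \<le> norm w / c"
proof -
  have le: "jap k ^ 3 * (cmod (fc z k))\<^sup>2 \<le> (cmod (fc w k))\<^sup>2 * (1 / c\<^sup>2)" for k
  proof -
    have "(cmod (fc z k))\<^sup>2 \<le> (cmod (fc w k) * (sqrt (jap k) / (c * (jap k)\<^sup>2)))\<^sup>2"
      using z[unfolded smoothing_bound_def, rule_format, of k] by (intro power_mono) auto
    then have "jap k ^ 3 * (cmod (fc z k))\<^sup>2 \<le> jap k ^ 3 * (cmod (fc w k) * (sqrt (jap k) / (c * (jap k)\<^sup>2)))\<^sup>2"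
      by (intro mult_left_mono) (auto simp: jap_nonneg)
    also have "\<dots> = jap k ^ 3 * ((cmod (fc w k))\<^sup>2 * (jap k / (c\<^sup>2 * (jap k)^4)))"
      by (simp add: power_mult_distrib power_divide jap_nonneg power_mult[symmetric])
    also have "\<dots> = (cmod (fc w k))\<^sup>2 * (1 / c\<^sup>2)"
      using jap_pos[of k] c by (simp add: field_simps power_numeral_reduce)
    finally show ?thesis .
  qed
  have s: "((\<lambda>k. (cmod (fc w k))\<^sup>2 * (1 / c\<^sup>2)) has_sum (norm w)\<^sup>2 / (4 * pi\<^sup>2) * (1 / c\<^sup>2)) UNIV"
    by (rule has_sum_cmult_left[OF parseval_norm])
  show f: "fsob 3 z" unfolding fsob_def
    by (rule summable_on_comparison_test[OF has_sum_imp_summable[OF s] le]) (simp add: jap_nonneg)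
  have "hs 3 z \<le> (norm w)\<^sup>2 / (4 * pi\<^sup>2) * (1 / c\<^sup>2)"
    unfolding hs_def by (rule has_sum_mono[OF has_sum_infsum s le]) (use f in \<open>simp add: fsob_def\<close>)
  also have "\<dots> \<le> (norm w)\<^sup>2 / 1 * (1 / c\<^sup>2)"
  proof -
    have "1 \<le> 4 * pi\<^sup>2" using one_le_power[of pi 2] pi_gt3 by linarith
    then show ?thesis by (intro mult_right_mono divide_left_mono) auto
  qed
  also have "\<dots> = (norm w / c)\<^sup>2" by (simp add: power_divide)
  finally show "sqrt (hs 3 z) \<le> norm w / c" using c by (intro real_le_lsqrt) (auto simp: hs_nonneg)
qed

lemma smoothing_bound_sobolev:
  assumes c: "0 < c" and z: "smoothing_bound c z w" and w: "wiener w"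
  shows "z \<in> sobolev 2" "i + j \<le> 2 \<Longrightarrow> wiener (weak_deriv i j z)"
proof -
  have sw: "(\<lambda>k. cmod (fc w k) * (1 / c)) summable_on UNIV"
    using w unfolding wiener_def by (rule summable_on_cmult_left)
  have le: "jap k ^ 1 * cmod (fc z k) \<le> cmod (fc w k) * (1 / c)" for k
  proof -
    have "jap k ^ 1 * cmod (fc z k) \<le> jap k * (cmod (fc w k) * (sqrt (jap k) / (c * (jap k)\<^sup>2)))"
      unfolding power_one_right
      by (rule mult_left_mono[OF z[unfolded smoothing_bound_def, rule_format, of k] jap_nonneg])
    also have "\<dots> \<le> jap k * (cmod (fc w k) * (jap k / (c * (jap k)\<^sup>2)))"
    proof -
      have "sqrt (jap k) \<le> jap k"
        using jap_ge_1[of k] self_le_power[of "jap k" 2] by (intro real_le_lsqrt) (auto simp: jap_nonneg)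
      then show ?thesis using c by (intro mult_left_mono divide_right_mono) (auto simp: jap_nonneg)
    qed
    also have "\<dots> = cmod (fc w k) * (1 / c)" using jap_pos[of k] by (simp add: power2_eq_square)
    finally show ?thesis .
  qed
  have s: "(\<lambda>k. jap k ^ 1 * cmod (fc z k)) summable_on UNIV"
    by (rule summable_on_comparison_test[OF sw le]) (simp add: jap_nonneg)
  then show 1: "z \<in> sobolev 2" by (rule sobolev_fc_exists) simp
  show "wiener (weak_deriv i j z)" if ij: "i + j \<le> 2"
    unfolding wiener_def
  proof (rule Infinite_Sum.abs_summable_on_comparison_test'[OF s])
    fix k
    have "(cmod (dsym i j k))\<^sup>2 \<le> (jap k ^ 1)\<^sup>2" using cmod_dsym_le[OF ij, of k] by simp
    then have "cmod (dsym i j k) \<le> jap k ^ 1" by (rule power2_le_imp_le) (simp add: jap_nonneg)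
    then show "norm (fc (weak_deriv i j z) k) \<le> jap k ^ 1 * cmod (fc z k)"
      unfolding fc_weak_deriv[OF 1 ij] norm_mult by (rule mult_right_mono) simp
  qed
qed

lemma velocity_smoothing:
  assumes \<alpha>: "0 < \<alpha>" and w: "wiener (\<omega> - f)"
  shows "smoothing_bound (min 1 \<alpha>) (fst (velocity \<alpha> f \<omega>)) (\<omega> - f)"
    and "smoothing_bound (min 1 \<alpha>) (snd (velocity \<alpha> f \<omega>)) (\<omega> - f)"
proof -
  show "smoothing_bound (min 1 \<alpha>) (fst (velocity \<alpha> f \<omega>)) (\<omega> - f)"
    by (rule smoothing_boundI[OF \<alpha>, where a = snd]) (simp_all add: fc_velocity[OF \<alpha> w] jap_def)
  show "smoothing_bound (min 1 \<alpha>) (snd (velocity \<alpha> f \<omega>)) (\<omega> - f)"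
    by (rule smoothing_boundI[OF \<alpha>, where a = "\<lambda>k. - fst k"]) (simp_all add: fc_velocity[OF \<alpha> w] jap_def)
qed

lemma velocity_diff_smoothing:
  assumes \<alpha>: "0 < \<alpha>" and w: "wiener (\<omega> - f)" "wiener (\<omega>' - f)"
  shows "smoothing_bound (min 1 \<alpha>) (fst (velocity \<alpha> f \<omega>) - fst (velocity \<alpha> f \<omega>')) (\<omega> - \<omega>')"
    and "smoothing_bound (min 1 \<alpha>) (snd (velocity \<alpha> f \<omega>) - snd (velocity \<alpha> f \<omega>')) (\<omega> - \<omega>')"
proof -
  show "smoothing_bound (min 1 \<alpha>) (fst (velocity \<alpha> f \<omega>) - fst (velocity \<alpha> f \<omega>')) (\<omega> - \<omega>')"
  proof (rule smoothing_boundI[OF \<alpha>, where a = snd])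
    show "fc (fst (velocity \<alpha> f \<omega>) - fst (velocity \<alpha> f \<omega>')) k =
        \<i> * of_int (snd k) / of_real (vden \<alpha> k) * fc (\<omega> - \<omega>') k" for k
      unfolding fc_diff[of "fst _"] fc_velocity[OF \<alpha> w(1)] fc_velocity[OF \<alpha> w(2)] right_diff_distrib[symmetric]
      by (simp add: fc_diff)
  qed (simp add: jap_def)
  show "smoothing_bound (min 1 \<alpha>) (snd (velocity \<alpha> f \<omega>) - snd (velocity \<alpha> f \<omega>')) (\<omega> - \<omega>')"
  proof (rule smoothing_boundI[OF \<alpha>, where a = "\<lambda>k. - fst k"])
    show "fc (snd (velocity \<alpha> f \<omega>) - snd (velocity \<alpha> f \<omega>')) k =
        \<i> * of_int (- fst k) / of_real (vden \<alpha> k) * fc (\<omega> - \<omega>') k" for k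
      unfolding fc_diff[of "snd _"] fc_velocity[OF \<alpha> w(1)] fc_velocity[OF \<alpha> w(2)] right_diff_distrib[symmetric]
      by (simp add: fc_diff)
  qed (simp add: jap_def)
qed

lemma velocity_good_field:
  assumes \<alpha>: "0 < \<alpha>" and w: "wiener (\<omega> - f)"
  shows "good_field (velocity \<alpha> f \<omega>)" "unorm (velocity \<alpha> f \<omega>) \<le> 2 / min 1 \<alpha> * norm (\<omega> - f)"
proof -
  have c: "0 < min 1 \<alpha>" using \<alpha> by simp
  have "of_int (fst k) * fc (fst (velocity \<alpha> f \<omega>)) k + of_int (snd k) * fc (snd (velocity \<alpha> f \<omega>)) k = 0" for k
    by (simp add: fc_velocity[OF \<alpha> w])
  then show "good_field (velocity \<alpha> f \<omega>)"
    using smoothing_bound_hs(1)[OF c velocity_smoothing(1)[OF \<alpha> w]] smoothing_bound_hs(1)[OF c velocity_smoothing(2)[OF \<alpha> w]]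
    by (simp add: good_field_def div_free_def del: split_paired_All)
  show "unorm (velocity \<alpha> f \<omega>) \<le> 2 / min 1 \<alpha> * norm (\<omega> - f)"
    using smoothing_bound_hs(2)[OF c velocity_smoothing(1)[OF \<alpha> w]] smoothing_bound_hs(2)[OF c velocity_smoothing(2)[OF \<alpha> w]]
    unfolding unorm_def by (simp only: times_divide_eq_left)
qed

section \<open>Energy identities of low order\<close>

lemma advect_skew:
  assumes u: "good_field u" and v: "v \<in> sobolev 1"
  shows "inner (advect u v) v = 0"
proof -
  let ?R = "advect_form u v v"
  have df: "div_free u" using u by (simp add: good_field_def)
  have f: "fsob 1 v" using sobolev_imp_fsob[OF v] by simp
  have "(\<Sum>p\<in>F. norm (?R (fst p) (snd p))) \<le> sqrt (hs 0 v) * (cw * unorm u) * sqrt (hs 1 v)" if F: "finite F" for F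
  proof -
    have "norm (?R k l) \<le> (sqrt (jap k) ^ 0 * cmod (fc v k)) * (sqrt (jap (k - l)) ^ 0 * umag u (k - l)) * (sqrt (jap l) ^ 1 * cmod (fc v l))" for k l
    proof -
      have "norm (?R k l) \<le> cmod (fc v k) * cmod (tsym u k l) * cmod (fc v l)"
        unfolding real_norm_def by (rule abs_advect_form_le)
      also have "\<dots> \<le> cmod (fc v k) * (sqrt (jap l) * umag u (k - l)) * cmod (fc v l)"
        by (intro mult_left_mono mult_right_mono norm_tsym_le) auto
      finally show ?thesis by (simp add: mult_ac)
    qed
    then have "(\<Sum>p\<in>F. norm (?R (fst p) (snd p))) \<le>
        (\<Sum>(k, l)\<in>F. (sqrt (jap k) ^ 0 * cmod (fc v k)) * (sqrt (jap (k - l)) ^ 0 * umag u (k - l)) * (sqrt (jap l) ^ 1 * cmod (fc v l)))"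
      unfolding case_prod_beta by (intro sum_mono)
    also have "\<dots> \<le> sqrt (hs 0 v) * (cw * unorm u) * sqrt (hs 1 v)"
      by (rule young_mid[OF l2b_fc[OF fsob_0] l1b_umag[OF u] l2b_fc[OF f] F]; simp)
    finally show ?thesis .
  qed
  then have "(\<lambda>p. norm (?R (fst p) (snd p))) summable_on UNIV"
    by (intro nonneg_bdd_above_summable_on) (auto intro!: bdd_aboveI2)
  then have "(\<lambda>p. ?R (fst p) (snd p)) summable_on UNIV"
    by (rule abs_summable_summable)
  then obtain T where T: "((\<lambda>p. ?R (fst p) (snd p)) has_sum T) UNIV" unfolding summable_on_def by blast
  have "((\<lambda>p. - ?R (fst p) (snd p)) has_sum - T) UNIV"
    using has_sum_bounded_linear[OF bounded_linear_minus[OF bounded_linear_ident] T] by simp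
  moreover have "((\<lambda>p. - ?R (fst p) (snd p)) has_sum T) UNIV"
  proof -
    have anti: "?R (snd p) (fst p) = - ?R (fst p) (snd p)" for p by (rule advect_form_antisym[OF df])
    show ?thesis
      by (subst has_sum_reindex_bij_witness[of _ prod.swap prod.swap UNIV "\<lambda>p. ?R (fst p) (snd p)"])
        (use T anti in auto)
  qed
  ultimately have T0: "T = 0" using has_sum_unique by fastforce
  have "((\<lambda>k. Re (cnj (fc v k) * fc (advect u v) k)) has_sum T) UNIV"
  proof (rule has_sum_SigmaD[where B = "\<lambda>_. UNIV"])
    show "((\<lambda>p. ?R (fst p) (snd p)) has_sum T) (UNIV \<times> UNIV)" using T by simp
    show "((\<lambda>l. ?R (fst (k, l)) (snd (k, l))) has_sum Re (cnj (fc v k) * fc (advect u v) k)) UNIV" for k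
      using advect_form_has_sum[OF good_field_wiener(1,2)[OF u] v, of v k] by simp
  qed
  moreover have "((\<lambda>k. Re (cnj (fc v k) * fc (advect u v) k)) has_sum inner (advect u v) v / (4 * pi\<^sup>2)) UNIV"
    using parseval[of "advect u v" v] by (simp add: mult.commute)
  ultimately have "inner (advect u v) v / (4 * pi\<^sup>2) = 0" using has_sum_unique T0 by blast
  then show ?thesis by simp
qed

lemma weak_deriv_sobolev:
  assumes v: "v \<in> sobolev (m + n)" and ij: "i + j \<le> n"
  shows "weak_deriv i j v \<in> sobolev m"
  unfolding sobolev_def
proof safe
  fix i' j' assume "i' + j' \<le> m"
  then have "(i + i') + (j + j') \<le> m + n" using ij by simp
  from fc_weak_deriv[OF v this] have "has_weak_deriv i' j' (weak_deriv i j v) (weak_deriv (i + i') (j + j') v)"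
    using ij by (simp add: has_weak_deriv_iff fc_weak_deriv[OF v] dsym_def power_add)
  then show "\<exists>w. has_weak_deriv i' j' (weak_deriv i j v) w" by blast
qed

definition dfield :: "nat \<Rightarrow> nat \<Rightarrow> l2 \<times> l2 \<Rightarrow> l2 \<times> l2" where
  "dfield i j u = (weak_deriv i j (fst u), weak_deriv i j (snd u))"

lemma inner_advect_second_deriv:
  assumes u: "good_field u" "fst u \<in> sobolev 2" "snd u \<in> sobolev 2"
    and du: "wiener (weak_deriv i j (fst u))" "wiener (weak_deriv i j (snd u))"
    and v: "v \<in> sobolev 3" and ij: "i + j = 1"
  shows "inner (advect u v) (weak_deriv (2 * i) (2 * j) v) = - inner (advect (dfield i j u) v) (weak_deriv i j v)"
proof -
  note uw = good_field_wiener(1,2)[OF u(1)]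
  have v1: "v \<in> sobolev 1" using v by (rule sobolev_mono) simp
  have dv: "weak_deriv i j v \<in> sobolev 1"
    using weak_deriv_sobolev[of v 1 2 i j] v ij by (simp add: numeral_3_eq_3 numeral_2_eq_2)
  have d: "dsym i j k = dsym i j (k - l) + dsym i j l" for k l
    using ij by (cases i; cases j) (auto simp: dsym_def algebra_simps)
  have fcw: "fc (advect (dfield i j u) v + advect u (weak_deriv i j v)) k = dsym i j k * fc (advect u v) k" for k
  proof -
    have E: "\<i> * tsym (dfield i j u) k l * fc v l + \<i> * tsym u k l * fc (weak_deriv i j v) l =
        dsym i j k * (\<i> * tsym u k l * fc v l)" for l
      using ij by (simp add: tsym_def dfield_def fc_weak_deriv[OF u(2)] fc_weak_deriv[OF u(3)] fc_weak_deriv[OF v1] d[of k l] algebra_simps)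
    have "((\<lambda>l. \<i> * tsym (dfield i j u) k l * fc v l + \<i> * tsym u k l * fc (weak_deriv i j v) l) has_sum
        fc (advect (dfield i j u) v + advect u (weak_deriv i j v)) k) UNIV"
      unfolding fc_add by (intro has_sum_add fc_advect uw dv v1) (simp_all add: dfield_def du)
    moreover have "((\<lambda>l. dsym i j k * (\<i> * tsym u k l * fc v l)) has_sum dsym i j k * fc (advect u v) k) UNIV"
      by (intro has_sum_cmult_right fc_advect uw v1)
    ultimately show ?thesis unfolding E by (rule has_sum_unique)
  qed
  have E: "Re (fc (advect (dfield i j u) v + advect u (weak_deriv i j v)) k * cnj (fc (weak_deriv i j v) k)) =
      Re (fc (advect u v) k * cnj (fc (- weak_deriv (2 * i) (2 * j) v) k))" for k
  proof -
    have "2 * i + 2 * j \<le> 3" using ij by simp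
    from fc_weak_deriv[OF v this] show ?thesis
      using ij unfolding fcw fc_uminus
      by (cases i; cases j) (auto simp: fc_weak_deriv[OF v1] dsym_def power2_eq_square algebra_simps)
  qed
  have "inner (advect (dfield i j u) v + advect u (weak_deriv i j v)) (weak_deriv i j v) / (4 * pi\<^sup>2)
      = inner (advect u v) (- weak_deriv (2 * i) (2 * j) v) / (4 * pi\<^sup>2)"
    by (rule has_sum_unique[OF parseval parseval[of "advect u v" "- weak_deriv (2 * i) (2 * j) v", folded E]])
  then have "inner (advect (dfield i j u) v + advect u (weak_deriv i j v)) (weak_deriv i j v) =
      inner (advect u v) (- weak_deriv (2 * i) (2 * j) v)" by (subst (asm) divide_cancel_right) simp
  then show ?thesis using advect_skew[OF u(1) dv] by (simp add: inner_add_left)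
qed

lemma frobenius_quadratic_bound:
  fixes a b c d p q :: real
  shows "\<bar>(a * p + b * q) * p + (c * p + d * q) * q\<bar> \<le> sqrt (a\<^sup>2 + c\<^sup>2 + b\<^sup>2 + d\<^sup>2) * (p\<^sup>2 + q\<^sup>2)"
proof -
  have "\<bar>inner (a, c, b, d) (p * p, p * q, q * p, q * q)\<bar> \<le> norm (a, c, b, d) * norm (p * p, p * q, q * p, q * q)"
    by (rule Cauchy_Schwarz_ineq2)
  also have "norm (p * p, p * q, q * p, q * q) = p\<^sup>2 + q\<^sup>2"
  proof -
    have "(p * p)\<^sup>2 + ((p * q)\<^sup>2 + ((q * p)\<^sup>2 + (q * q)\<^sup>2)) = (p\<^sup>2 + q\<^sup>2)\<^sup>2"
      by (simp add: power2_eq_square algebra_simps)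
    then show ?thesis by (simp add: norm_prod_def)
  qed
  finally show ?thesis by (simp add: norm_prod_def algebra_simps)
qed

definition multiplies :: "(real \<times> real \<Rightarrow> real) \<Rightarrow> l2 \<Rightarrow> bool" where
  "multiplies F w \<longleftrightarrow> square_integrable F \<and> w = of_fun F \<and> (\<forall>g. square_integrable g \<longrightarrow>
    square_integrable (\<lambda>x. F x * g x) \<and> w \<odot> of_fun g = of_fun (\<lambda>x. F x * g x))"

lemma multipliesD:
  assumes "multiplies F w"
  shows "square_integrable F" "w = of_fun F" "square_integrable g \<Longrightarrow> square_integrable (\<lambda>x. F x * g x)"
    "square_integrable g \<Longrightarrow> w \<odot> of_fun g = of_fun (\<lambda>x. F x * g x)"
  using assms unfolding multiplies_def by blast+

lemma wiener_multiplies: "wiener w \<Longrightarrow> \<exists>F. multiplies F w"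
  unfolding multiplies_def by (rule wiener_mult, assumption) (blast intro: square_integrable_continuous)

lemma stretching_bound:
  assumes du: "wiener (weak_deriv 1 0 (fst u))" "wiener (weak_deriv 1 0 (snd u))"
      "wiener (weak_deriv 0 1 (fst u))" "wiener (weak_deriv 0 1 (snd u))"
    and M: "grad_sup_norm u \<le> ennreal M" "0 \<le> M"
  shows "\<bar>inner (advect (dfield 1 0 u) v) (weak_deriv 1 0 v) + inner (advect (dfield 0 1 u) v) (weak_deriv 0 1 v)\<bar>
    \<le> M * ((norm (weak_deriv 1 0 v))\<^sup>2 + (norm (weak_deriv 0 1 v))\<^sup>2)"
proof -
  obtain p where p: "square_integrable p" "weak_deriv 1 0 v = of_fun p" by (rule l2_cases)
  obtain q where q: "square_integrable q" "weak_deriv 0 1 v = of_fun q" by (rule l2_cases)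
  obtain A B C D where A: "multiplies A (weak_deriv 1 0 (fst u))" and B: "multiplies B (weak_deriv 1 0 (snd u))"
    and C: "multiplies C (weak_deriv 0 1 (fst u))" and D: "multiplies D (weak_deriv 0 1 (snd u))"
    using du[THEN wiener_multiplies] by blast
  note A = multipliesD[OF A] and B = multipliesD[OF B] and C = multipliesD[OF C] and D = multipliesD[OF D]
  have "grad_sup_norm u = esssup torus (\<lambda>x. ennreal (sqrt ((A x)\<^sup>2 + (C x)\<^sup>2 + (B x)\<^sup>2 + (D x)\<^sup>2)))"
    unfolding grad_sup_norm_def A(2) B(2) C(2) D(2)
    by (simp add: matrix_sup_norm.abs_eq l2_eq_refl A(1) B(1) C(1) D(1))
  then have ae: "AE x in torus. sqrt ((A x)\<^sup>2 + (C x)\<^sup>2 + (B x)\<^sup>2 + (D x)\<^sup>2) \<le> M"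
    using esssup_AE[of "\<lambda>x. ennreal (sqrt ((A x)\<^sup>2 + (C x)\<^sup>2 + (B x)\<^sup>2 + (D x)\<^sup>2))" torus] M
    by (auto elim!: eventually_mono) (metis ennreal_le_iff order_trans)
  have s1: "square_integrable (\<lambda>x. A x * p x + B x * q x)" "square_integrable (\<lambda>x. C x * p x + D x * q x)"
    by (intro square_integrable_add A(3) B(3) C(3) D(3) p(1) q(1))+
  have i1: "integrable torus (\<lambda>x. (A x * p x + B x * q x) * p x)" "integrable torus (\<lambda>x. (C x * p x + D x * q x) * q x)"
    by (intro square_integrable_mult s1 p(1) q(1))+
  have "inner (advect (dfield 1 0 u) v) (weak_deriv 1 0 v) + inner (advect (dfield 0 1 u) v) (weak_deriv 0 1 v) =
      (\<integral>x. (A x * p x + B x * q x) * p x \<partial>torus) + (\<integral>x. (C x * p x + D x * q x) * q x \<partial>torus)"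
    unfolding advect_def dfield_def fst_conv snd_conv p(2) q(2) A(4)[OF p(1)] B(4)[OF q(1)] C(4)[OF p(1)] D(4)[OF q(1)]
    by (simp only: of_fun_add A(3) B(3) C(3) D(3) p(1) q(1) inner_of_fun s1)
  also have "\<dots> = (\<integral>x. (A x * p x + B x * q x) * p x + (C x * p x + D x * q x) * q x \<partial>torus)"
    by (rule Bochner_Integration.integral_add[symmetric]) (rule i1)+
  finally have eq: "inner (advect (dfield 1 0 u) v) (weak_deriv 1 0 v) + inner (advect (dfield 0 1 u) v) (weak_deriv 0 1 v) =
      (\<integral>x. (A x * p x + B x * q x) * p x + (C x * p x + D x * q x) * q x \<partial>torus)" .
  have "\<bar>\<integral>x. (A x * p x + B x * q x) * p x + (C x * p x + D x * q x) * q x \<partial>torus\<bar> \<le>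
      (\<integral>x. \<bar>(A x * p x + B x * q x) * p x + (C x * p x + D x * q x) * q x\<bar> \<partial>torus)"
    by (rule integral_abs_bound)
  also have "\<dots> \<le> (\<integral>x. M * ((p x)\<^sup>2 + (q x)\<^sup>2) \<partial>torus)"
  proof (rule integral_mono_AE)
    show "integrable torus (\<lambda>x. \<bar>(A x * p x + B x * q x) * p x + (C x * p x + D x * q x) * q x\<bar>)"
      by (intro integrable_abs Bochner_Integration.integrable_add i1)
    show "integrable torus (\<lambda>x. M * ((p x)\<^sup>2 + (q x)\<^sup>2))"
      using p(1) q(1) by (auto simp: square_integrable_def)
    show "AE x in torus. \<bar>(A x * p x + B x * q x) * p x + (C x * p x + D x * q x) * q x\<bar> \<le> M * ((p x)\<^sup>2 + (q x)\<^sup>2)"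
      using ae
    proof eventually_elim
      case (elim x)
      show ?case by (rule order_trans[OF frobenius_quadratic_bound mult_right_mono[OF elim]]) simp
    qed
  qed
  also have "\<dots> = M * ((norm (weak_deriv 1 0 v))\<^sup>2 + (norm (weak_deriv 0 1 v))\<^sup>2)"
    unfolding p(2) q(2) using p(1) q(1) by (simp add: norm_of_fun square_integrable_def)
  finally show ?thesis unfolding eq .
qed

lemma gradient_energy_bound:
  assumes \<alpha>: "0 < \<alpha>" and w: "wiener (\<omega> - f)" and b: "b \<in> sobolev 3"
    and M: "grad_sup_norm (velocity \<alpha> f \<omega>) \<le> ennreal M" "0 \<le> M"
  shows "\<bar>inner (advect (velocity \<alpha> f \<omega>) b) (laplacian b)\<bar> \<le> M * ((norm (weak_deriv 1 0 b))\<^sup>2 + (norm (weak_deriv 0 1 b))\<^sup>2)"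
proof -
  let ?u = "velocity \<alpha> f \<omega>"
  have c: "0 < min 1 \<alpha>" using \<alpha> by simp
  note u = velocity_good_field(1)[OF \<alpha> w]
  note s1 = smoothing_bound_sobolev[OF c velocity_smoothing(1)[OF \<alpha> w] w]
  note s2 = smoothing_bound_sobolev[OF c velocity_smoothing(2)[OF \<alpha> w] w]
  have "inner (advect ?u b) (laplacian b) = - (inner (advect (dfield 1 0 ?u) b) (weak_deriv 1 0 b) + inner (advect (dfield 0 1 ?u) b) (weak_deriv 0 1 b))"
    using inner_advect_second_deriv[OF u s1(1) s2(1) s1(2) s2(2) b, of 1 0] inner_advect_second_deriv[OF u s1(1) s2(1) s1(2) s2(2) b, of 0 1]
    by (simp add: laplacian_def inner_add_right)
  then show ?thesis
    using stretching_bound[OF s1(2) s2(2) s1(2) s2(2) M, of b] by simp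
qed

section \<open>Differentiation and Gronwall inequalities\<close>

lemma deriv_nonpos_imp_le:
  fixes y :: "real \<Rightarrow> real"
  assumes d: "\<And>s. s \<in> {0..T} \<Longrightarrow> (y has_real_derivative y' s) (at s within {0..T})"
    and le: "\<And>s. s \<in> {0..T} \<Longrightarrow> y' s \<le> 0" and t: "t \<in> {0..T}"
  shows "y t \<le> y 0"
proof (cases "t = 0")
  case False
  then have t0: "0 < t" using t by simp
  have "\<exists>x\<in>{0<..<t}. y t - y 0 = (\<lambda>h. h * y' x) (t - 0)"
  proof (rule mvt_simple[OF t0])
    fix x assume "0 \<le> x" "x \<le> t"
    then have "(y has_real_derivative y' x) (at x within {0..t})"
      using t by (intro has_field_derivative_subset[OF d]) auto
    then show "(y has_derivative (\<lambda>h. h * y' x)) (at x within {0..t})"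
      by (simp add: has_field_derivative_def mult_commute_abs)
  qed
  then obtain x where "x \<in> {0<..<t}" "y t - y 0 = t * y' x" by auto
  then show ?thesis using le[of x] t t0 mult_nonneg_nonpos[of t "y' x"] by auto
qed simp

lemma gronwall_deriv:
  fixes y :: "real \<Rightarrow> real"
  assumes d: "\<And>s. s \<in> {0..T} \<Longrightarrow> (y has_real_derivative y' s) (at s within {0..T})"
    and le: "\<And>s. s \<in> {0..T} \<Longrightarrow> y' s \<le> C * y s" and t: "t \<in> {0..T}"
  shows "y t \<le> y 0 * exp (C * t)"
proof -
  have "y t * exp (- C * t) \<le> y 0 * exp (- C * 0)"
  proof (rule deriv_nonpos_imp_le[OF _ _ t, where y = "\<lambda>s. y s * exp (- C * s)"])
    fix s assume s: "s \<in> {0..T}"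
    show "((\<lambda>s. y s * exp (- C * s)) has_real_derivative (y' s - C * y s) * exp (- C * s)) (at s within {0..T})"
      by (rule derivative_eq_intros d[OF s] refl | simp add: algebra_simps)+
    show "(y' s - C * y s) * exp (- C * s) \<le> 0"
      using le[OF s] by (intro mult_nonpos_nonneg) auto
  qed
  then show ?thesis by (simp add: exp_minus field_simps)
qed

lemma integral_deriv:
  fixes g :: "real \<Rightarrow> real"
  assumes "continuous_on {0..T} g" "s \<in> {0..T}"
  shows "((\<lambda>t. integral {0..t} g) has_real_derivative g s) (at s within {0..T})"
  using integral_has_vector_derivative[OF assms]
  by (simp add: has_real_derivative_iff_has_vector_derivative)

lemma gronwall_integral:
  fixes y :: "real \<Rightarrow> real"
  assumes c: "continuous_on {0..T} y" and C: "0 \<le> C"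
    and le: "\<And>s. s \<in> {0..T} \<Longrightarrow> y s \<le> A + C * integral {0..s} y" and t: "t \<in> {0..T}"
  shows "y t \<le> A * exp (C * t)"
proof -
  have "A + C * integral {0..t} y \<le> (A + C * integral {0..0} y) * exp (C * t)"
  proof (rule gronwall_deriv[OF _ _ t])
    fix s assume s: "s \<in> {0..T}"
    show "((\<lambda>s. A + C * integral {0..s} y) has_real_derivative C * y s) (at s within {0..T})"
      by (rule derivative_eq_intros integral_deriv[OF c s] refl | simp)+
    show "C * y s \<le> C * (A + C * integral {0..s} y)" using le[OF s] C by (rule mult_left_mono)
  qed
  then show ?thesis using le[OF t] by simp
qed

text \<open>The space of square integrable functions is not known to be complete here, so the fundamental
  theorem of calculus is reduced to scalar functions by pairing the error with itself.\<close>

lemma integral_equation_derivative: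
  fixes g B :: "real \<Rightarrow> 'a::real_inner"
  assumes g: "continuous_on {0..T} g"
    and eq: "\<And>t. t \<in> {0..T} \<Longrightarrow> \<exists>I. (g has_integral I) {0..t} \<and> B t = B0 - I"
    and s: "s \<in> {0..T}"
  shows "(B has_vector_derivative - g s) (at s within {0..T})"
proof -
  have scalar: "((\<lambda>t. inner (B t) p) has_real_derivative - inner (g t) p) (at t within {0..T})" if t: "t \<in> {0..T}" for p t
  proof -
    have c: "continuous_on {0..T} (\<lambda>t. inner (g t) p)" by (intro continuous_intros g)
    have E: "inner (B r) p = inner B0 p - integral {0..r} (\<lambda>t. inner (g t) p)" if r: "r \<in> {0..T}" for r
    proof -
      obtain I where I: "(g has_integral I) {0..r}" "B r = B0 - I" using eq[OF r] by blast
      have "((\<lambda>t. inner (g t) p) has_integral inner I p) {0..r}"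
        using has_integral_linear[OF I(1) bounded_linear_inner_left[of p]] by (simp add: o_def)
      then show ?thesis by (simp add: I(2) inner_diff_left integral_unique)
    qed
    have "((\<lambda>t. inner B0 p - integral {0..t} (\<lambda>t. inner (g t) p)) has_real_derivative - inner (g t) p) (at t within {0..T})"
      by (rule derivative_eq_intros integral_deriv[OF c t] refl | simp)+
    then show ?thesis
      by (rule has_field_derivative_transform_within[OF _ zero_less_one t]) (simp add: E)
  qed
  have "((\<lambda>y. norm (B y - B s - (y - s) *\<^sub>R (- g s)) / norm (y - s)) \<longlongrightarrow> 0) (at s within {0..T})"
  proof (rule tendstoI)
    fix e :: real assume e: "0 < e"
    obtain d where d: "0 < d" "\<And>r. r \<in> {0..T} \<Longrightarrow> dist r s < d \<Longrightarrow> dist (g r) (g s) < e / 2"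
      using g[unfolded continuous_on_iff, rule_format, OF s, of "e / 2"] e by auto
    have X: "norm (B y - B s - (y - s) *\<^sub>R (- g s)) \<le> e / 2 * norm (y - s)" if y: "y \<in> {0..T}" "dist y s < d" for y
    proof -
      define p where "p = B y - B s - (y - s) *\<^sub>R (- g s)"
      define S where "S = {0..T} \<inter> ball s d"
      have "norm ((inner (B y) p + y * inner (g s) p) - (inner (B s) p + s * inner (g s) p)) \<le> (e / 2 * norm p) * norm (y - s)"
      proof (rule field_differentiable_bound[where S = S])
        show "convex S" unfolding S_def by (intro convex_Int) auto
        show "y \<in> S" "s \<in> S" using y s d by (auto simp: S_def dist_commute)
        fix r assume r: "r \<in> S"
        have "((\<lambda>r. inner (B r) p) has_real_derivative - inner (g r) p) (at r within S)"
          using r by (intro has_field_derivative_subset[OF scalar]) (auto simp: S_def)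
        then show "((\<lambda>r. inner (B r) p + r * inner (g s) p) has_real_derivative inner (g s - g r) p) (at r within S)"
          by (auto intro!: derivative_eq_intros simp: inner_diff_left)
        have "\<bar>inner (g s - g r) p\<bar> \<le> norm (g s - g r) * norm p" by (rule Cauchy_Schwarz_ineq2)
        also have "\<dots> \<le> e / 2 * norm p"
        proof (intro mult_right_mono)
          have "dist (g r) (g s) < e / 2" using r by (intro d(2)) (auto simp: S_def dist_commute)
          then show "norm (g s - g r) \<le> e / 2" by (simp add: dist_norm norm_minus_commute)
        qed simp
        finally show "norm (inner (g s - g r) p) \<le> e / 2 * norm p" by simp
      qed
      also have "(inner (B y) p + y * inner (g s) p) - (inner (B s) p + s * inner (g s) p) = inner p p"
        by (simp add: p_def inner_diff_left inner_add_left algebra_simps)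
      finally have "norm p * norm p \<le> e / 2 * norm (y - s) * norm p"
        by (simp add: power2_norm_eq_inner[symmetric] power2_eq_square mult_ac)
      then show ?thesis unfolding p_def[symmetric] using e
        by (cases "p = 0") (simp_all add: mult_le_cancel_right)
    qed
    then have "dist (norm (B y - B s - (y - s) *\<^sub>R (- g s)) / norm (y - s)) 0 < e" if "y \<in> {0..T}" "0 < dist y s" "dist y s < d" for y
    proof -
      have "norm (B y - B s - (y - s) *\<^sub>R (- g s)) / norm (y - s) \<le> e / 2"
        using X[OF that(1,3)] that(2)
        by (simp add: divide_le_eq dist_norm)
      then have "norm (B y - B s - (y - s) *\<^sub>R (- g s)) / norm (y - s) < e" using e by linarith
      then show ?thesis by (simp add: dist_real_def)
    qed
    then show "\<forall>\<^sub>F y in at s within {0..T}. dist (norm (B y - B s - (y - s) *\<^sub>R (- g s)) / norm (y - s)) 0 < e"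
      unfolding eventually_at using d(1) by (metis zero_less_dist_iff)
  qed
  from conjI[OF bounded_linear_scaleR_left this] show ?thesis
    unfolding has_vector_derivative_def has_derivative_iff_norm .
qed

lemma symmetric_form_derivative:
  fixes B D :: "real \<Rightarrow> 'a::real_inner"
  assumes B: "(B has_vector_derivative B') (at s within S)" and D: "continuous_on S D" and s: "s \<in> S"
    and sym: "\<And>r. r \<in> S \<Longrightarrow> inner (B r) (D s) = inner (B s) (D r)"
  shows "((\<lambda>t. inner (B t) (D t)) has_real_derivative 2 * inner B' (D s)) (at s within S)"
proof -
  have "((\<lambda>y. norm (B y - B s - (y - s) *\<^sub>R B') / norm (y - s)) \<longlongrightarrow> 0) (at s within S)"
    using B by (simp add: has_vector_derivative_def has_derivative_iff_norm)
  moreover have "\<forall>\<^sub>F y in at s within S. norm ((1 / (y - s)) *\<^sub>R (B y - B s) - B') \<le> norm (B y - B s - (y - s) *\<^sub>R B') / norm (y - s)"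
    unfolding eventually_at_filter
  proof (intro always_eventually allI impI)
    fix y assume "y \<noteq> s"
    then have "(1 / (y - s)) *\<^sub>R (B y - B s) - B' = (1 / (y - s)) *\<^sub>R (B y - B s - (y - s) *\<^sub>R B')"
      by (subst scaleR_diff_right[of _ "B y - B s"]) simp
    then show "norm ((1 / (y - s)) *\<^sub>R (B y - B s) - B') \<le> norm (B y - B s - (y - s) *\<^sub>R B') / norm (y - s)"
      by simp
  qed
  ultimately have "((\<lambda>y. (1 / (y - s)) *\<^sub>R (B y - B s) - B') \<longlongrightarrow> 0) (at s within S)"
    by (rule Lim_null_comparison[rotated])
  then have q: "((\<lambda>y. (1 / (y - s)) *\<^sub>R (B y - B s)) \<longlongrightarrow> B') (at s within S)" by (simp add: LIM_zero_iff)
  have "((\<lambda>y. inner ((1 / (y - s)) *\<^sub>R (B y - B s)) (D y + D s)) \<longlongrightarrow> inner B' (D s + D s)) (at s within S)"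
    using D s by (intro tendsto_intros q) (auto simp: continuous_on_def)
  then have "((\<lambda>y. (inner (B y) (D y) - inner (B s) (D s)) / (y - s)) \<longlongrightarrow> inner B' (D s + D s)) (at s within S)"
  proof (rule Lim_transform_eventually)
    show "\<forall>\<^sub>F y in at s within S. inner ((1 / (y - s)) *\<^sub>R (B y - B s)) (D y + D s) = (inner (B y) (D y) - inner (B s) (D s)) / (y - s)"
      unfolding eventually_at_filter
      by (intro always_eventually allI impI) (simp add: inner_diff_left inner_add_right sym add_divide_distrib[symmetric])
  qed
  then show ?thesis by (simp add: has_field_derivative_iff inner_add_right)
qed

section \<open>Passing to the limit in the truncated energies\<close>

lemma energy_limit:
  assumes v: "\<And>s. s \<in> {0..T} \<Longrightarrow> (v has_vector_derivative v' s) (at s within {0..T})"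
    and f: "\<And>s. s \<in> {0..T} \<Longrightarrow> fsob m (v s)" and m: "0 < m"
    and c: "continuous_on {0..T} \<rho>"
    and le: "\<And>s N. s \<in> {0..T} \<Longrightarrow> 2 * wsum m N (v s) (v' s) \<le> \<rho> s"
    and t: "t \<in> {0..T}"
  shows "hs m (v t) \<le> hs m (v 0) + integral {0..t} \<rho>"
proof -
  have T: "0 \<in> {0..T}" using t by auto
  define E where "E N s = (\<Sum>k\<in>wset N. wgt m N (jap k) * (cmod (fc (v s) k))\<^sup>2)" for N s
  have dE: "(E N has_real_derivative 2 * wsum m N (v s) (v' s)) (at s within {0..T})"
    if s: "s \<in> {0..T}" for N s
  proof -
    have k: "((\<lambda>s. (cmod (fc (v s) k))\<^sup>2) has_real_derivative 2 * Re (cnj (fc (v s) k) * fc (v' s) k)) (at s within {0..T})" for k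
    proof -
      have d: "((\<lambda>s. fc (v s) k) has_vector_derivative fc (v' s) k) (at s within {0..T})"
        by (rule bounded_linear.has_vector_derivative[OF bounded_linear_fc v[OF s]])
      have r: "((\<lambda>s. Re (fc (v s) k)) has_real_derivative Re (fc (v' s) k)) (at s within {0..T})"
        "((\<lambda>s. Im (fc (v s) k)) has_real_derivative Im (fc (v' s) k)) (at s within {0..T})"
        unfolding has_real_derivative_iff_has_vector_derivative
        by (rule bounded_linear.has_vector_derivative[OF bounded_linear_Re d] bounded_linear.has_vector_derivative[OF bounded_linear_Im d])+
      show ?thesis unfolding cmod_power2
        by (rule derivative_eq_intros r refl | simp add: algebra_simps)+
    qed
    have "(E N has_real_derivative (\<Sum>k\<in>wset N. wgt m N (jap k) * (2 * Re (cnj (fc (v s) k) * fc (v' s) k)))) (at s within {0..T})"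
      unfolding E_def[abs_def] by (intro DERIV_sum DERIV_cmult k)
    then show ?thesis unfolding wsum_def sum_distrib_left by (simp only: mult.left_commute[of _ 2])
  qed
  have E: "E N t \<le> hs m (v 0) + integral {0..t} \<rho>" for N
  proof -
    have "E N t - integral {0..t} \<rho> \<le> E N 0 - integral {0..0} \<rho>"
    proof (rule deriv_nonpos_imp_le[OF _ _ t, where y = "\<lambda>t. E N t - integral {0..t} \<rho>"])
      fix s assume s: "s \<in> {0..T}"
      show "((\<lambda>t. E N t - integral {0..t} \<rho>) has_real_derivative
          2 * wsum m N (v s) (v' s) - \<rho> s) (at s within {0..T})"
        by (intro DERIV_diff dE integral_deriv c s)
      show "2 * wsum m N (v s) (v' s) - \<rho> s \<le> 0"
        using le[OF s, of N] by simp
    qed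
    also have "E N 0 \<le> hs m (v 0)"
    proof -
      have "E N 0 \<le> (\<Sum>k\<in>wset N. jap k ^ m * (cmod (fc (v 0) k))\<^sup>2)"
        unfolding E_def using wgt_bounds[OF jap_nonneg m] by (intro sum_mono mult_right_mono) auto
      also have "\<dots> \<le> hs m (v 0)" by (rule hs_finite_sum_le[OF f[OF T] finite_wset])
      finally show ?thesis .
    qed
    finally show ?thesis by simp
  qed
  show ?thesis unfolding hs_def[of m "v t"]
  proof (rule infsum_le_finite_sums)
    show "(\<lambda>k. jap k ^ m * (cmod (fc (v t) k))\<^sup>2) summable_on UNIV" using f[OF t] by (simp add: fsob_def)
    fix S :: "(int \<times> int) set" assume S: "finite S"
    define N where "N = (\<Sum>k\<in>S. jap k)"
    have N: "jap k \<le> N" if "k \<in> S" for k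
      unfolding N_def using S that by (intro member_le_sum) (auto simp: jap_nonneg)
    have sub: "S \<subseteq> wset N"
    proof
      fix k assume "k \<in> S"
      then show "k \<in> wset N" using N[of k] jap_ge_1[of k] unfolding wset_def by auto
    qed
    have "(\<Sum>k\<in>S. jap k ^ m * (cmod (fc (v t) k))\<^sup>2) = (\<Sum>k\<in>S. wgt m N (jap k) * (cmod (fc (v t) k))\<^sup>2)"
      using N m by (intro sum.cong refl) (simp add: wgt_eq jap_nonneg)
    also have "\<dots> \<le> E N t"
      unfolding E_def using wgt_bounds[OF jap_nonneg m] by (intro sum_mono2 finite_wset sub) auto
    also have "\<dots> \<le> hs m (v 0) + integral {0..t} \<rho>" by (rule E)
    finally show "(\<Sum>k\<in>S. jap k ^ m * (cmod (fc (v t) k))\<^sup>2) \<le> hs m (v 0) + integral {0..t} \<rho>" .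
  qed
qed

lemma inner_laplacian:
  assumes v: "v \<in> sobolev 2" and w: "w \<in> sobolev 2"
  shows "inner v (laplacian w) = - (inner (weak_deriv 1 0 v) (weak_deriv 1 0 w) + inner (weak_deriv 0 1 v) (weak_deriv 0 1 w))"
proof -
  have E: "Re (fc v k * cnj (fc (- laplacian w) k)) =
      Re (fc (weak_deriv 1 0 v) k * cnj (fc (weak_deriv 1 0 w) k)) + Re (fc (weak_deriv 0 1 v) k * cnj (fc (weak_deriv 0 1 w) k))" for k
    by (simp add: fc_uminus fc_laplacian[OF w] fc_weak_deriv[OF v] fc_weak_deriv[OF w] dsym_def jap_def power2_eq_square algebra_simps)
  have "((\<lambda>k. Re (fc v k * cnj (fc (- laplacian w) k))) has_sum
      (inner (weak_deriv 1 0 v) (weak_deriv 1 0 w) / (4 * pi\<^sup>2) + inner (weak_deriv 0 1 v) (weak_deriv 0 1 w) / (4 * pi\<^sup>2))) UNIV"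
    unfolding E by (intro has_sum_add parseval)
  from has_sum_unique[OF parseval this]
  have "inner v (- laplacian w) = inner (weak_deriv 1 0 v) (weak_deriv 1 0 w) + inner (weak_deriv 0 1 v) (weak_deriv 0 1 w)"
    unfolding add_divide_distrib[symmetric] by (subst (asm) divide_cancel_right) simp
  then show ?thesis by simp
qed

lemma continuous_wiener_mult:
  assumes v: "\<And>t. t \<in> S \<Longrightarrow> wiener (v t)"
    and d: "\<And>t s. t \<in> S \<Longrightarrow> s \<in> S \<Longrightarrow> wnorm (v t - v s) \<le> C * norm (z t - z s)"
    and z: "continuous_on S z" and w: "continuous_on S w"
  shows "continuous_on S (\<lambda>t. v t \<odot> w t)"
  unfolding continuous_on_def
proof
  fix s assume s: "s \<in> S"
  have "((\<lambda>t. v t \<odot> w t - v s \<odot> w s) \<longlongrightarrow> 0) (at s within S)"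
  proof (rule Lim_null_comparison)
    have "((\<lambda>t. C * norm (z t - z s) * norm (w t) + wnorm (v s) * norm (w t - w s)) \<longlongrightarrow>
        C * norm (z s - z s) * norm (w s) + wnorm (v s) * norm (w s - w s)) (at s within S)"
      using z w s by (intro tendsto_intros) (auto simp: continuous_on_def)
    then show "((\<lambda>t. C * norm (z t - z s) * norm (w t) + wnorm (v s) * norm (w t - w s)) \<longlongrightarrow> 0) (at s within S)" by simp
    show "\<forall>\<^sub>F t in at s within S. norm (v t \<odot> w t - v s \<odot> w s) \<le> C * norm (z t - z s) * norm (w t) + wnorm (v s) * norm (w t - w s)"
      unfolding eventually_at_filter
    proof (intro always_eventually allI impI)
      fix t assume t: "t \<in> S"
      have "v t \<odot> w t - v s \<odot> w s = (v t - v s) \<odot> w t + v s \<odot> (w t - w s)"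
        by (simp add: wiener_mult_diff[OF v[OF t] v[OF s]] wiener_mult_diff_right[OF v[OF s]])
      also have "norm \<dots> \<le> norm ((v t - v s) \<odot> w t) + norm (v s \<odot> (w t - w s))" by (rule norm_triangle_ineq)
      also have "\<dots> \<le> wnorm (v t - v s) * norm (w t) + wnorm (v s) * norm (w t - w s)"
        by (intro add_mono norm_wiener_mult wiener_diff v t s)
      also have "\<dots> \<le> C * norm (z t - z s) * norm (w t) + wnorm (v s) * norm (w t - w s)"
        by (intro add_right_mono mult_right_mono d t s) auto
      finally show "norm (v t \<odot> w t - v s \<odot> w s) \<le> C * norm (z t - z s) * norm (w t) + wnorm (v s) * norm (w t - w s)" .
    qed
  qed
  then show "((\<lambda>t. v t \<odot> w t) \<longlongrightarrow> v s \<odot> w s) (at s within S)" by (simp add: LIM_zero_iff)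
qed

section \<open>A priori bounds for strong solutions\<close>

locale strong_solution =
  fixes \<alpha> :: real and u\<^sub>h :: "l2 \<times> l2" and f b\<^sub>0 \<omega>\<^sub>0 :: l2 and b \<omega> :: "real \<Rightarrow> l2" and T :: real
  assumes alpha: "0 < \<alpha>" and uh: "u\<^sub>h \<in> sobolev_div 3" and f: "f \<in> sobolev 2"
    and sol: "local_strong_solution \<alpha> u\<^sub>h f b\<^sub>0 \<omega>\<^sub>0 b \<omega> T"
begin

abbreviation u :: "real \<Rightarrow> l2 \<times> l2" where
  "u t \<equiv> velocity \<alpha> f (\<omega> t)"

definition gradsq :: "real \<Rightarrow> real" where
  "gradsq t = (norm (weak_deriv 1 0 (b t)))\<^sup>2 + (norm (weak_deriv 0 1 (b t)))\<^sup>2"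

definition b' :: "real \<Rightarrow> l2" where
  "b' t = advect (u t) (b t)"

definition \<omega>' :: "real \<Rightarrow> l2" where
  "\<omega>' t = advect (u t) (\<omega> t - b t) + advect u\<^sub>h (b t)"

lemma T_pos: "0 < T"
  and cb: "continuous_sobolev 3 T b" and co: "continuous_sobolev 2 T \<omega>"
  using sol by (auto simp: local_strong_solution_def)

lemma b_sob: "t \<in> {0..T} \<Longrightarrow> b t \<in> sobolev 3" and o_sob: "t \<in> {0..T} \<Longrightarrow> \<omega> t \<in> sobolev 2"
  using cb co by (auto simp: continuous_sobolev_def)

lemma wiener_vort: "t \<in> {0..T} \<Longrightarrow> wiener (\<omega> t - f)"
  using sobolev_imp_fsob[OF sobolev_diff[OF o_sob f]] fsob_wiener by blast

lemma c_pos: "0 < min 1 \<alpha>"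
  using alpha by simp

lemma good_u: "t \<in> {0..T} \<Longrightarrow> good_field (u t)"
  by (rule velocity_good_field[OF alpha wiener_vort])

lemma good_uh: "good_field u\<^sub>h"
proof -
  have 1: "fst u\<^sub>h \<in> sobolev 3" "snd u\<^sub>h \<in> sobolev 3" "has_weak_div u\<^sub>h 0" using uh by (auto simp: sobolev_div_def)
  have "of_int (fst k) * fc (fst u\<^sub>h) k + of_int (snd k) * fc (snd u\<^sub>h) k = 0" for k
  proof -
    have "\<i> * (of_int (fst k) * fc (fst u\<^sub>h) k + of_int (snd k) * fc (snd u\<^sub>h) k) = 0"
      using 1(3)[unfolded has_weak_div_iff, rule_format, of k] by (simp add: distrib_left mult.assoc)
    then show ?thesis by simp
  qed
  then show ?thesis using sobolev_imp_fsob(1)[OF 1(1)] sobolev_imp_fsob(1)[OF 1(2)]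
    unfolding good_field_def div_free_def by blast
qed

lemma ob_sob: "t \<in> {0..T} \<Longrightarrow> \<omega> t - b t \<in> sobolev 2"
  by (intro sobolev_diff o_sob sobolev_mono[OF b_sob]) auto

lemma weak_div_b: "t \<in> {0..T} \<Longrightarrow> weak_div (b t \<odot>\<^sub>v u t) = b' t"
  unfolding b'_def using good_u[of t] sobolev_mono[OF b_sob[of t], of 1]
  by (intro weak_div_scale_field good_field_wiener) (auto simp: good_field_def)

lemma weak_div_o:
  assumes t: "t \<in> {0..T}"
  shows "weak_div ((\<omega> t - b t) \<odot>\<^sub>v u t) + weak_div (b t \<odot>\<^sub>v u\<^sub>h) = \<omega>' t"
proof -
  have "weak_div ((\<omega> t - b t) \<odot>\<^sub>v u t) = advect (u t) (\<omega> t - b t)"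
    using good_u[OF t] sobolev_mono[OF ob_sob[OF t], of 1]
    by (intro weak_div_scale_field good_field_wiener) (auto simp: good_field_def)
  moreover have "weak_div (b t \<odot>\<^sub>v u\<^sub>h) = advect u\<^sub>h (b t)"
    using good_uh sobolev_mono[OF b_sob[OF t], of 1]
    by (intro weak_div_scale_field good_field_wiener) (auto simp: good_field_def)
  ultimately show ?thesis by (simp add: \<omega>'_def)
qed

lemma wnorm_velocity_diff:
  assumes "t \<in> {0..T}" "s \<in> {0..T}"
  shows "wnorm (fst (u t) - fst (u s)) \<le> cw / min 1 \<alpha> * norm (\<omega> t - \<omega> s)"
    and "wnorm (snd (u t) - snd (u s)) \<le> cw / min 1 \<alpha> * norm (\<omega> t - \<omega> s)"
proof -
  have *: "wnorm z \<le> cw / min 1 \<alpha> * norm w" if "smoothing_bound (min 1 \<alpha>) z w" for z w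
  proof -
    have h: "fsob 3 z" "sqrt (hs 3 z) \<le> norm w / min 1 \<alpha>" using smoothing_bound_hs[OF c_pos that] by auto
    have h2: "fsob 2 z" "hs 2 z \<le> hs 3 z" using fsob_mono[OF h(1), of 2] by auto
    have "wnorm z \<le> cw * sqrt (hs 2 z)" by (rule fsob_wiener[OF h2(1)])
    also have "\<dots> \<le> cw * (norm w / min 1 \<alpha>)"
      using h2(2) h(2) by (intro mult_left_mono cw_nonneg) (meson order_trans real_sqrt_le_mono)
    finally show ?thesis by simp
  qed
  show "wnorm (fst (u t) - fst (u s)) \<le> cw / min 1 \<alpha> * norm (\<omega> t - \<omega> s)"
    "wnorm (snd (u t) - snd (u s)) \<le> cw / min 1 \<alpha> * norm (\<omega> t - \<omega> s)"
    by (intro * velocity_diff_smoothing alpha wiener_vort assms)+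
qed

lemma wnorm_zero: "wnorm 0 = 0"
  by (simp add: wnorm_def)

lemma continuous_advect_u:
  assumes "continuous_on {0..T} (\<lambda>t. weak_deriv 1 0 (v t))" "continuous_on {0..T} (\<lambda>t. weak_deriv 0 1 (v t))"
  shows "continuous_on {0..T} (\<lambda>t. advect (u t) (v t))"
  unfolding advect_def
  by (intro continuous_on_add continuous_wiener_mult[where C = "cw / min 1 \<alpha>", OF _ _ continuous_sobolev_l2[OF co] assms(1)]
      continuous_wiener_mult[where C = "cw / min 1 \<alpha>", OF _ _ continuous_sobolev_l2[OF co] assms(2)] good_field_wiener good_u wnorm_velocity_diff)

lemma continuous_b': "continuous_on {0..T} b'"
  unfolding b'_def[abs_def]
  by (intro continuous_advect_u continuous_sobolev_weak_deriv[OF cb]) auto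

lemma continuous_o': "continuous_on {0..T} \<omega>'"
proof -
  have d: "continuous_on {0..T} (\<lambda>t. weak_deriv i j (\<omega> t - b t))" if "i + j \<le> 2" for i j
  proof -
    have "continuous_on {0..T} (\<lambda>t. weak_deriv i j (\<omega> t) - weak_deriv i j (b t))"
      using that by (intro continuous_on_diff continuous_sobolev_weak_deriv[OF co] continuous_sobolev_weak_deriv[OF cb]) auto
    then show ?thesis
      by (rule continuous_on_eq) (simp add: weak_deriv_diff[where m = 2] o_sob sobolev_mono[OF b_sob] that)
  qed
  have "continuous_on {0..T} (\<lambda>t. advect u\<^sub>h (b t))"
    unfolding advect_def
    by (intro continuous_on_add continuous_wiener_mult[where C = 0, OF _ _ continuous_sobolev_l2[OF co]]
        good_field_wiener good_uh continuous_sobolev_weak_deriv[OF cb]) (auto simp: wnorm_zero)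
  then show ?thesis unfolding \<omega>'_def[abs_def] by (intro continuous_on_add continuous_advect_u d) auto
qed

lemma b_deriv: "s \<in> {0..T} \<Longrightarrow> (b has_vector_derivative - b' s) (at s within {0..T})"
proof (rule integral_equation_derivative[OF continuous_b', where ?B0.0 = b\<^sub>0])
  fix t assume t: "t \<in> {0..T}"
  then obtain I where I: "((\<lambda>\<tau>. weak_div (b \<tau> \<odot>\<^sub>v u \<tau>)) has_integral I) {0..t}" "b t = b\<^sub>0 - I"
    using sol unfolding local_strong_solution_def by blast
  have "(b' has_integral I) {0..t}"
    by (rule has_integral_eq[OF _ I(1)]) (use t in \<open>auto intro: weak_div_b\<close>)
  then show "\<exists>I. (b' has_integral I) {0..t} \<and> b t = b\<^sub>0 - I" using I(2) by blast
qed

lemma o_deriv: "s \<in> {0..T} \<Longrightarrow> (\<omega> has_vector_derivative - \<omega>' s) (at s within {0..T})"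
proof (rule integral_equation_derivative[OF continuous_o', where ?B0.0 = \<omega>\<^sub>0])
  fix t assume t: "t \<in> {0..T}"
  then obtain I where I: "((\<lambda>\<tau>. weak_div ((\<omega> \<tau> - b \<tau>) \<odot>\<^sub>v u \<tau>) + weak_div (b \<tau> \<odot>\<^sub>v u\<^sub>h)) has_integral I) {0..t}" "\<omega> t = \<omega>\<^sub>0 - I"
    using sol unfolding local_strong_solution_def by blast
  have "(\<omega>' has_integral I) {0..t}"
    by (rule has_integral_eq[OF _ I(1)]) (use t in \<open>auto intro: weak_div_o\<close>)
  then show "\<exists>I. (\<omega>' has_integral I) {0..t} \<and> \<omega> t = \<omega>\<^sub>0 - I" using I(2) by blast
qed

lemma b_0: "b 0 = b\<^sub>0" and o_0: "\<omega> 0 = \<omega>\<^sub>0"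
proof -
  have 0: "0 \<in> {0..T}" using T_pos by simp
  obtain I where "((\<lambda>\<tau>. weak_div (b \<tau> \<odot>\<^sub>v u \<tau>)) has_integral I) {0..0}" "b 0 = b\<^sub>0 - I"
    using sol 0 unfolding local_strong_solution_def by blast
  moreover obtain I' where "((\<lambda>\<tau>. weak_div ((\<omega> \<tau> - b \<tau>) \<odot>\<^sub>v u \<tau>) + weak_div (b \<tau> \<odot>\<^sub>v u\<^sub>h)) has_integral I') {0..0}" "\<omega> 0 = \<omega>\<^sub>0 - I'"
    using sol 0 unfolding local_strong_solution_def by blast
  ultimately show "b 0 = b\<^sub>0" "\<omega> 0 = \<omega>\<^sub>0"
    using has_integral_unique[OF _ has_integral_refl(2)] by auto
qed

lemma gradsq_eq:
  assumes "t \<in> {0..T}"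
  shows "gradsq t = - inner (b t) (laplacian (b t))"
proof -
  have "b t \<in> sobolev 2" by (rule sobolev_mono[OF b_sob[OF assms]]) simp
  then show ?thesis by (simp add: inner_laplacian gradsq_def power2_norm_eq_inner)
qed

lemma continuous_laplacian: "continuous_on {0..T} (\<lambda>t. laplacian (b t))"
  unfolding laplacian_def by (intro continuous_on_add continuous_sobolev_weak_deriv[OF cb]) auto

lemma gradsq_deriv:
  assumes s: "s \<in> {0..T}"
  shows "(gradsq has_real_derivative 2 * inner (b' s) (laplacian (b s))) (at s within {0..T})"
proof -
  have "((\<lambda>t. inner (b t) (laplacian (b t))) has_real_derivative 2 * inner (- b' s) (laplacian (b s))) (at s within {0..T})"
  proof (rule symmetric_form_derivative[OF b_deriv[OF s] continuous_laplacian s])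
    fix r assume r: "r \<in> {0..T}"
    show "inner (b r) (laplacian (b s)) = inner (b s) (laplacian (b r))"
      using inner_laplacian[OF sobolev_mono[OF b_sob[OF r]] sobolev_mono[OF b_sob[OF s]]]
        inner_laplacian[OF sobolev_mono[OF b_sob[OF s]] sobolev_mono[OF b_sob[OF r]]]
      by (simp add: inner_commute)
  qed
  then have "((\<lambda>t. - inner (b t) (laplacian (b t))) has_real_derivative - (2 * inner (- b' s) (laplacian (b s)))) (at s within {0..T})"
    by (rule DERIV_minus)
  then have "((\<lambda>t. - inner (b t) (laplacian (b t))) has_real_derivative 2 * inner (b' s) (laplacian (b s))) (at s within {0..T})"
    by simp
  then show ?thesis
    by (rule has_field_derivative_transform_within[OF _ zero_less_one s]) (simp add: gradsq_eq)
qed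

text \<open>The logarithmic derivative of \<open>1 + gradsq\<close> is continuous in time, so that no measurability of
  \<open>grad_sup_norm\<close> as a function of time is needed.\<close>

lemma gradient_bound:
  assumes J: "(\<integral>\<^sup>+ s \<in> {s. 0 \<le> s \<and> s < T}. grad_sup_norm (u s) \<partial>lborel) \<le> ennreal J" "0 \<le> J"
    and t: "t \<in> {0..T}"
  shows "gradsq t \<le> (1 + gradsq 0) * exp (2 * J)"
proof -
  define g where "g s = inner (b' s) (laplacian (b s)) / (1 + gradsq s)" for s
  have pos: "0 < 1 + gradsq s" for s by (simp add: gradsq_def add_pos_nonneg)
  have cg: "continuous_on {0..T} gradsq"
    using gradsq_deriv DERIV_continuous continuous_on_eq_continuous_within by blast
  have c: "continuous_on {0..T} g"
    unfolding g_def using pos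
    by (intro continuous_intros continuous_b' continuous_laplacian cg) (auto simp: less_imp_neq[symmetric])
  have c': "continuous_on {0..t} (\<lambda>s. \<bar>g s\<bar>)"
    using t by (intro continuous_intros continuous_on_subset[OF c]) auto
  have le: "ennreal \<bar>g s\<bar> \<le> grad_sup_norm (u s)" if s: "s \<in> {0..T}" for s
  proof (cases "grad_sup_norm (u s) = \<infinity>")
    case False
    then obtain M where M: "grad_sup_norm (u s) = ennreal M" "0 \<le> M" by (cases "grad_sup_norm (u s)") auto
    have "\<bar>inner (b' s) (laplacian (b s))\<bar> \<le> M * gradsq s"
      unfolding b'_def gradsq_def using M s by (intro gradient_energy_bound alpha wiener_vort b_sob) auto
    also have "\<dots> \<le> M * (1 + gradsq s)" using M(2) by (intro mult_left_mono) auto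
    finally have "\<bar>g s\<bar> \<le> M" using pos[of s] by (simp add: g_def abs_divide divide_le_eq)
    then show ?thesis by (simp add: M(1) ennreal_leI)
  qed simp
  have "((\<lambda>s. 2 * g s) has_integral ln (1 + gradsq t) - ln (1 + gradsq 0)) {0..t}"
  proof (rule fundamental_theorem_of_calculus)
    fix s assume s: "s \<in> {0..t}"
    have "(gradsq has_real_derivative 2 * inner (b' s) (laplacian (b s))) (at s within {0..t})"
      using s t by (intro has_field_derivative_subset[OF gradsq_deriv]) auto
    then have "((\<lambda>s. ln (1 + gradsq s)) has_real_derivative 2 * g s) (at s within {0..t})"
      using pos[of s] by (auto intro!: derivative_eq_intros simp: g_def)
    then show "((\<lambda>s. ln (1 + gradsq s)) has_vector_derivative 2 * g s) (at s within {0..t})"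
      by (simp add: has_real_derivative_iff_has_vector_derivative)
  qed (use t in auto)
  moreover have si: "set_integrable lborel {0..t} (\<lambda>s. \<bar>g s\<bar>)" by (rule borel_integrable_atLeastAtMost'[OF c'])
  have i: "((\<lambda>s. 2 * \<bar>g s\<bar>) has_integral 2 * (LINT s:{0..t}|lborel. \<bar>g s\<bar>)) {0..t}"
    using set_borel_integral_eq_integral[OF si] by (intro has_integral_mult_right) (simp add: has_integral_iff)
  ultimately have 1: "ln (1 + gradsq t) - ln (1 + gradsq 0) \<le> 2 * (LINT s:{0..t}|lborel. \<bar>g s\<bar>)"
    by (rule has_integral_le) simp
  have "ennreal (LINT s:{0..t}|lborel. \<bar>g s\<bar>) = (\<integral>\<^sup>+ s. ennreal (indicator {0..t} s * \<bar>g s\<bar>) \<partial>lborel)"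
    unfolding set_lebesgue_integral_def
    using si by (subst nn_integral_eq_integral) (auto simp: set_integrable_def)
  also have "\<dots> \<le> (\<integral>\<^sup>+ s \<in> {s. 0 \<le> s \<and> s < T}. grad_sup_norm (u s) \<partial>lborel)"
  proof (rule nn_integral_mono_AE)
    show "AE s in lborel. ennreal (indicator {0..t} s * \<bar>g s\<bar>) \<le> grad_sup_norm (u s) * indicator {s. 0 \<le> s \<and> s < T} s"
      using AE_lborel_singleton[of T]
    proof eventually_elim
      case (elim s)
      show ?case using le[of s] t elim by (auto simp: indicator_def)
    qed
  qed
  also have "\<dots> \<le> ennreal J" by (rule J)
  finally have "(LINT s:{0..t}|lborel. \<bar>g s\<bar>) \<le> J" using J(2) by (simp add: ennreal_le_iff)
  with 1 have "ln (1 + gradsq t) \<le> ln (1 + gradsq 0) + 2 * J" by simp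
  then have "exp (ln (1 + gradsq t)) \<le> exp (ln (1 + gradsq 0) + 2 * J)" by simp
  then show ?thesis using pos[of t] pos[of 0] by (simp add: exp_add)
qed

lemma norm_advect_b:
  assumes v: "good_field v" and K: "gradsq t \<le> K"
  shows "norm (advect v (b t)) \<le> 2 * cw * unorm v * sqrt K"
proof -
  have n: "norm (weak_deriv 1 0 (b t)) \<le> sqrt K" "norm (weak_deriv 0 1 (b t)) \<le> sqrt K"
  proof -
    have "(norm (weak_deriv 1 0 (b t)))\<^sup>2 \<le> K" "(norm (weak_deriv 0 1 (b t)))\<^sup>2 \<le> K"
      using K zero_le_power2[of "norm (weak_deriv 1 0 (b t))"] zero_le_power2[of "norm (weak_deriv 0 1 (b t))"]
      unfolding gradsq_def by linarith+
    then show "norm (weak_deriv 1 0 (b t)) \<le> sqrt K" "norm (weak_deriv 0 1 (b t)) \<le> sqrt K"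
      by (auto intro: real_le_rsqrt)
  qed
  have "norm (advect v (b t)) \<le> wnorm (fst v) * norm (weak_deriv 1 0 (b t)) + wnorm (snd v) * norm (weak_deriv 0 1 (b t))"
    by (intro norm_advect_le good_field_wiener v)
  also have "\<dots> \<le> (cw * unorm v) * sqrt K + (cw * unorm v) * sqrt K"
    by (intro add_mono mult_mono good_field_wiener v n) (auto simp: cw_nonneg unorm_nonneg)
  finally show ?thesis by (simp add: mult_ac)
qed

lemma advect_diff:
  assumes "good_field v" "w \<in> sobolev 1" "w' \<in> sobolev 1"
  shows "advect v (w - w') = advect v w - advect v w'"
  using assms(2,3)
  by (simp add: advect_def weak_deriv_diff[where m = 1] wiener_mult_diff_right good_field_wiener[OF assms(1)])

lemma unorm_u_le:
  assumes "t \<in> {0..T}"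
  shows "unorm (u t) \<le> 2 / min 1 \<alpha> * (norm (\<omega> t) + norm f)"
proof -
  have "unorm (u t) \<le> 2 / min 1 \<alpha> * norm (\<omega> t - f)" by (rule velocity_good_field[OF alpha wiener_vort[OF assms]])
  also have "\<dots> \<le> 2 / min 1 \<alpha> * (norm (\<omega> t) + norm f)"
    using c_pos by (intro mult_left_mono norm_triangle_ineq4) auto
  finally show ?thesis .
qed

lemma vorticity_bound:
  assumes K: "\<And>s. s \<in> {0..T} \<Longrightarrow> gradsq s \<le> K" "0 \<le> K"
    and C: "C = 4 * cw * sqrt K * (2 / min 1 \<alpha> * (1 + norm f) + unorm u\<^sub>h)"
    and t: "t \<in> {0..T}"
  shows "(norm (\<omega> t))\<^sup>2 \<le> (1 + (norm \<omega>\<^sub>0)\<^sup>2) * exp (C * t)"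
proof -
  define y where "y s = 1 + (norm (\<omega> s))\<^sup>2" for s
  have "y t \<le> y 0 * exp (C * t)"
  proof (rule gronwall_deriv[OF _ _ t])
    fix s assume s: "s \<in> {0..T}"
    have "((\<lambda>t. inner (\<omega> t) (\<omega> t)) has_real_derivative 2 * inner (- \<omega>' s) (\<omega> s)) (at s within {0..T})"
      by (rule symmetric_form_derivative[OF o_deriv[OF s] continuous_sobolev_l2[OF co] s inner_commute])
    then show "(y has_real_derivative 2 * inner (- \<omega>' s) (\<omega> s)) (at s within {0..T})"
      unfolding y_def[abs_def] power2_norm_eq_inner by (auto intro!: derivative_eq_intros)
    have o1: "\<omega> s \<in> sobolev 1" "b s \<in> sobolev 1"
      by (rule sobolev_mono[OF o_sob[OF s]] sobolev_mono[OF b_sob[OF s]]; simp)+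
    have "inner (- \<omega>' s) (\<omega> s) = inner (advect (u s) (b s)) (\<omega> s) - inner (advect u\<^sub>h (b s)) (\<omega> s)"
      using advect_skew[OF good_u[OF s] o1(1)]
      by (simp add: \<omega>'_def advect_diff[OF good_u[OF s] o1] inner_add_left inner_diff_left)
    also have "\<dots> \<le> norm (advect (u s) (b s)) * norm (\<omega> s) + norm (advect u\<^sub>h (b s)) * norm (\<omega> s)"
      using Cauchy_Schwarz_ineq2[of "advect (u s) (b s)" "\<omega> s"] Cauchy_Schwarz_ineq2[of "advect u\<^sub>h (b s)" "\<omega> s"] by linarith
    also have "\<dots> \<le> (2 * cw * unorm (u s) * sqrt K) * norm (\<omega> s) + (2 * cw * unorm u\<^sub>h * sqrt K) * norm (\<omega> s)"
      by (intro add_mono mult_right_mono norm_advect_b good_u good_uh K s) auto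
    also have "\<dots> = 2 * cw * sqrt K * ((unorm (u s) + unorm u\<^sub>h) * norm (\<omega> s))" by (simp add: algebra_simps)
    also have "\<dots> \<le> 2 * cw * sqrt K * ((2 / min 1 \<alpha> * (1 + norm f) + unorm u\<^sub>h) * y s)"
    proof (intro mult_left_mono)
      let ?n = "norm (\<omega> s)" and ?c = "2 / min 1 \<alpha>"
      have c0: "0 \<le> ?c" using c_pos by simp
      have ny: "?n \<le> y s" "?n * ?n \<le> y s"
        using sum_squares_bound[of ?n 1] by (simp_all add: y_def power2_eq_square)
          (use zero_le_square[of ?n] in linarith)
      have "(unorm (u s) + unorm u\<^sub>h) * ?n \<le> (?c * (?n + norm f) + unorm u\<^sub>h) * ?n"
        by (intro mult_right_mono add_right_mono unorm_u_le s) auto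
      also have "\<dots> = ?c * (?n * ?n) + ?c * norm f * ?n + unorm u\<^sub>h * ?n" by (simp only: algebra_simps)
      also have "\<dots> \<le> ?c * y s + ?c * norm f * y s + unorm u\<^sub>h * y s"
        by (intro add_mono mult_left_mono ny mult_nonneg_nonneg c0 unorm_nonneg norm_ge_zero)
      also have "\<dots> = (?c * (1 + norm f) + unorm u\<^sub>h) * y s" by (simp only: algebra_simps)
      finally show "(unorm (u s) + unorm u\<^sub>h) * ?n \<le> (?c * (1 + norm f) + unorm u\<^sub>h) * y s" .
    qed (auto simp: cw_nonneg K)
    finally have "2 * inner (- \<omega>' s) (\<omega> s) \<le> 2 * (2 * cw * sqrt K * ((2 / min 1 \<alpha> * (1 + norm f) + unorm u\<^sub>h) * y s))"
      by (rule mult_left_mono) simp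
    also have "2 * (2 * cw * sqrt K * (Z * y s)) = 4 * cw * sqrt K * Z * y s" for Z by simp
    finally show "2 * inner (- \<omega>' s) (\<omega> s) \<le> C * y s" unfolding C .
  qed
  then show ?thesis by (simp add: y_def o_0)
qed

lemma buoyancy_bound:
  assumes U: "\<And>s. s \<in> {0..T} \<Longrightarrow> unorm (u s) \<le> U"
    and C: "C = 36 * cw * U * 3 ^ 4" and t: "t \<in> {0..T}"
  shows "(sobolev_norm 3 (b t))\<^sup>2 \<le> csob 3 * hs 3 b\<^sub>0 * exp (csob 3 * C * t)"
proof -
  let ?\<sigma> = "\<lambda>s. (sobolev_norm 3 (b s))\<^sup>2"
  have U0: "0 \<le> U" using order_trans[OF unorm_nonneg U[OF t]] .
  have c\<sigma>: "continuous_on {0..T} ?\<sigma>" by (rule continuous_sobolev_norm[OF cb])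
  show ?thesis
  proof (rule gronwall_integral[OF c\<sigma> _ _ t])
    show "0 \<le> csob 3 * C" using U0 by (simp add: C csob_nonneg cw_nonneg)
    fix s assume s: "s \<in> {0..T}"
    have "hs 3 (b s) \<le> hs 3 (b 0) + integral {0..s} (\<lambda>r. C * ?\<sigma> r)"
    proof (rule energy_limit[OF b_deriv _ _ _ _ s])
      show "continuous_on {0..T} (\<lambda>r. C * ?\<sigma> r)" by (intro continuous_intros c\<sigma>)
      fix r N assume r: "r \<in> {0..T}"
      have "- wsum 3 N (b r) (b' r) \<le> 18 * cw * unorm (u r) * hs 3 (b r)"
        unfolding b'_def by (rule abs_le_D2[OF energy_estimate_3[OF good_u[OF r] b_sob[OF r]]])
      also have "\<dots> \<le> 18 * cw * U * (3 ^ (3 + 1) * ?\<sigma> r)"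
        by (intro mult_mono U r sobolev_imp_fsob b_sob) (auto simp: cw_nonneg U0 hs_nonneg unorm_nonneg)
      finally show "2 * wsum 3 N (b r) (- b' r) \<le> C * ?\<sigma> r"
        by (simp add: C wsum_uminus)
    qed (simp_all add: sobolev_imp_fsob(1)[OF b_sob])
    then have "csob 3 * hs 3 (b s) \<le> csob 3 * (hs 3 b\<^sub>0 + C * integral {0..s} ?\<sigma>)"
      by (intro mult_left_mono csob_nonneg) (simp add: b_0)
    then show "?\<sigma> s \<le> csob 3 * hs 3 b\<^sub>0 + csob 3 * C * integral {0..s} ?\<sigma>"
      using sobolev_norm_le[OF b_sob[OF s]] by (simp add: distrib_left mult.assoc)
  qed
qed

lemma vorticity_sobolev_bound:
  assumes U: "\<And>s. s \<in> {0..T} \<Longrightarrow> unorm (u s) \<le> U"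
    and H: "\<And>s. s \<in> {0..T} \<Longrightarrow> hs 3 (b s) \<le> H"
    and C: "C = (16 * cw * U + 8 * cw * U * sqrt H + 8 * cw * unorm u\<^sub>h * sqrt H) * 3 ^ 3" and t: "t \<in> {0..T}"
  shows "1 + (sobolev_norm 2 (\<omega> t))\<^sup>2 \<le> (1 + csob 2 * hs 2 \<omega>\<^sub>0) * exp (csob 2 * C * t)"
proof -
  let ?y = "\<lambda>s. 1 + (sobolev_norm 2 (\<omega> s))\<^sup>2"
  have U0: "0 \<le> U" using order_trans[OF unorm_nonneg U[OF t]] .
  have H0: "0 \<le> H" using order_trans[OF hs_nonneg H[OF t]] .
  have cy: "continuous_on {0..T} ?y" by (intro continuous_intros continuous_sobolev_norm[OF co])
  show ?thesis
  proof (rule gronwall_integral[OF cy _ _ t])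
    show "0 \<le> csob 2 * C" using U0 H0 by (simp add: C csob_nonneg cw_nonneg unorm_nonneg)
    fix s assume s: "s \<in> {0..T}"
    have "hs 2 (\<omega> s) \<le> hs 2 (\<omega> 0) + integral {0..s} (\<lambda>r. C * ?y r)"
    proof (rule energy_limit[OF o_deriv _ _ _ _ s])
      show "continuous_on {0..T} (\<lambda>r. C * ?y r)" by (intro continuous_intros cy)
      fix r N assume r: "r \<in> {0..T}"
      let ?S = "\<lambda>v w. wsum 2 N (\<omega> r) (advect v w)"
      let ?h = "hs 2 (\<omega> r)"
      have fo: "fsob 2 (\<omega> r)" "?h \<le> 3 ^ (2 + 1) * (sobolev_norm 2 (\<omega> r))\<^sup>2"
        using sobolev_imp_fsob[OF o_sob[OF r]] by auto
      have o1: "\<omega> r \<in> sobolev 1" "b r \<in> sobolev 1"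
        by (rule sobolev_mono[OF o_sob[OF r]] sobolev_mono[OF b_sob[OF r]]; simp)+
      have sq: "sqrt ?h \<le> 1 + ?h"
        using hs_nonneg[of 2 "\<omega> r"] by (intro real_le_lsqrt) (auto simp: power2_eq_square algebra_simps)
      have force: "\<bar>?S v (b r)\<bar> \<le> 4 * cw * V * (1 + ?h) * sqrt H" if "good_field v" "unorm v \<le> V" for v V
      proof -
        have V: "0 \<le> V" using order_trans[OF unorm_nonneg that(2)] .
        have "\<bar>?S v (b r)\<bar> \<le> 4 * cw * unorm v * sqrt ?h * sqrt (hs 3 (b r))"
          by (rule forcing_estimate[OF that(1) b_sob[OF r] fo(1)])
        also have "\<dots> \<le> 4 * cw * V * (1 + ?h) * sqrt H"
          using that(2) sq H[OF r] V by (intro mult_mono) (auto simp: cw_nonneg hs_nonneg H0 unorm_nonneg add_nonneg_nonneg)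
        finally show ?thesis .
      qed
      have "\<bar>?S (u r) (\<omega> r)\<bar> \<le> 8 * cw * unorm (u r) * ?h" by (rule energy_estimate_2[OF good_u[OF r] o_sob[OF r]])
      also have "\<dots> \<le> 8 * cw * U * (1 + ?h)"
        using U[OF r] U0 by (intro mult_mono) (auto simp: cw_nonneg hs_nonneg unorm_nonneg)
      finally have e1: "\<bar>?S (u r) (\<omega> r)\<bar> \<le> 8 * cw * U * (1 + ?h)" .
      have "wsum 2 N (\<omega> r) (- \<omega>' r) = ?S (u r) (b r) - ?S (u r) (\<omega> r) - ?S u\<^sub>h (b r)"
        by (simp add: \<omega>'_def advect_diff[OF good_u[OF r] o1] wsum_uminus wsum_add wsum_diff)
      also have "2 * \<dots> \<le> 2 * (4 * cw * U * (1 + ?h) * sqrt H + 8 * cw * U * (1 + ?h) + 4 * cw * unorm u\<^sub>h * (1 + ?h) * sqrt H)"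
      proof (rule mult_left_mono)
        show "?S (u r) (b r) - ?S (u r) (\<omega> r) - ?S u\<^sub>h (b r) \<le>
            4 * cw * U * (1 + ?h) * sqrt H + 8 * cw * U * (1 + ?h) + 4 * cw * unorm u\<^sub>h * (1 + ?h) * sqrt H"
          using abs_le_D2[OF e1] abs_le_D1[OF force[OF good_u[OF r] U[OF r]]] abs_le_D2[OF force[OF good_uh order_refl]]
          by linarith
      qed simp
      also have "\<dots> = (16 * cw * U + 8 * cw * U * sqrt H + 8 * cw * unorm u\<^sub>h * sqrt H) * (1 + ?h)" by (simp add: algebra_simps)
      also have "\<dots> \<le> (16 * cw * U + 8 * cw * U * sqrt H + 8 * cw * unorm u\<^sub>h * sqrt H) * (3 ^ 3 * ?y r)"
        using fo(2) U0 H0 by (intro mult_left_mono) (auto simp: cw_nonneg unorm_nonneg)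
      finally show "2 * wsum 2 N (\<omega> r) (- \<omega>' r) \<le> C * ?y r"
        unfolding C by (simp only: mult.assoc)
    qed (simp_all add: sobolev_imp_fsob(1)[OF o_sob])
    then have "csob 2 * hs 2 (\<omega> s) \<le> csob 2 * (hs 2 \<omega>\<^sub>0 + C * integral {0..s} ?y)"
      by (intro mult_left_mono csob_nonneg) (simp add: o_0)
    then show "?y s \<le> 1 + csob 2 * hs 2 \<omega>\<^sub>0 + csob 2 * C * integral {0..s} ?y"
      using sobolev_norm_le[OF o_sob[OF s]] by (simp add: distrib_left mult.assoc)
  qed
qed

end

theorem theorem5p4:
  fixes \<alpha> :: real and h f b\<^sub>0 \<omega>\<^sub>0 :: l2 and u\<^sub>h :: "l2 \<times> l2"
    and b \<omega> :: "real \<Rightarrow> l2" and Tmax :: ereal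
  assumes "\<alpha> > 0"
    and "h \<in> sobolev 1" and "u\<^sub>h = (1 / 2) *\<^sub>R grad_perp h" and "u\<^sub>h \<in> sobolev_div 3"
    and "f \<in> sobolev 2" and "b\<^sub>0 \<in> sobolev 3" and "\<omega>\<^sub>0 \<in> sobolev 2"
    and "average h = 0" and "average f = 0" and "average b\<^sub>0 = 0" and "average \<omega>\<^sub>0 = 0"
    and "maximal_solution \<alpha> u\<^sub>h f b\<^sub>0 \<omega>\<^sub>0 b \<omega> Tmax"
    and "Tmax < \<infinity>"
  shows "(\<integral>\<^sup>+ t \<in> {t. 0 \<le> t \<and> ereal t < Tmax}. grad_sup_norm (velocity \<alpha> f (\<omega> t)) \<partial>lborel) = \<infinity>"
proof (rule ccontr)
  let ?J = "\<integral>\<^sup>+ t \<in> {t. 0 \<le> t \<and> ereal t < Tmax}. grad_sup_norm (velocity \<alpha> f (\<omega> t)) \<partial>lborel"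
  assume "?J \<noteq> \<infinity>"
  then obtain J where J: "?J = ennreal J" "0 \<le> J" by (cases ?J) auto
  obtain S where S: "0 < Tmax" "incseq S" "(\<lambda>n. ereal (S n)) \<longlonglongrightarrow> Tmax"
    "\<And>n. local_strong_solution \<alpha> u\<^sub>h f b\<^sub>0 \<omega>\<^sub>0 b \<omega> (S n)"
    "limsup (\<lambda>n. ereal ((M_norm (b (S n), \<omega> (S n)))\<^sup>2)) = \<infinity>"
    using assms(12,13) unfolding maximal_solution_def by blast
  obtain Tm where Tm: "Tmax = ereal Tm" using S(1) assms(13) by (cases Tmax) auto
  have STm: "S n \<le> Tm" for n
  proof -
    have "incseq (\<lambda>n. ereal (S n))" using S(2) by (simp add: incseq_def)
    from incseq_le[OF this S(3), of n] show ?thesis by (simp add: Tm)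
  qed
  define K1 where "K1 = (1 + ((norm (weak_deriv 1 0 b\<^sub>0))\<^sup>2 + (norm (weak_deriv 0 1 b\<^sub>0))\<^sup>2)) * exp (2 * J)"
  define C2 where "C2 = 4 * cw * sqrt K1 * (2 / min 1 \<alpha> * (1 + norm f) + unorm u\<^sub>h)"
  define K2 where "K2 = (1 + (norm \<omega>\<^sub>0)\<^sup>2) * exp (C2 * Tm)"
  define U where "U = 2 / min 1 \<alpha> * (sqrt K2 + norm f)"
  define C3 where "C3 = 36 * cw * U * 3 ^ 4"
  define K3 where "K3 = csob 3 * hs 3 b\<^sub>0 * exp (csob 3 * C3 * Tm)"
  define H where "H = 3 ^ (3 + 1) * K3"
  define C4 where "C4 = (16 * cw * U + 8 * cw * U * sqrt H + 8 * cw * unorm u\<^sub>h * sqrt H) * 3 ^ 3"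
  define K4 where "K4 = (1 + csob 2 * hs 2 \<omega>\<^sub>0) * exp (csob 2 * C4 * Tm)"
  have c: "0 < min 1 \<alpha>" using assms(1) by simp
  have K1: "0 \<le> K1" by (simp add: K1_def)
  have C2: "0 \<le> C2" using c K1 by (simp add: C2_def cw_nonneg unorm_nonneg)
  have K2: "0 \<le> K2" by (simp add: K2_def)
  have U: "0 \<le> U" using c K2 by (simp add: U_def)
  have C3: "0 \<le> C3" using U by (simp add: C3_def cw_nonneg)
  have K3: "0 \<le> K3" by (simp add: K3_def csob_nonneg hs_nonneg)
  have C4: "0 \<le> C4" using U K3 by (simp add: C4_def H_def cw_nonneg unorm_nonneg)
  have bound: "(M_norm (b (S n), \<omega> (S n)))\<^sup>2 \<le> (sqrt K3 + sqrt K4)\<^sup>2" for n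
  proof -
    interpret strong_solution \<alpha> u\<^sub>h f b\<^sub>0 \<omega>\<^sub>0 b \<omega> "S n"
      by unfold_locales (use assms S in auto)
    have emono: "exp (C * t) \<le> exp (C * Tm)" if "0 \<le> C" "t \<in> {0..S n}" for C t
      using that STm[of n] by (auto intro!: mult_left_mono)
    have "(\<integral>\<^sup>+ s \<in> {s. 0 \<le> s \<and> s < S n}. grad_sup_norm (u s) \<partial>lborel) \<le> ?J"
      using STm[of n] by (intro nn_integral_mono mult_left_mono) (auto simp: Tm indicator_def)
    then have J': "(\<integral>\<^sup>+ s \<in> {s. 0 \<le> s \<and> s < S n}. grad_sup_norm (u s) \<partial>lborel) \<le> ennreal J" using J by simp
    have k1: "gradsq t \<le> K1" if "t \<in> {0..S n}" for t
      using gradient_bound[OF J' J(2) that] by (simp add: K1_def gradsq_def b_0)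
    have k2: "(norm (\<omega> t))\<^sup>2 \<le> K2" if "t \<in> {0..S n}" for t
    proof -
      have "(norm (\<omega> t))\<^sup>2 \<le> (1 + (norm \<omega>\<^sub>0)\<^sup>2) * exp (C2 * t)"
        by (rule vorticity_bound[OF k1 K1 C2_def that])
      also have "\<dots> \<le> K2" unfolding K2_def by (intro mult_left_mono emono C2 that) simp
      finally show ?thesis .
    qed
    have u: "unorm (u t) \<le> U" if "t \<in> {0..S n}" for t
    proof -
      have "norm (\<omega> t) \<le> sqrt K2" by (rule real_le_rsqrt[OF k2[OF that]])
      then have "2 / min 1 \<alpha> * (norm (\<omega> t) + norm f) \<le> U" unfolding U_def using c by (intro mult_left_mono) auto
      then show ?thesis by (rule order_trans[OF unorm_u_le[OF that]])
    qed
    have k3: "(sobolev_norm 3 (b t))\<^sup>2 \<le> K3" if "t \<in> {0..S n}" for t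
    proof -
      have "(sobolev_norm 3 (b t))\<^sup>2 \<le> csob 3 * hs 3 b\<^sub>0 * exp (csob 3 * C3 * t)"
        by (rule buoyancy_bound[OF u C3_def that])
      also have "\<dots> \<le> K3" unfolding K3_def
        by (intro mult_left_mono emono that) (auto simp: C3 csob_nonneg hs_nonneg)
      finally show ?thesis .
    qed
    have hH: "hs 3 (b t) \<le> H" if "t \<in> {0..S n}" for t
      using sobolev_imp_fsob(2)[OF b_sob[OF that]] k3[OF that] unfolding H_def by simp
    have Sn: "S n \<in> {0..S n}" using T_pos by simp
    have "1 + (sobolev_norm 2 (\<omega> (S n)))\<^sup>2 \<le> (1 + csob 2 * hs 2 \<omega>\<^sub>0) * exp (csob 2 * C4 * S n)"
      by (rule vorticity_sobolev_bound[OF u hH C4_def Sn])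
    also have "\<dots> \<le> K4" unfolding K4_def
      by (intro mult_left_mono emono Sn) (auto simp: C4 csob_nonneg hs_nonneg)
    finally have "(sobolev_norm 2 (\<omega> (S n)))\<^sup>2 \<le> K4" by simp
    then have "sobolev_norm 2 (\<omega> (S n)) \<le> sqrt K4" by (rule real_le_rsqrt)
    moreover have "sobolev_norm 3 (b (S n)) \<le> sqrt K3" by (rule real_le_rsqrt[OF k3[OF Sn]])
    ultimately show ?thesis
      unfolding M_norm_def by (intro power_mono) (auto simp: sobolev_norm_nonneg)
  qed
  have "limsup (\<lambda>n. ereal ((M_norm (b (S n), \<omega> (S n)))\<^sup>2)) \<le> ereal ((sqrt K3 + sqrt K4)\<^sup>2)"
    by (rule Limsup_bounded) (use bound in auto)
  then show False using S(5) by simp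
qed

end
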